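(* Let $G$ be a simple group of type $A_n$, and let $K=N^\vee/Q^\vee$ be the corresponding subgroup of $P^\vee/Q^\vee$. A stratum $X=X(\mathcal{H},K,L)$ in the Jordan stratification of $G/\!/G$ is normal if and only if the stratum $X(\mathcal{H},L)$ in $\mathrm{SL}_{n+1}/\!/\mathrm{SL}_{n+1}$ is normal.
   Context: $\Phi$ is the root system of type $A_n$, with Weyl group $W$, coroot lattice $Q^\vee$, coweight lattice $P^\vee$, $E=Q^\vee\otimes_{\mathbb{Z}}\mathbb{R}$ with direction $V$, $E_{\mathbb{C}}=E+iV$. $\mathcal{H}$ is the set of affine hyperplanes $\{x\in E:\alpha(x)=m\}$, $\alpha\in\Phi$, $m\in\mathbb{Z}$; $\mathcal{W}_{\mathcal{H}}=W\ltimes Q^\vee$. $G$ is the connected simple complex algebraic group with root system $\Phi$ and cocharacter lattice $N^\vee$, $Q^\vee\subset N^\vee\subset P^\vee$; $K=N^\vee/Q^\vee$ and $\mathcal{W}_{\mathcal{H},K}=W\ltimes N^\vee\simeq K\ltimes\mathcal{W}_{\mathcal{H}}$. A flat $L$ is a nonempty intersection of elements of $\mathcal{H}$ ($E$ included), $L_{\mathbb{C}}=L+iV(L)$ with $V(L)$ its direction. $X(\mathcal{H},K,L)=\mathcal{W}_{\mathcal{H},K}L_{\mathbb{C}}/\mathcal{W}_{\mathcal{H},K}$ and $X(\mathcal{H},L)=\mathcal{W}_{\mathcal{H}}L_{\mathbb{C}}/\mathcal{W}_{\mathcal{H}}$, viewed as closed reduced subvarieties of $E_{\mathbb{C}}/\mathcal{W}_{\mathcal{H},K}\simeq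 T/W\simeq G/\!/G$ and of $E_{\mathbb{C}}/\mathcal{W}_{\mathcal{H}}\simeq\mathrm{SL}_{n+1}/\!/\mathrm{SL}_{n+1}$ respectively (isomorphisms induced by $\exp(2\pi i\,-)$ and Chevalley's isomorphism, $T$ a maximal torus of $G$). They are the quotients $\overline{J}/\!/G$ of closures of semisimple Jordan classes (strata of the Jordan stratification), the Jordan class of a semisimple $s$ being $G\cdot(Z(M)^\circ s)^{reg}$ with $M=C_G(s)^\circ$, where $reg$ denotes the points whose $G$-orbit has maximal dimension. *)

theory Defs
  imports "HOL-Analysis.Analysis" "HOL-Algebra.Polynomials"
begin

section \<open>Integrally closed domains\<close>

text \<open>
  The field of fractions of a domain \<open>R\<close>: classes of pairs \<open>(a, b)\<close> with \<open>b\<close> nonzero, where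
  \<open>(a, b)\<close> and \<open>(c, d)\<close> are identified when \<open>a d = b c\<close>.
\<close>

definition frac_pairs :: "('a, 'b) ring_scheme \<Rightarrow> ('a \<times> 'a) set" where
  "frac_pairs R = carrier R \<times> (carrier R - {\<zero>\<^bsub>R\<^esub>})"

definition frac_rel :: "('a, 'b) ring_scheme \<Rightarrow> (('a \<times> 'a) \<times> ('a \<times> 'a)) set" where
  "frac_rel R = {((a, b), (c, d)) | a b c d.
      (a, b) \<in> frac_pairs R \<and> (c, d) \<in> frac_pairs R \<and> a \<otimes>\<^bsub>R\<^esub> d = b \<otimes>\<^bsub>R\<^esub> c}"

definition frac_class :: "('a, 'b) ring_scheme \<Rightarrow> 'a \<Rightarrow> 'a \<Rightarrow> ('a \<times> 'a) set" where
  "frac_class R a b = frac_rel R `` {(a, b)}"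

definition frac_field :: "('a, 'b) ring_scheme \<Rightarrow> ('a \<times> 'a) set ring" where
  "frac_field R =
    \<lparr>carrier = frac_pairs R // frac_rel R,
     mult = (\<lambda>x y. \<Union>(a, b)\<in>x. \<Union>(c, d)\<in>y. frac_class R (a \<otimes>\<^bsub>R\<^esub> c) (b \<otimes>\<^bsub>R\<^esub> d)),
     one = frac_class R \<one>\<^bsub>R\<^esub> \<one>\<^bsub>R\<^esub>,
     zero = frac_class R \<zero>\<^bsub>R\<^esub> \<one>\<^bsub>R\<^esub>,
     add = (\<lambda>x y. \<Union>(a, b)\<in>x. \<Union>(c, d)\<in>y.
        frac_class R ((a \<otimes>\<^bsub>R\<^esub> d) \<oplus>\<^bsub>R\<^esub> (b \<otimes>\<^bsub>R\<^esub> c)) (b \<otimes>\<^bsub>R\<^esub> d))\<rparr>"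

definition frac_embed :: "('a, 'b) ring_scheme \<Rightarrow> 'a \<Rightarrow> ('a \<times> 'a) set" where
  "frac_embed R a = frac_class R a \<one>\<^bsub>R\<^esub>"

text \<open>Polynomials of HOL-Algebra are coefficient lists, leading coefficient first.\<close>

definition integral_over :: "('a, 'b) ring_scheme \<Rightarrow> 'a set \<Rightarrow> 'a \<Rightarrow> bool" where
  "integral_over F S x \<longleftrightarrow>
    (\<exists>p. polynomial\<^bsub>F\<^esub> S p \<and> p \<noteq> [] \<and> lead_coeff p = \<one>\<^bsub>F\<^esub> \<and> ring.eval F p x = \<zero>\<^bsub>F\<^esub>)"

definition integrally_closed_domain :: "('a, 'b) ring_scheme \<Rightarrow> bool" where
  "integrally_closed_domain R \<longleftrightarrow>
    domain R \<and>
    (\<forall>x \<in> carrier (frac_field R).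
       integral_over (frac_field R) (frac_embed R ` carrier R) x \<longrightarrow> x \<in> frac_embed R ` carrier R)"

section \<open>The root system of type A\<close>

text \<open>
  With \<open>CARD('n) = n + 1\<close>, the root system of type \<open>A\<^sub>n\<close> lives in the hyperplane \<open>E\<close> of vectors of
  \<open>real ^ 'n\<close> with coordinate sum zero. The origin of the affine space \<open>E\<close> is fixed, so \<open>E\<close> is
  identified with its direction \<open>V\<close>, and linear forms on \<open>V\<close> are identified with vectors of \<open>V\<close>
  through the inner product.
\<close>

definition E_space :: "(real ^ 'n) set" where
  "E_space = {x. (\<Sum>i\<in>UNIV. x $ i) = 0}"

definition roots :: "(real ^ 'n) set" where
  "roots = {axis i 1 - axis j 1 | i j. i \<noteq> j}"

definition coroot :: "real ^ 'n \<Rightarrow> real ^ 'n" where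
  "coroot \<alpha> = (2 / (\<alpha> \<bullet> \<alpha>)) *\<^sub>R \<alpha>"

definition coroot_lattice :: "(real ^ 'n) set" where
  "coroot_lattice = {\<Sum>\<alpha>\<in>roots. of_int (c \<alpha>) *\<^sub>R coroot \<alpha> | c :: real ^ 'n \<Rightarrow> int. True}"

definition coweight_lattice :: "(real ^ 'n) set" where
  "coweight_lattice = {x \<in> E_space. \<forall>\<alpha>\<in>roots. \<alpha> \<bullet> x \<in> \<int>}"

text \<open>
  The possible cocharacter lattices \<open>N\<^sup>\<or>\<close> of the connected simple groups \<open>G\<close> with this root system;
  \<open>G\<close> is determined by \<open>N\<^sup>\<or>\<close>, and \<open>K = N\<^sup>\<or>/Q\<^sup>\<or>\<close>.
\<close>

definition cocharacter_lattice :: "(real ^ 'n) set \<Rightarrow> bool" where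
  "cocharacter_lattice N \<longleftrightarrow>
    coroot_lattice \<subseteq> N \<and> N \<subseteq> coweight_lattice \<and> (\<forall>x\<in>N. \<forall>y\<in>N. x - y \<in> N)"

definition reflection :: "real ^ 'n \<Rightarrow> real ^ 'n \<Rightarrow> real ^ 'n" where
  "reflection \<alpha> x = x - (\<alpha> \<bullet> x) *\<^sub>R coroot \<alpha>"

text \<open>Reflections are involutions, so the monoid they generate is the Weyl group.\<close>

inductive_set weyl_group :: "(real ^ 'n \<Rightarrow> real ^ 'n) set" where
  weyl_id: "id \<in> weyl_group"
| weyl_reflection: "w \<in> weyl_group \<Longrightarrow> \<alpha> \<in> roots \<Longrightarrow> reflection \<alpha> \<circ> w \<in> weyl_group"

definition hyperplanes :: "(real ^ 'n) set set" where
  "hyperplanes = {{x \<in> E_space. \<alpha> \<bullet> x = of_int m} | \<alpha> (m :: int). \<alpha> \<in> roots}"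

definition is_flat :: "(real ^ 'n) set \<Rightarrow> bool" where
  "is_flat L \<longleftrightarrow> L \<noteq> {} \<and> (\<exists>S \<subseteq> hyperplanes. L = E_space \<inter> \<Inter>S)"

section \<open>Complexification and the extended affine Weyl group\<close>

definition cvec :: "real ^ 'n \<Rightarrow> real ^ 'n \<Rightarrow> complex ^ 'n" where
  "cvec x y = (\<chi> i. Complex (x $ i) (y $ i))"

text \<open>\<open>L + i V(L)\<close>, where \<open>V(L) = {u - v | u v. u \<in> L \<and> v \<in> L}\<close> for an affine subspace \<open>L\<close>.\<close>

definition complexify :: "(real ^ 'n) set \<Rightarrow> (complex ^ 'n) set" where
  "complexify L = {cvec x (u - v) | x u v. x \<in> L \<and> u \<in> L \<and> v \<in> L}"

definition extend_map :: "(real ^ 'n \<Rightarrow> real ^ 'n) \<Rightarrow> complex ^ 'n \<Rightarrow> complex ^ 'n" where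
  "extend_map w z = cvec (w (\<chi> i. Re (z $ i))) (w (\<chi> i. Im (z $ i)))"

text \<open>\<open>W \<ltimes> N\<close>; for \<open>N\<close> the coroot lattice this is the affine Weyl group of the arrangement.\<close>

definition ext_affine_weyl :: "(real ^ 'n) set \<Rightarrow> (complex ^ 'n \<Rightarrow> complex ^ 'n) set" where
  "ext_affine_weyl N = {\<lambda>z. extend_map w z + cvec \<nu> 0 | w \<nu>. w \<in> weyl_group \<and> \<nu> \<in> N}"

definition weyl_orbit :: "(real ^ 'n) set \<Rightarrow> complex ^ 'n \<Rightarrow> (complex ^ 'n) set" where
  "weyl_orbit N z = {g z | g. g \<in> ext_affine_weyl N}"

text \<open>The points of \<open>X(\<H>, K, L)\<close>, inside the orbit space of \<open>complexify E_space\<close>.\<close>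

definition stratum :: "(real ^ 'n) set \<Rightarrow> (real ^ 'n) set \<Rightarrow> (complex ^ 'n) set set" where
  "stratum N L = weyl_orbit N ` (\<Union>g\<in>ext_affine_weyl N. g ` complexify L)"

section \<open>The variety structure\<close>

definition character_lattice :: "(real ^ 'n) set \<Rightarrow> (real ^ 'n) set" where
  "character_lattice N = {\<mu> \<in> E_space. \<forall>\<nu>\<in>N. \<mu> \<bullet> \<nu> \<in> \<int>}"

definition cpair :: "real ^ 'n \<Rightarrow> complex ^ 'n \<Rightarrow> complex" where
  "cpair \<mu> z = (\<Sum>i\<in>UNIV. of_real (\<mu> $ i) * z $ i)"

text \<open>
  The regular functions on the torus \<open>T\<close> with cocharacter lattice \<open>N\<close> are the linear combinations
  of its characters. They are pulled back to the complexified space along \<open>exp(2 \<pi> i -)\<close>, under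
  which the character \<open>\<mu>\<close> becomes \<open>z \<mapsto> exp(2 \<pi> i \<mu>(z))\<close>. A function on the orbit
  space is regular on \<open>T/W\<close> when its pullback is regular on \<open>T\<close>; this pullback is automatically
  \<open>W\<close>-invariant, so the regular functions form \<open>\<complex>[T]\<^sup>W\<close>.
\<close>

definition torus_functions :: "(real ^ 'n) set \<Rightarrow> (complex ^ 'n \<Rightarrow> complex) set" where
  "torus_functions N =
    {\<lambda>z. \<Sum>\<mu>\<in>S. c \<mu> * exp (2 * of_real pi * \<i> * cpair \<mu> z) | S c.
       finite S \<and> S \<subseteq> character_lattice N}"

definition quotient_functions :: "(real ^ 'n) set \<Rightarrow> ((complex ^ 'n) set \<Rightarrow> complex) set" where
  "quotient_functions N =
    {f. \<exists>h \<in> torus_functions N. \<forall>z \<in> complexify E_space. f (weyl_orbit N z) = h z}"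

text \<open>
  The ring of restrictions to \<open>Y\<close> of the functions in \<open>A\<close>. For \<open>A\<close> the regular functions on an
  affine variety and \<open>Y\<close> a closed subset, this is the coordinate ring of \<open>Y\<close> with its reduced
  structure.
\<close>

definition restriction_ring :: "'x set \<Rightarrow> ('x \<Rightarrow> complex) set \<Rightarrow> ('x \<Rightarrow> complex) ring" where
  "restriction_ring Y A =
    \<lparr>carrier = (\<lambda>f. restrict f Y) ` A,
     mult = (\<lambda>f g. \<lambda>x\<in>Y. f x * g x),
     one = (\<lambda>x\<in>Y. 1),
     zero = (\<lambda>x\<in>Y. 0),
     add = (\<lambda>f g. \<lambda>x\<in>Y. f x + g x)\<rparr>"

definition coordinate_ring ::
    "(real ^ 'n) set \<Rightarrow> (complex ^ 'n) set set \<Rightarrow> ((complex ^ 'n) set \<Rightarrow> complex) ring" where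
  "coordinate_ring N Y = restriction_ring Y (quotient_functions N)"

definition normal_subvariety :: "(real ^ 'n) set \<Rightarrow> (complex ^ 'n) set set \<Rightarrow> bool" where
  "normal_subvariety N Y \<longleftrightarrow> integrally_closed_domain (coordinate_ring N Y)"

end

theory Submission
  imports Defs
begin

text \<open>
  Let \<open>C\<close> be the number of coordinates. Call two coordinates equivalent when their difference is a
  constant integer on the flat \<open>L\<close>; the classes are the blocks of \<open>L\<close>, and a flat is determined by
  its blocks and one of its points. In the torus coordinates \<open>t\<^sub>i = exp(2 \<pi> i z\<^sub>i)\<close> the points of
  \<open>L + i V(L)\<close> are those of a torus coset on which \<open>t\<close> takes one value \<open>t\<^sub>b\<close> on each block \<open>b\<close>. For every
  cocharacter lattice \<open>N\<close> the stratum is normal if and only if all blocks have the same size.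
  This criterion does not mention \<open>N\<close>, so the theorem follows by applying it to \<open>N\<close> and to the
  coroot lattice.

  Both halves of the criterion start from an elementary form of integral closedness
  (\<open>normal_subvariety_iff\<close>): the coordinate ring consists of the restrictions to \<open>L + i V(L)\<close> of
  exponential sums invariant under the Weyl group and \<open>N\<close>, and it has to contain every quotient
  \<open>a / b\<close> that satisfies a monic equation.

  If all blocks have size \<open>d\<close>, such a quotient is first shown to be an exponential sum \<open>h\<close> on the torus
  coset (\<open>torus_integrally_closed\<close>). It inherits the invariance under all permutations of
  the blocks, hence is a combination of monomial symmetric functions of the values \<open>t\<^sub>b\<close>. These are
  polynomials in the power sums of the \<open>t\<^sub>b\<close>, and a power sum of the \<open>t\<^sub>b\<close> is \<open>1/d\<close> times the power
  sum of all the \<open>t\<^sub>i\<close>, which is a symmetric function on the whole torus. The construction preserves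
  degrees, and the degree modulo \<open>C\<close> decides whether a character is one of \<open>N\<close>; so \<open>h\<close> is the
  restriction of an invariant function (\<open>normal_if_equal_blocks\<close>).

  If two blocks have different sizes \<open>p\<close> and \<open>q\<close>, consider the sum \<open>g\<close> of \<open>t\<^sub>b\<^sup>C\<close> over the blocks,
  each block counted once. It is integral over the coordinate ring and a quotient of two of its
  elements, obtained by averaging over all subsets with as many elements as there are blocks. At a
  point where all \<open>t\<^sub>i\<close> agree, move the first block with speed \<open>q\<close> and the second with speed
  \<open>-p\<close>: this stays in the torus coset, all invariant functions have derivative zero, but the
  derivative of \<open>g\<close> is a nonzero multiple of \<open>q - p\<close>. So \<open>g\<close> is not in the coordinate ring
  (\<open>not_normal_if_unequal_blocks\<close>).
\<close>

section \<open>Integrally closed rings of functions\<close>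

lemma (in domain) equiv_frac_rel: "equiv (frac_pairs R) (frac_rel R)"
proof (rule equivI)
  show "frac_rel R \<subseteq> frac_pairs R \<times> frac_pairs R"
    by (auto simp: frac_rel_def)
  show "refl_on (frac_pairs R) (frac_rel R)"
    by (auto simp: refl_on_def frac_rel_def frac_pairs_def m_comm)
  show "sym (frac_rel R)"
    by (auto simp: sym_def frac_rel_def frac_pairs_def m_comm)
  show "trans (frac_rel R)"
  proof (rule transI)
    fix x y z assume "(x, y) \<in> frac_rel R" "(y, z) \<in> frac_rel R"
    then obtain a b c d e f where xyz: "x = (a, b)" "y = (c, d)" "z = (e, f)"
      and cl: "a \<in> carrier R" "b \<in> carrier R" "c \<in> carrier R" "d \<in> carrier R" "e \<in> carrier R" "f \<in> carrier R"
      and nz: "b \<noteq> \<zero>" "d \<noteq> \<zero>" "f \<noteq> \<zero>"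
      and eq: "a \<otimes> d = b \<otimes> c" "c \<otimes> f = d \<otimes> e"
      by (auto simp: frac_rel_def frac_pairs_def)
    have "d \<otimes> (a \<otimes> f) = (a \<otimes> d) \<otimes> f" using cl by (simp add: m_ac)
    also have "\<dots> = b \<otimes> (c \<otimes> f)" using cl eq by (simp add: m_ac)
    also have "\<dots> = d \<otimes> (b \<otimes> e)" unfolding eq using cl by (simp add: m_ac)
    finally have "a \<otimes> f = b \<otimes> e" using cl nz m_lcancel by simp
    then show "(x, z) \<in> frac_rel R"
      using xyz cl nz by (auto simp: frac_rel_def frac_pairs_def)
  qed
qed

context domain
begin

abbreviation "F \<equiv> frac_field R"

lemma frac_class_eq_iff:
  assumes "a \<in> carrier R" "b \<in> carrier R" "b \<noteq> \<zero>" "c \<in> carrier R" "d \<in> carrier R" "d \<noteq> \<zero>"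
  shows "frac_class R a b = frac_class R c d \<longleftrightarrow> a \<otimes> d = b \<otimes> c"
proof -
  have "frac_class R a b = frac_class R c d \<longleftrightarrow> ((a, b), (c, d)) \<in> frac_rel R"
    unfolding frac_class_def using assms
    by (intro eq_equiv_class_iff[OF equiv_frac_rel]) (auto simp: frac_pairs_def)
  then show ?thesis using assms by (auto simp: frac_rel_def frac_pairs_def)
qed

lemma frac_class_mem:
  "a \<in> carrier R \<Longrightarrow> b \<in> carrier R \<Longrightarrow> b \<noteq> \<zero> \<Longrightarrow> frac_class R a b \<in> carrier F"
  by (auto simp: frac_field_def frac_class_def frac_pairs_def intro!: quotientI)

lemma frac_field_elem:
  assumes "x \<in> carrier F"
  obtains a b where "x = frac_class R a b" "a \<in> carrier R" "b \<in> carrier R" "b \<noteq> \<zero>"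
  using assms that by (auto simp: frac_field_def frac_class_def frac_pairs_def elim!: quotientE)

text \<open>
  The operations of the fraction field are unions over all pairs of representatives. Since the
  set does not depend on the representatives, the union is that set; this reduces each operation to
  computing with one pair of fractions.
\<close>
lemma UN_frac_class2:
  assumes f: "\<And>a' b' c' d'. \<lbrakk>a' \<in> carrier R; b' \<in> carrier R; b' \<noteq> \<zero>; a \<otimes> b' = b \<otimes> a';
      c' \<in> carrier R; d' \<in> carrier R; d' \<noteq> \<zero>; c \<otimes> d' = d \<otimes> c'\<rbrakk> \<Longrightarrow> f a' b' c' d' = f a b c d"
    and cl: "a \<in> carrier R" "b \<in> carrier R" "b \<noteq> \<zero>" "c \<in> carrier R" "d \<in> carrier R" "d \<noteq> \<zero>"
  shows "(\<Union>(a, b)\<in>frac_class R a b. \<Union>(c, d)\<in>frac_class R c d. f a b c d) = f a b c d"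
proof -
  have cls: "frac_class R a b = {(a', b'). a' \<in> carrier R \<and> b' \<in> carrier R \<and> b' \<noteq> \<zero> \<and> a \<otimes> b' = b \<otimes> a'}"
    "frac_class R c d = {(a', b'). a' \<in> carrier R \<and> b' \<in> carrier R \<and> b' \<noteq> \<zero> \<and> c \<otimes> b' = d \<otimes> a'}"
    using cl by (auto simp: frac_class_def frac_rel_def frac_pairs_def)
  have mem: "(a, b) \<in> frac_class R a b" "(c, d) \<in> frac_class R c d"
    using cl unfolding cls by (auto simp: m_comm)
  have const: "(case p of (a', b') \<Rightarrow> \<Union>q\<in>frac_class R c d. case q of (c', d') \<Rightarrow> f a' b' c' d') = f a b c d"
    if "p \<in> frac_class R a b" for p
  proof -
    obtain a' b' where p: "p = (a', b')" by (cases p)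
    have "(case q of (c', d') \<Rightarrow> f a' b' c' d') = f a b c d" if "q \<in> frac_class R c d" for q
    proof -
      obtain c' d' where q: "q = (c', d')" by (cases q)
      show ?thesis
        using that \<open>p \<in> frac_class R a b\<close> f[of a' b' c' d'] unfolding p q cls by simp
    qed
    then show ?thesis unfolding p using mem(2) by auto
  qed
  then show ?thesis using mem(1) by auto
qed

lemma frac_mult:
  assumes cl: "a \<in> carrier R" "b \<in> carrier R" "b \<noteq> \<zero>" "c \<in> carrier R" "d \<in> carrier R" "d \<noteq> \<zero>"
  shows "frac_class R a b \<otimes>\<^bsub>F\<^esub> frac_class R c d = frac_class R (a \<otimes> c) (b \<otimes> d)"
proof -
  have "(\<Union>(a, b)\<in>frac_class R a b. \<Union>(c, d)\<in>frac_class R c d. frac_class R (a \<otimes> c) (b \<otimes> d))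
    = frac_class R (a \<otimes> c) (b \<otimes> d)"
  proof (rule UN_frac_class2[OF _ cl])
    fix a' b' c' d'
    assume h: "a' \<in> carrier R" "b' \<in> carrier R" "b' \<noteq> \<zero>" "a \<otimes> b' = b \<otimes> a'"
      "c' \<in> carrier R" "d' \<in> carrier R" "d' \<noteq> \<zero>" "c \<otimes> d' = d \<otimes> c'"
    have "a \<otimes> c \<otimes> (b' \<otimes> d') = (a \<otimes> b') \<otimes> (c \<otimes> d')" using cl h(1-3,5-7) by (simp add: m_ac)
    also have "\<dots> = b \<otimes> d \<otimes> (a' \<otimes> c')" unfolding h using cl h(1-3,5-7) by (simp add: m_ac)
    finally show "frac_class R (a' \<otimes> c') (b' \<otimes> d') = frac_class R (a \<otimes> c) (b \<otimes> d)"
      using cl h by (subst eq_commute, subst frac_class_eq_iff) (auto simp: integral_iff)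
  qed
  then show ?thesis by (simp add: frac_field_def)
qed

lemma frac_add:
  assumes cl: "a \<in> carrier R" "b \<in> carrier R" "b \<noteq> \<zero>" "c \<in> carrier R" "d \<in> carrier R" "d \<noteq> \<zero>"
  shows "frac_class R a b \<oplus>\<^bsub>F\<^esub> frac_class R c d
    = frac_class R ((a \<otimes> d) \<oplus> (b \<otimes> c)) (b \<otimes> d)"
proof -
  have "(\<Union>(a, b)\<in>frac_class R a b. \<Union>(c, d)\<in>frac_class R c d.
       frac_class R ((a \<otimes> d) \<oplus> (b \<otimes> c)) (b \<otimes> d)) = frac_class R ((a \<otimes> d) \<oplus> (b \<otimes> c)) (b \<otimes> d)"
  proof (rule UN_frac_class2[OF _ cl])
    fix a' b' c' d'
    assume h: "a' \<in> carrier R" "b' \<in> carrier R" "b' \<noteq> \<zero>" "a \<otimes> b' = b \<otimes> a'"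
      "c' \<in> carrier R" "d' \<in> carrier R" "d' \<noteq> \<zero>" "c \<otimes> d' = d \<otimes> c'"
    have "((a \<otimes> d) \<oplus> (b \<otimes> c)) \<otimes> (b' \<otimes> d') = (a \<otimes> b') \<otimes> (d \<otimes> d') \<oplus> (c \<otimes> d') \<otimes> (b \<otimes> b')"
      using cl(1,2,4,5) h(1,2,5,6) by algebra
    also have "\<dots> = b \<otimes> d \<otimes> ((a' \<otimes> d') \<oplus> (b' \<otimes> c'))"
      unfolding h using cl h(1-3,5-7) by (simp add: m_ac r_distr)
    finally show "frac_class R ((a' \<otimes> d') \<oplus> (b' \<otimes> c')) (b' \<otimes> d')
        = frac_class R ((a \<otimes> d) \<oplus> (b \<otimes> c)) (b \<otimes> d)"
      using cl h by (subst eq_commute, subst frac_class_eq_iff) (auto simp: integral_iff)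
  qed
  then show ?thesis by (simp add: frac_field_def)
qed

lemma frac_one: "\<one>\<^bsub>F\<^esub> = frac_class R \<one> \<one>"
  and frac_zero: "\<zero>\<^bsub>F\<^esub> = frac_class R \<zero> \<one>"
  by (simp_all add: frac_field_def)

lemma frac_eq_zero_iff:
  "a \<in> carrier R \<Longrightarrow> b \<in> carrier R \<Longrightarrow> b \<noteq> \<zero> \<Longrightarrow>
    frac_class R a b = \<zero>\<^bsub>F\<^esub> \<longleftrightarrow> a = \<zero>"
  by (simp add: frac_zero frac_class_eq_iff)

lemma cring_frac_field: "cring F"
proof (rule cringI)
  show "abelian_group F"
  proof (rule abelian_groupI)
    fix x y z assume x: "x \<in> carrier F" and y: "y \<in> carrier F"
    obtain a b where x': "x = frac_class R a b" "a \<in> carrier R" "b \<in> carrier R" "b \<noteq> \<zero>"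
      by (rule frac_field_elem[OF x])
    obtain c d where y': "y = frac_class R c d" "c \<in> carrier R" "d \<in> carrier R" "d \<noteq> \<zero>"
      by (rule frac_field_elem[OF y])
    show "x \<oplus>\<^bsub>F\<^esub> y \<in> carrier F"
      using x' y' by (auto simp: frac_add integral_iff intro!: frac_class_mem)
    show "x \<oplus>\<^bsub>F\<^esub> y = y \<oplus>\<^bsub>F\<^esub> x"
      using x' y' by (simp add: frac_add a_comm m_comm)
    {
      assume z: "z \<in> carrier F"
      obtain e f where z': "z = frac_class R e f" "e \<in> carrier R" "f \<in> carrier R" "f \<noteq> \<zero>"
        by (rule frac_field_elem[OF z])
      show "(x \<oplus>\<^bsub>F\<^esub> y) \<oplus>\<^bsub>F\<^esub> z = x \<oplus>\<^bsub>F\<^esub> (y \<oplus>\<^bsub>F\<^esub> z)"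
      proof -
        have "(a \<otimes> d \<oplus> b \<otimes> c) \<otimes> f \<oplus> b \<otimes> d \<otimes> e = a \<otimes> (d \<otimes> f) \<oplus> b \<otimes> (c \<otimes> f \<oplus> d \<otimes> e)"
          using x' y' z' by algebra
        then show ?thesis using x' y' z' by (simp add: frac_add integral_iff m_assoc)
      qed
    }
    show "\<zero>\<^bsub>F\<^esub> \<oplus>\<^bsub>F\<^esub> x = x"
      using x' by (simp add: frac_add frac_zero)
    show "\<exists>y\<in>carrier F. y \<oplus>\<^bsub>F\<^esub> x = \<zero>\<^bsub>F\<^esub>"
    proof (rule bexI)
      have "(\<ominus> a) \<otimes> b \<oplus> b \<otimes> a = \<zero>" using x'(2,3) by algebra
      then show "frac_class R (\<ominus> a) b \<oplus>\<^bsub>F\<^esub> x = \<zero>\<^bsub>F\<^esub>"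
        using x' by (simp add: frac_add frac_eq_zero_iff integral_iff)
      show "frac_class R (\<ominus> a) b \<in> carrier F"
        using x' by (simp add: frac_class_mem)
    qed
  next
    show "\<zero>\<^bsub>F\<^esub> \<in> carrier F" by (simp add: frac_zero frac_class_mem)
  qed
next
  show "comm_monoid F"
  proof (rule comm_monoidI)
    fix x y z assume x: "x \<in> carrier F"
    obtain a b where x': "x = frac_class R a b" "a \<in> carrier R" "b \<in> carrier R" "b \<noteq> \<zero>"
      by (rule frac_field_elem[OF x])
    show "\<one>\<^bsub>F\<^esub> \<otimes>\<^bsub>F\<^esub> x = x"
      using x' by (simp add: frac_mult frac_one)
    assume y: "y \<in> carrier F"
    obtain c d where y': "y = frac_class R c d" "c \<in> carrier R" "d \<in> carrier R" "d \<noteq> \<zero>"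
      by (rule frac_field_elem[OF y])
    show "x \<otimes>\<^bsub>F\<^esub> y \<in> carrier F"
      using x' y' by (auto simp: frac_mult integral_iff intro!: frac_class_mem)
    show "x \<otimes>\<^bsub>F\<^esub> y = y \<otimes>\<^bsub>F\<^esub> x"
      using x' y' by (simp add: frac_mult m_comm)
    assume z: "z \<in> carrier F"
    obtain e f where z': "z = frac_class R e f" "e \<in> carrier R" "f \<in> carrier R" "f \<noteq> \<zero>"
      by (rule frac_field_elem[OF z])
    show "(x \<otimes>\<^bsub>F\<^esub> y) \<otimes>\<^bsub>F\<^esub> z = x \<otimes>\<^bsub>F\<^esub> (y \<otimes>\<^bsub>F\<^esub> z)"
      using x' y' z' by (simp add: frac_mult integral_iff m_ac)
  next
    show "\<one>\<^bsub>F\<^esub> \<in> carrier F" by (simp add: frac_one frac_class_mem)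
  qed
next
  fix x y z assume x: "x \<in> carrier F" and y: "y \<in> carrier F"
    and z: "z \<in> carrier F"
  obtain a b where x': "x = frac_class R a b" "a \<in> carrier R" "b \<in> carrier R" "b \<noteq> \<zero>"
    by (rule frac_field_elem[OF x])
  obtain c d where y': "y = frac_class R c d" "c \<in> carrier R" "d \<in> carrier R" "d \<noteq> \<zero>"
    by (rule frac_field_elem[OF y])
  obtain e f where z': "z = frac_class R e f" "e \<in> carrier R" "f \<in> carrier R" "f \<noteq> \<zero>"
    by (rule frac_field_elem[OF z])
  show "(x \<oplus>\<^bsub>F\<^esub> y) \<otimes>\<^bsub>F\<^esub> z
      = x \<otimes>\<^bsub>F\<^esub> z \<oplus>\<^bsub>F\<^esub> y \<otimes>\<^bsub>F\<^esub> z"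
  proof -
    have "(a \<otimes> d \<oplus> b \<otimes> c) \<otimes> e \<otimes> (b \<otimes> f \<otimes> (d \<otimes> f))
        = b \<otimes> d \<otimes> f \<otimes> (a \<otimes> e \<otimes> (d \<otimes> f) \<oplus> b \<otimes> f \<otimes> (c \<otimes> e))"
      using x' y' z' by algebra
    then show ?thesis using x' y' z' by (simp add: frac_mult frac_add integral_iff frac_class_eq_iff)
  qed
qed

lemma nonzero_pow: "b \<in> carrier R \<Longrightarrow> b \<noteq> \<zero> \<Longrightarrow> b [^] (k::nat) \<noteq> \<zero>"
  by (induction k) (auto simp: integral_iff)

lemma frac_pow:
  assumes "a \<in> carrier R" "b \<in> carrier R" "b \<noteq> \<zero>"
  shows "frac_class R a b [^]\<^bsub>F\<^esub> (k::nat) = frac_class R (a [^] k) (b [^] k)"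
proof (induction k)
  case 0
  then show ?case by (simp add: frac_one)
next
  case (Suc k)
  then show ?case using assms by (simp add: frac_mult nonzero_pow)
qed

text \<open>
  The numerator of the value at \<open>a / b\<close> of the polynomial with coefficient list \<open>cs\<close>, over the
  denominator \<open>b ^ length cs\<close>. The exponent is one more than the degree, so that the recursion treats
  all lists alike.
\<close>
fun eval_numer :: "'a list \<Rightarrow> 'a \<Rightarrow> 'a \<Rightarrow> 'a" where
  "eval_numer [] a b = \<zero>"
| "eval_numer (c # cs) a b = b \<otimes> (c \<otimes> a [^] length cs \<oplus> eval_numer cs a b)"

lemma eval_numer_closed:
  "set cs \<subseteq> carrier R \<Longrightarrow> a \<in> carrier R \<Longrightarrow> b \<in> carrier R \<Longrightarrow> eval_numer cs a b \<in> carrier R"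
  by (induction cs) auto

lemma eval_frac:
  assumes "a \<in> carrier R" "b \<in> carrier R" "b \<noteq> \<zero>" "set cs \<subseteq> carrier R"
  shows "ring.eval F (map (frac_embed R) cs) (frac_class R a b)
    = frac_class R (eval_numer cs a b) (b [^] length cs)"
  using assms(4)
proof (induction cs)
  case Nil
  interpret F: cring F by (rule cring_frac_field)
  show ?case by (simp add: frac_zero)
next
  case (Cons c cs)
  interpret F: cring F by (rule cring_frac_field)
  have *: "eval_numer cs a b \<in> carrier R" using Cons.prems assms by (simp add: eval_numer_closed)
  let ?B = "b [^] length cs" and ?A = "a [^] length cs"
  have c: "c \<in> carrier R" "?A \<in> carrier R" "?B \<in> carrier R" "?B \<noteq> \<zero>"
    using Cons.prems assms nonzero_pow by auto
  have "(c \<otimes> ?A \<otimes> ?B \<oplus> ?B \<otimes> eval_numer cs a b) \<otimes> (?B \<otimes> b)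
      = ?B \<otimes> ?B \<otimes> (b \<otimes> (c \<otimes> ?A \<oplus> eval_numer cs a b))"
    using c * assms by algebra
  then show ?case
    using Cons assms * c
    by (simp add: frac_embed_def frac_pow frac_mult frac_add integral_iff frac_class_eq_iff)
qed

text \<open>
  Clearing denominators turns a monic equation for \<open>a / b\<close> in the fraction field into a vanishing
  numerator in \<open>R\<close>, and \<open>a / b\<close> comes from \<open>R\<close> exactly when \<open>b\<close> divides \<open>a\<close>.
\<close>
theorem integrally_closed_domain_iff:
  "integrally_closed_domain R \<longleftrightarrow>
    (\<forall>a\<in>carrier R. \<forall>b\<in>carrier R - {\<zero>}. \<forall>cs. set cs \<subseteq> carrier R \<longrightarrow>
      eval_numer (\<one> # cs) a b = \<zero> \<longrightarrow> (\<exists>h\<in>carrier R. a = b \<otimes> h))"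
proof -
  have one: "frac_embed R \<one> = \<one>\<^bsub>F\<^esub>" by (simp add: frac_embed_def frac_one)
  have emb: "frac_class R a b \<in> frac_embed R ` carrier R \<longleftrightarrow> (\<exists>h\<in>carrier R. a = b \<otimes> h)"
    if "a \<in> carrier R" "b \<in> carrier R" "b \<noteq> \<zero>" for a b
    using that by (auto simp: frac_embed_def image_iff frac_class_eq_iff)
  have int: "integral_over F (frac_embed R ` carrier R) (frac_class R a b) \<longleftrightarrow>
      (\<exists>cs. set cs \<subseteq> carrier R \<and> eval_numer (\<one> # cs) a b = \<zero>)"
    if ab: "a \<in> carrier R" "b \<in> carrier R" "b \<noteq> \<zero>" for a b
  proof
    assume "integral_over F (frac_embed R ` carrier R) (frac_class R a b)"
    then obtain p where p: "polynomial\<^bsub>F\<^esub> (frac_embed R ` carrier R) p" "p \<noteq> []"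
      "lead_coeff p = \<one>\<^bsub>F\<^esub>" "ring.eval F p (frac_class R a b) = \<zero>\<^bsub>F\<^esub>"
      by (auto simp: integral_over_def)
    then obtain ps where ps: "p = \<one>\<^bsub>F\<^esub> # ps" by (cases p) auto
    then have "\<forall>c\<in>set ps. \<exists>r\<in>carrier R. c = frac_embed R r"
      using p by (auto simp: polynomial_def)
    then have "\<exists>cs. set cs \<subseteq> carrier R \<and> ps = map (frac_embed R) cs"
    proof (induction ps)
      case (Cons c ps)
      then obtain cs r where "set cs \<subseteq> carrier R" "ps = map (frac_embed R) cs"
        "r \<in> carrier R" "c = frac_embed R r" by auto
      then show ?case by (intro exI[of _ "r # cs"]) auto
    qed simp
    then obtain cs where cs: "set cs \<subseteq> carrier R" "ps = map (frac_embed R) cs" by auto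
    then have "p = map (frac_embed R) (\<one> # cs)" using ps one by simp
    then have "frac_class R (eval_numer (\<one> # cs) a b) (b [^] length (\<one> # cs)) = \<zero>\<^bsub>F\<^esub>"
      using eval_frac[OF ab, of "\<one> # cs"] cs p by simp
    then have "eval_numer (\<one> # cs) a b = \<zero>"
      using ab cs
      by (subst (asm) frac_eq_zero_iff) (auto simp: nonzero_pow integral_iff eval_numer_closed)
    then show "\<exists>cs. set cs \<subseteq> carrier R \<and> eval_numer (\<one> # cs) a b = \<zero>" using cs by blast
  next
    assume "\<exists>cs. set cs \<subseteq> carrier R \<and> eval_numer (\<one> # cs) a b = \<zero>"
    then obtain cs where cs: "set cs \<subseteq> carrier R" "eval_numer (\<one> # cs) a b = \<zero>" by blast
    have "ring.eval F (map (frac_embed R) (\<one> # cs)) (frac_class R a b)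
        = frac_class R (eval_numer (\<one> # cs) a b) (b [^] length (\<one> # cs))"
      by (rule eval_frac[OF ab]) (use cs in auto)
    also have "\<dots> = \<zero>\<^bsub>F\<^esub>"
      unfolding cs(2) using nonzero_pow[OF ab(2,3), of "length (\<one> # cs)"] ab(2)
      by (simp add: frac_eq_zero_iff)
    finally have "ring.eval F (map (frac_embed R) (\<one> # cs)) (frac_class R a b) = \<zero>\<^bsub>F\<^esub>" .
    moreover have "\<one>\<^bsub>F\<^esub> \<noteq> \<zero>\<^bsub>F\<^esub>" unfolding frac_one by (simp add: frac_eq_zero_iff)
    ultimately show "integral_over F (frac_embed R ` carrier R) (frac_class R a b)"
      unfolding integral_over_def polynomial_def using cs one
      by (intro exI[of _ "map (frac_embed R) (\<one> # cs)"]) auto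
  qed
  have "integrally_closed_domain R \<longleftrightarrow> (\<forall>a\<in>carrier R. \<forall>b\<in>carrier R - {\<zero>}.
      integral_over F (frac_embed R ` carrier R) (frac_class R a b) \<longrightarrow>
      frac_class R a b \<in> frac_embed R ` carrier R)"
    using domain_axioms unfolding integrally_closed_domain_def
    by (auto elim!: frac_field_elem intro: frac_class_mem)
  also have "\<dots> \<longleftrightarrow> (\<forall>a\<in>carrier R. \<forall>b\<in>carrier R - {\<zero>}.
      (\<exists>cs. set cs \<subseteq> carrier R \<and> eval_numer (\<one> # cs) a b = \<zero>) \<longrightarrow> (\<exists>h\<in>carrier R. a = b \<otimes> h))"
    by (intro ball_cong refl) (simp add: int emb del: eval_numer.simps)
  finally show ?thesis by blast
qed

end

text \<open>
  Integral closedness of the ring of restrictions of \<open>A\<close> to \<open>Y\<close>, without fraction fields: quotients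
  are evaluated pointwise, at the points where the denominator does not vanish.
\<close>
definition contains_integral_quotients :: "'x set \<Rightarrow> ('x \<Rightarrow> complex) set \<Rightarrow> bool" where
  "contains_integral_quotients Y A \<longleftrightarrow>
    (\<forall>a\<in>A. \<forall>b\<in>A. (\<exists>y\<in>Y. b y \<noteq> 0) \<longrightarrow>
      (\<forall>k c. (\<forall>j<k. c j \<in> A) \<longrightarrow>
        (\<forall>y\<in>Y. b y \<noteq> 0 \<longrightarrow> (a y / b y) ^ k + (\<Sum>j<k. c j y * (a y / b y) ^ j) = 0) \<longrightarrow>
        (\<exists>h\<in>A. \<forall>y\<in>Y. a y = b y * h y)))"

lemma contains_integral_quotientsD:
  assumes "contains_integral_quotients Y A" "a \<in> A" "b \<in> A" "\<exists>y\<in>Y. b y \<noteq> 0" "\<And>j. j < k \<Longrightarrow> c j \<in> A"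
    and "\<And>y. y \<in> Y \<Longrightarrow> b y \<noteq> 0 \<Longrightarrow> (a y / b y) ^ k + (\<Sum>j<k. c j y * (a y / b y) ^ j) = 0"
  shows "\<exists>h\<in>A. \<forall>y\<in>Y. a y = b y * h y"
  by (rule assms(1)[unfolded contains_integral_quotients_def, rule_format, where k = k and c = c, OF assms(2-4)])
    (use assms(5,6) in auto)

text \<open>
  The property depends only on the functions that \<open>A\<close> and \<open>B\<close> induce on a common parameter set \<open>Z\<close>.
  It is used to replace functions on the orbit space by invariant functions.
\<close>
lemma contains_integral_quotients_transfer:
  assumes A: "contains_integral_quotients (\<rho> ` Z) A"
    and to_A: "\<And>f. f \<in> B \<Longrightarrow> \<exists>g\<in>A. \<forall>z\<in>Z. f (\<pi> z) = g (\<rho> z)"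
    and to_B: "\<And>g. g \<in> A \<Longrightarrow> \<exists>f\<in>B. \<forall>z\<in>Z. f (\<pi> z) = g (\<rho> z)"
  shows "contains_integral_quotients (\<pi> ` Z) B"
  unfolding contains_integral_quotients_def ball_simps(9) bex_simps(7)
proof (intro ballI impI allI)
  fix a b k c
  assume ab: "a \<in> B" "b \<in> B" "\<exists>z\<in>Z. b (\<pi> z) \<noteq> 0" and c: "\<forall>j<k. c j \<in> B"
    and eq: "\<forall>z\<in>Z. b (\<pi> z) \<noteq> 0 \<longrightarrow>
      (a (\<pi> z) / b (\<pi> z)) ^ k + (\<Sum>j<k. c j (\<pi> z) * (a (\<pi> z) / b (\<pi> z)) ^ j) = 0"
  obtain a' where a': "a' \<in> A" "\<forall>z\<in>Z. a (\<pi> z) = a' (\<rho> z)" using to_A[OF ab(1)] ..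
  obtain b' where b': "b' \<in> A" "\<forall>z\<in>Z. b (\<pi> z) = b' (\<rho> z)" using to_A[OF ab(2)] ..
  have "\<forall>j\<in>{..<k}. \<exists>c'. c' \<in> A \<and> (\<forall>z\<in>Z. c j (\<pi> z) = c' (\<rho> z))"
  proof
    fix j assume "j \<in> {..<k}"
    then have "c j \<in> B" using c by simp
    from to_A[OF this] show "\<exists>c'. c' \<in> A \<and> (\<forall>z\<in>Z. c j (\<pi> z) = c' (\<rho> z))" by (simp only: Bex_def)
  qed
  from bchoice[OF this] obtain c' where
    c': "\<forall>j\<in>{..<k}. c' j \<in> A \<and> (\<forall>z\<in>Z. c j (\<pi> z) = c' j (\<rho> z))" ..
  have "\<exists>h\<in>A. \<forall>y\<in>\<rho> ` Z. a' y = b' y * h y"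
  proof (rule contains_integral_quotientsD[OF A a'(1) b'(1)])
    show "\<exists>y\<in>\<rho> ` Z. b' y \<noteq> 0" using ab(3) b'(2) by auto
    show "c' j \<in> A" if "j < k" for j using c' that by simp
    show "(a' y / b' y) ^ k + (\<Sum>j<k. c' j y * (a' y / b' y) ^ j) = 0" if y: "y \<in> \<rho> ` Z" "b' y \<noteq> 0" for y
    proof -
      obtain z where z: "z \<in> Z" "y = \<rho> z" using y(1) ..
      then show ?thesis using bspec[OF eq z(1)] y(2) a'(2) b'(2) c' by simp
    qed
  qed
  then obtain h where h: "h \<in> A" "\<forall>y\<in>\<rho> ` Z. a' y = b' y * h y" ..
  obtain f where f: "f \<in> B" "\<forall>z\<in>Z. f (\<pi> z) = h (\<rho> z)" using to_B[OF h(1)] ..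
  show "\<exists>h\<in>B. \<forall>z\<in>Z. a (\<pi> z) = b (\<pi> z) * h (\<pi> z)"
    by (rule bexI[OF _ f(1)]) (use h(2) f(2) a'(2) b'(2) in simp)
qed

lemma restriction_ring_simps:
  "carrier (restriction_ring Y A) = (\<lambda>f. restrict f Y) ` A"
  "f \<otimes>\<^bsub>restriction_ring Y A\<^esub> g = (\<lambda>y\<in>Y. f y * g y)"
  "f \<oplus>\<^bsub>restriction_ring Y A\<^esub> g = (\<lambda>y\<in>Y. f y + g y)"
  "\<one>\<^bsub>restriction_ring Y A\<^esub> = (\<lambda>y\<in>Y. 1)"
  "\<zero>\<^bsub>restriction_ring Y A\<^esub> = (\<lambda>y\<in>Y. 0)"
  by (simp_all add: restriction_ring_def)

text \<open>
  The functions matter only through their restrictions to \<open>Y\<close>; the last condition makes the ring of these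
  restrictions a domain.
\<close>
locale function_algebra =
  fixes Y :: "'x set" and A :: "('x \<Rightarrow> complex) set"
  assumes nonempty: "Y \<noteq> {}"
    and const: "(\<lambda>_. k) \<in> A"
    and add: "f \<in> A \<Longrightarrow> g \<in> A \<Longrightarrow> (\<lambda>y. f y + g y) \<in> A"
    and mult: "f \<in> A \<Longrightarrow> g \<in> A \<Longrightarrow> (\<lambda>y. f y * g y) \<in> A"
    and no_zero_divisors: "f \<in> A \<Longrightarrow> g \<in> A \<Longrightarrow> (\<And>y. y \<in> Y \<Longrightarrow> f y * g y = 0) \<Longrightarrow>
      (\<forall>y\<in>Y. f y = 0) \<or> (\<forall>y\<in>Y. g y = 0)"
begin

abbreviation "RY \<equiv> restriction_ring Y A"

lemma restrict_memI: "g \<in> A \<Longrightarrow> (\<And>y. y \<in> Y \<Longrightarrow> f y = g y) \<Longrightarrow> f \<in> extensional Y \<Longrightarrow>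
    f \<in> carrier RY"
  unfolding restriction_ring_simps
  by (rule image_eqI[of _ _ g]) (auto simp: extensional_def restrict_def fun_eq_iff)

lemma restriction_cring: "cring RY"
proof (rule cringI)
  show "abelian_group RY"
  proof (rule abelian_groupI)
    fix x assume "x \<in> carrier RY"
    then obtain f where f: "f \<in> A" "x = restrict f Y" by (auto simp: restriction_ring_simps)
    have "(\<lambda>y. (-1) * f y) \<in> A" using f const mult by blast
    then show "\<exists>y\<in>carrier RY. y \<oplus>\<^bsub>RY\<^esub> x = \<zero>\<^bsub>RY\<^esub>"
      using f by (intro bexI[of _ "restrict (\<lambda>y. (-1) * f y) Y"])
        (auto simp: restriction_ring_simps fun_eq_iff)
  next
    show "\<zero>\<^bsub>RY\<^esub> \<in> carrier RY"
      by (rule restrict_memI[OF const[of 0]]) (auto simp: restriction_ring_simps)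
  next
    fix x y assume "x \<in> carrier RY" "y \<in> carrier RY"
    then obtain f g where "f \<in> A" "x = restrict f Y" "g \<in> A" "y = restrict g Y"
      by (auto simp: restriction_ring_simps)
    then show "x \<oplus>\<^bsub>RY\<^esub> y \<in> carrier RY"
      by (intro restrict_memI[OF add[of f g]]) (auto simp: restriction_ring_simps)
  qed (auto simp: restriction_ring_simps fun_eq_iff add.assoc add.commute)
  show "comm_monoid RY"
  proof (rule comm_monoidI)
    show "\<one>\<^bsub>RY\<^esub> \<in> carrier RY"
      by (rule restrict_memI[OF const[of 1]]) (auto simp: restriction_ring_simps)
  next
    fix x y assume "x \<in> carrier RY" "y \<in> carrier RY"
    then obtain f g where "f \<in> A" "x = restrict f Y" "g \<in> A" "y = restrict g Y"
      by (auto simp: restriction_ring_simps)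
    then show "x \<otimes>\<^bsub>RY\<^esub> y \<in> carrier RY"
      by (intro restrict_memI[OF mult[of f g]]) (auto simp: restriction_ring_simps)
  qed (auto simp: restriction_ring_simps fun_eq_iff mult.assoc mult.commute)
qed (auto simp: restriction_ring_simps fun_eq_iff distrib_right)

lemma restriction_domain: "domain RY"
proof -
  interpret cring RY by (rule restriction_cring)
  show ?thesis
  proof (rule domainI)
    show "\<one>\<^bsub>RY\<^esub> \<noteq> \<zero>\<^bsub>RY\<^esub>"
      using nonempty by (auto simp: restriction_ring_simps fun_eq_iff)
  next
    fix x y
    assume xy: "x \<otimes>\<^bsub>RY\<^esub> y = \<zero>\<^bsub>RY\<^esub>"
      and "x \<in> carrier RY" "y \<in> carrier RY"
    then obtain f g where fg: "f \<in> A" "x = restrict f Y" "g \<in> A" "y = restrict g Y"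
      by (auto simp: restriction_ring_simps)
    have "f z * g z = 0" if "z \<in> Y" for z
      using fun_cong[OF xy, of z] that fg by (simp add: restriction_ring_simps)
    then show "x = \<zero>\<^bsub>RY\<^esub> \<or> y = \<zero>\<^bsub>RY\<^esub>"
      using no_zero_divisors[OF fg(1,3)] fg by (auto simp: restriction_ring_simps fun_eq_iff)
  qed (rule restriction_cring)
qed

lemma restriction_pow:
  "restrict f Y [^]\<^bsub>RY\<^esub> (k::nat) = (\<lambda>y\<in>Y. f y ^ k)"
  by (induction k) (auto simp: restriction_ring_simps fun_eq_iff nat_pow_def)

text \<open>
  Coefficient lists start with the leading coefficient, so the coefficient of the \<open>j\<close>-th power is
  found in the reversed list.
\<close>
lemma restriction_eval_numer:
  "domain.eval_numer RY (map (\<lambda>f. restrict f Y) fs) (restrict a Y) (restrict b Y)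
    = (\<lambda>y\<in>Y. \<Sum>j<length fs. (rev fs ! j) y * a y ^ j * b y ^ (length fs - j))"
proof (induction fs)
  case Nil
  interpret domain RY by (rule restriction_domain)
  show ?case by (simp add: restriction_ring_simps)
next
  case (Cons f fs)
  interpret domain RY by (rule restriction_domain)
  have "b y * (f y * a y ^ length fs + (\<Sum>j<length fs. (rev fs ! j) y * a y ^ j * b y ^ (length fs - j)))
    = (\<Sum>j<Suc (length fs). (rev (f # fs) ! j) y * a y ^ j * b y ^ (Suc (length fs) - j))" for y
    unfolding distrib_left sum_distrib_left sum.lessThan_Suc
    by (simp add: nth_append, intro sum.cong refl) (simp add: Suc_diff_le)
  then show ?case
    unfolding list.map eval_numer.simps Cons.IH length_map restriction_pow
    by (auto simp: restriction_ring_simps fun_eq_iff)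
qed

text \<open>
  The cleared equation is the monic equation multiplied by a positive power of \<open>b\<close>. It holds trivially
  where \<open>b\<close> vanishes, so it only says that the quotient satisfies the monic equation elsewhere.
\<close>
theorem integrally_closed_iff:
  "integrally_closed_domain RY \<longleftrightarrow> contains_integral_quotients Y A"
proof -
  interpret domain RY by (rule restriction_domain)
  let ?r = "\<lambda>f. restrict f Y"
  have numer: "eval_numer (\<one>\<^bsub>RY\<^esub> # map ?r fs) (?r a) (?r b) = \<zero>\<^bsub>RY\<^esub> \<longleftrightarrow>
      (\<forall>y\<in>Y. b y \<noteq> 0 \<longrightarrow> (a y / b y) ^ length fs + (\<Sum>j<length fs. (rev fs ! j) y * (a y / b y) ^ j) = 0)"
    for a b fs
  proof -
    have eq: "\<one>\<^bsub>RY\<^esub> # map ?r fs = map ?r ((\<lambda>_. 1) # fs)" by (simp add: restriction_ring_simps)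
    have "(\<Sum>j<Suc (length fs). (rev ((\<lambda>_. 1) # fs) ! j) y * a y ^ j * b y ^ (Suc (length fs) - j)) = 0
        \<longleftrightarrow> (b y \<noteq> 0 \<longrightarrow> (a y / b y) ^ length fs + (\<Sum>j<length fs. (rev fs ! j) y * (a y / b y) ^ j) = 0)"
      (is "?L = 0 \<longleftrightarrow> (_ \<longrightarrow> ?M = 0)") for y
    proof (cases "b y = 0")
      case False
      have "?L = b y ^ Suc (length fs) * ?M"
        using False unfolding distrib_left sum_distrib_left sum.lessThan_Suc
        by (simp add: nth_append power_divide, intro sum.cong refl)
          (simp add: nth_append power_divide power_diff Suc_diff_le)
      then show ?thesis using False by auto
    qed (auto simp: nth_append intro!: sum.neutral)
    then show ?thesis unfolding eq restriction_eval_numer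
      by (auto simp: restriction_ring_simps fun_eq_iff)
  qed
  have nz: "?r b \<noteq> \<zero>\<^bsub>RY\<^esub> \<longleftrightarrow> (\<exists>y\<in>Y. b y \<noteq> 0)" for b
    by (auto simp: restriction_ring_simps fun_eq_iff)
  have dvd: "(\<exists>h\<in>?r ` A. ?r a = ?r b \<otimes>\<^bsub>RY\<^esub> h) \<longleftrightarrow> (\<exists>h\<in>A. \<forall>y\<in>Y. a y = b y * h y)" for a b
    by (auto simp: restriction_ring_simps fun_eq_iff)
  have lists: "(\<forall>cs. set cs \<subseteq> carrier RY \<longrightarrow> P cs) \<longleftrightarrow> (\<forall>fs. set fs \<subseteq> A \<longrightarrow> P (map ?r fs))" for P
  proof safe
    fix cs assume *: "\<forall>fs. set fs \<subseteq> A \<longrightarrow> P (map ?r fs)" "set cs \<subseteq> carrier RY"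
    then have "cs \<in> lists (?r ` A)" by (auto simp: restriction_ring_simps)
    then obtain fs where "fs \<in> lists A" "cs = map ?r fs" by (auto simp: lists_image)
    then show "P cs" using * by auto
  next
    fix fs assume *: "\<forall>cs. set cs \<subseteq> carrier RY \<longrightarrow> P cs" "set fs \<subseteq> A"
    have "set (map ?r fs) \<subseteq> carrier RY" using *(2) by (auto simp: restriction_ring_simps)
    then show "P (map ?r fs)" using *(1) by blast
  qed
  have seqs: "(\<forall>fs. set fs \<subseteq> A \<longrightarrow> Q (length fs) (\<lambda>j. rev fs ! j)) \<longleftrightarrow>
      (\<forall>k c. (\<forall>j<k. c j \<in> A) \<longrightarrow> Q k c)"
    if "\<And>k c c'. (\<And>j. j < k \<Longrightarrow> c j = c' j) \<Longrightarrow> Q k c = Q k c'" for Q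
  proof safe
    fix k and c :: "nat \<Rightarrow> 'x \<Rightarrow> complex" assume *: "\<forall>fs. set fs \<subseteq> A \<longrightarrow> Q (length fs) (\<lambda>j. rev fs ! j)" "\<forall>j<k. c j \<in> A"
    have "Q (length (rev (map c [0..<k]))) (\<lambda>j. rev (rev (map c [0..<k])) ! j)"
      using * by (intro mp[OF spec[OF *(1)]]) auto
    then have "Q k (\<lambda>j. map c [0..<k] ! j)" by simp
    then show "Q k c" by (rule iffD1[OF that, rotated]) simp
  next
    fix fs assume *: "\<forall>k c. (\<forall>j<k. c j \<in> A) \<longrightarrow> Q k c" "set fs \<subseteq> A"
    then show "Q (length fs) (\<lambda>j. rev fs ! j)"
      by (metis length_rev nth_mem set_rev subsetD)
  qed
  have "integrally_closed_domain RY \<longleftrightarrow> (\<forall>a\<in>A. \<forall>b\<in>A. ?r b \<noteq> \<zero>\<^bsub>RY\<^esub> \<longrightarrow>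
      (\<forall>fs. set fs \<subseteq> A \<longrightarrow> eval_numer (\<one>\<^bsub>RY\<^esub> # map ?r fs) (?r a) (?r b) = \<zero>\<^bsub>RY\<^esub> \<longrightarrow>
        (\<exists>h\<in>?r ` A. ?r a = ?r b \<otimes>\<^bsub>RY\<^esub> h)))"
    unfolding integrally_closed_domain_iff lists unfolding restriction_ring_simps(1) by blast
  also have "\<dots> \<longleftrightarrow> (\<forall>a\<in>A. \<forall>b\<in>A. (\<exists>y\<in>Y. b y \<noteq> 0) \<longrightarrow>
      (\<forall>k c. (\<forall>j<k. c j \<in> A) \<longrightarrow>
        (\<forall>y\<in>Y. b y \<noteq> 0 \<longrightarrow> (a y / b y) ^ k + (\<Sum>j<k. c j y * (a y / b y) ^ j) = 0) \<longrightarrow>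
        (\<exists>h\<in>A. \<forall>y\<in>Y. a y = b y * h y)))"
    unfolding numer dvd nz by (intro ball_cong refl imp_cong seqs) auto
  finally show ?thesis unfolding contains_integral_quotients_def .
qed

end

section \<open>Exponential sums and their leading terms\<close>

text \<open>
  The character \<open>\<mu>\<close> of a torus, pulled back along \<open>exp(2 \<pi> i -)\<close>.
\<close>
definition echar :: "real ^ 'n \<Rightarrow> complex ^ 'n \<Rightarrow> complex" where
  "echar \<mu> z = exp (2 * of_real pi * \<i> * cpair \<mu> z)"

definition expsum :: "(real ^ 'n) set \<Rightarrow> (complex ^ 'n \<Rightarrow> complex) set" where
  "expsum S = {\<lambda>z. \<Sum>\<mu>\<in>T. c \<mu> * echar \<mu> z | T c. finite T \<and> T \<subseteq> S}"

lemma torus_functions_eq_expsum: "torus_functions N = expsum (character_lattice N)"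
  by (simp add: torus_functions_def expsum_def echar_def)

lemma cpair_add: "cpair (\<mu> + \<nu>) z = cpair \<mu> z + cpair \<nu> z"
  and cpair_scaleR: "cpair (r *\<^sub>R \<mu>) z = of_real r * cpair \<mu> z"
  and cpair_zero: "cpair 0 z = 0"
  and cpair_add_right: "cpair \<mu> (z + y) = cpair \<mu> z + cpair \<mu> y"
  by (simp_all add: cpair_def distrib_left distrib_right left_diff_distrib sum.distrib sum_subtractf
      sum_distrib_left algebra_simps)

lemma echar_add: "echar (\<mu> + \<nu>) z = echar \<mu> z * echar \<nu> z"
  by (simp add: echar_def cpair_add distrib_left exp_add)

lemma echar_zero [simp]: "echar 0 z = 1"
  by (simp add: echar_def cpair_zero)

lemma echar_nonzero [simp]: "echar \<mu> z \<noteq> 0"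
  by (simp add: echar_def)

lemma echar_pow: "echar (real m *\<^sub>R \<mu>) z = echar \<mu> z ^ m"
  by (simp add: echar_def cpair_scaleR exp_of_nat_mult[symmetric] mult_ac)

lemma expsum_mono: "S \<subseteq> S' \<Longrightarrow> expsum S \<subseteq> expsum S'"
  by (fastforce simp: expsum_def)

lemma expsum_zero [simp]: "(\<lambda>_. 0) \<in> expsum S"
  unfolding expsum_def by (rule CollectI, intro exI[of _ "{}"]) auto

lemma expsum_add:
  assumes "f \<in> expsum S" "g \<in> expsum S"
  shows "(\<lambda>z. f z + g z) \<in> expsum S"
proof -
  obtain T c where f: "f = (\<lambda>z. \<Sum>\<mu>\<in>T. c \<mu> * echar \<mu> z)" "finite T" "T \<subseteq> S"
    using assms by (auto simp: expsum_def)
  obtain T' c' where g: "g = (\<lambda>z. \<Sum>\<mu>\<in>T'. c' \<mu> * echar \<mu> z)" "finite T'" "T' \<subseteq> S"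
    using assms by (auto simp: expsum_def)
  let ?d = "\<lambda>\<mu>. (if \<mu> \<in> T then c \<mu> else 0) + (if \<mu> \<in> T' then c' \<mu> else 0)"
  have "f z + g z = (\<Sum>\<mu>\<in>T \<union> T'. ?d \<mu> * echar \<mu> z)" for z
  proof -
    have "f z = (\<Sum>\<mu>\<in>T \<union> T'. (if \<mu> \<in> T then c \<mu> else 0) * echar \<mu> z)"
      unfolding f(1) using f(2) g(2) by (intro sum.mono_neutral_cong_left) auto
    moreover have "g z = (\<Sum>\<mu>\<in>T \<union> T'. (if \<mu> \<in> T' then c' \<mu> else 0) * echar \<mu> z)"
      unfolding g(1) using f(2) g(2) by (intro sum.mono_neutral_cong_left) auto
    ultimately show ?thesis by (simp add: distrib_right sum.distrib)
  qed
  then show ?thesis using f g unfolding expsum_def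
    by (intro CollectI exI[of _ "T \<union> T'"] exI[of _ ?d]) auto
qed

lemma expsum_cmult:
  assumes "f \<in> expsum S" shows "(\<lambda>z. k * f z) \<in> expsum S"
proof -
  obtain T c where f: "f = (\<lambda>z. \<Sum>\<mu>\<in>T. c \<mu> * echar \<mu> z)" "finite T" "T \<subseteq> S"
    using assms by (auto simp: expsum_def)
  then show ?thesis unfolding expsum_def
    by (intro CollectI exI[of _ T] exI[of _ "\<lambda>\<mu>. k * c \<mu>"]) (auto simp: sum_distrib_left mult.assoc)
qed

lemma expsum_echar: "\<mu> \<in> S \<Longrightarrow> echar \<mu> \<in> expsum S"
  unfolding expsum_def by (intro CollectI exI[of _ "{\<mu>}"] exI[of _ "\<lambda>_. 1"]) auto

lemma expsum_const: "0 \<in> S \<Longrightarrow> (\<lambda>_. k) \<in> expsum S"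
  using expsum_cmult[OF expsum_echar[of 0 S], of k] by simp

lemma expsum_sum:
  "(\<And>i. i \<in> I \<Longrightarrow> f i \<in> expsum S) \<Longrightarrow> (\<lambda>z. \<Sum>i\<in>I. f i z) \<in> expsum S"
  by (induction I rule: infinite_finite_induct) (auto intro: expsum_add)

lemma expsum_induct [consumes 1, case_names zero add]:
  assumes "f \<in> expsum S" and "P (\<lambda>_. 0)"
    and "\<And>c \<mu> f. \<mu> \<in> S \<Longrightarrow> f \<in> expsum S \<Longrightarrow> P f \<Longrightarrow> P (\<lambda>z. c * echar \<mu> z + f z)"
  shows "P f"
proof -
  obtain T c where f: "f = (\<lambda>z. \<Sum>\<mu>\<in>T. c \<mu> * echar \<mu> z)" "finite T" "T \<subseteq> S"
    using assms by (auto simp: expsum_def)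
  have "P (\<lambda>z. \<Sum>\<mu>\<in>T. c \<mu> * echar \<mu> z)"
    using f(2,3)
  proof (induction T)
    case (insert \<mu> T)
    moreover have "(\<lambda>z. \<Sum>\<mu>\<in>T. c \<mu> * echar \<mu> z) \<in> expsum S"
      using insert by (auto simp: expsum_def)
    ultimately show ?case using assms(3) by simp
  qed (use assms in simp)
  then show ?thesis using f by simp
qed

lemma expsum_mult:
  assumes f: "f \<in> expsum S" and g: "g \<in> expsum S'"
    and U: "\<And>\<mu> \<nu>. \<mu> \<in> S \<Longrightarrow> \<nu> \<in> S' \<Longrightarrow> \<mu> + \<nu> \<in> U"
  shows "(\<lambda>z. f z * g z) \<in> expsum U"
  using f
proof (induction rule: expsum_induct)
  case (add c \<mu> f)
  have "(\<lambda>z. echar \<mu> z * g z) \<in> expsum U"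
    using g
  proof (induction rule: expsum_induct)
    case (add d \<nu> g)
    have "(\<lambda>z. d * echar (\<mu> + \<nu>) z + echar \<mu> z * g z) \<in> expsum U"
      using add U[OF \<open>\<mu> \<in> S\<close>] by (intro expsum_add expsum_cmult expsum_echar) auto
    then show ?case by (simp add: echar_add algebra_simps)
  qed simp
  from expsum_add[OF expsum_cmult[OF this] add.IH] show ?case
    by (simp add: algebra_simps)
qed simp

lemma le_of_nat_mult_bound:
  fixes x r K :: real
  assumes "\<And>m. real m * x \<le> real m * r + K"
  shows "x \<le> r"
proof (rule ccontr)
  assume "\<not> x \<le> r"
  then obtain m where "K < real m * (x - r)" using ex_less_of_nat_mult[of "x - r" K] by auto
  then show False using assms[of m] by (simp add: algebra_simps)
qed

text \<open>
  A set \<open>A\<close> that can be moved along \<open>- i w\<close>, for a real vector \<open>w\<close> that separates the exponents in \<open>M\<close>.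
  Moving by \<open>- i s w\<close> multiplies the character \<open>\<mu>\<close> by \<open>exp(2 \<pi> s (\<mu> \<bullet> w))\<close>. Hence the exponents are
  totally ordered by their growth in this direction, and an exponential sum is dominated by its
  greatest exponent.
\<close>
locale exponential_frame =
  fixes A :: "(complex ^ 'n) set" and M :: "(real ^ 'n) set" and w :: "real ^ 'n"
  assumes A_nonempty: "A \<noteq> {}"
    and A_shift: "z \<in> A \<Longrightarrow> z + (\<chi> i. - \<i> * of_real (s * w $ i)) \<in> A"
    and M_zero: "0 \<in> M"
    and M_add: "\<mu> \<in> M \<Longrightarrow> \<nu> \<in> M \<Longrightarrow> \<mu> + \<nu> \<in> M"
    and M_diff: "\<mu> \<in> M \<Longrightarrow> \<nu> \<in> M \<Longrightarrow> \<mu> - \<nu> \<in> M"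
    and generic: "\<mu> \<in> M \<Longrightarrow> \<mu> \<bullet> w = 0 \<Longrightarrow> \<mu> = 0"
begin

text \<open>
  The leading exponent and coefficient of the restriction of \<open>f\<close> to \<open>A\<close>, with respect to the order of
  exponents by \<open>\<mu> \<bullet> w\<close>.
\<close>
definition lead :: "(complex ^ 'n \<Rightarrow> complex) \<Rightarrow> real ^ 'n \<Rightarrow> complex \<Rightarrow> bool" where
  "lead f \<alpha> c \<longleftrightarrow> c \<noteq> 0 \<and> \<alpha> \<in> M \<and>
    (\<exists>g \<in> expsum {\<mu>\<in>M. \<mu> \<bullet> w < \<alpha> \<bullet> w}. \<forall>z\<in>A. f z = c * echar \<alpha> z + g z)"

lemma lead_cong: "(\<And>z. z \<in> A \<Longrightarrow> f z = g z) \<Longrightarrow> lead f \<alpha> c \<longleftrightarrow> lead g \<alpha> c"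
  by (auto simp: lead_def)

lemma generic_eq: "\<mu> \<in> M \<Longrightarrow> \<nu> \<in> M \<Longrightarrow> \<mu> \<bullet> w = \<nu> \<bullet> w \<Longrightarrow> \<mu> = \<nu>"
  using generic[of "\<mu> - \<nu>"] M_diff by (simp add: inner_diff_left)

lemma M_scale: "\<mu> \<in> M \<Longrightarrow> real m *\<^sub>R \<mu> \<in> M"
  by (induction m) (auto simp: M_zero scaleR_add_left M_add)

lemma echar_shift:
  "echar \<mu> (z + (\<chi> i. - \<i> * of_real (s * w $ i))) = echar \<mu> z * of_real (exp (2 * pi * s * (\<mu> \<bullet> w)))"
proof -
  have "cpair \<mu> (\<chi> i. - \<i> * of_real (s * w $ i)) = - \<i> * of_real (s * (\<mu> \<bullet> w))"
    by (simp add: cpair_def inner_vec_def sum_distrib_left sum_negf mult_ac)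
  then have "2 * of_real pi * \<i> * cpair \<mu> (z + (\<chi> i. - \<i> * of_real (s * w $ i)))
      = 2 * of_real pi * \<i> * cpair \<mu> z + of_real (2 * pi * s * (\<mu> \<bullet> w))"
    by (simp only: cpair_add_right) (simp add: algebra_simps)
  then show ?thesis
    unfolding echar_def by (metis exp_add exp_of_real)
qed

lemma expsum_decay:
  assumes "g \<in> expsum {\<mu>\<in>M. \<mu> \<bullet> w < r}"
  shows "((\<lambda>s. g (z + (\<chi> i. - \<i> * of_real (s * w $ i))) * of_real (exp (- (2 * pi * s * r)))) \<longlongrightarrow> 0) at_top"
  using assms
proof (induction rule: expsum_induct)
  case (add c \<mu> f)
  have "((\<lambda>s. exp (2 * pi * s * (\<mu> \<bullet> w - r))) \<longlongrightarrow> 0) at_top"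
  proof (rule filterlim_compose[OF exp_at_bot])
    have "filterlim (\<lambda>s::real. (2 * pi * (\<mu> \<bullet> w - r)) * s) at_bot at_top"
      by (rule filterlim_tendsto_neg_mult_at_bot[OF tendsto_const _ filterlim_ident])
        (use add in \<open>auto simp: mult_less_0_iff\<close>)
    then show "filterlim (\<lambda>s::real. 2 * pi * s * (\<mu> \<bullet> w - r)) at_bot at_top"
      by (simp add: mult_ac)
  qed
  then have "((\<lambda>s. c * echar \<mu> z * of_real (exp (2 * pi * s * (\<mu> \<bullet> w - r)))) \<longlongrightarrow> c * echar \<mu> z * of_real 0) at_top"
    by (intro tendsto_intros)
  note lim = tendsto_add[OF this add.IH]
  have "c * echar \<mu> z * of_real (exp (2 * pi * s * (\<mu> \<bullet> w - r))) + F * of_real (exp (- (2 * pi * s * r)))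
      = (c * echar \<mu> (z + (\<chi> i. - \<i> * of_real (s * w $ i))) + F) * of_real (exp (- (2 * pi * s * r)))" for s F
  proof -
    have "exp (2 * pi * s * (\<mu> \<bullet> w - r)) = exp (2 * pi * s * (\<mu> \<bullet> w)) * exp (- (2 * pi * s * r))"
      by (simp add: exp_add[symmetric] right_diff_distrib)
    then show ?thesis unfolding echar_shift by (simp only: of_real_mult distrib_right mult.assoc)
  qed
  then show ?case using lim by simp
qed simp

lemma lead_limit:
  assumes "lead f \<alpha> c" "z \<in> A"
  shows "((\<lambda>s. f (z + (\<chi> i. - \<i> * of_real (s * w $ i))) * of_real (exp (- (2 * pi * s * (\<alpha> \<bullet> w)))))
    \<longlongrightarrow> c * echar \<alpha> z) at_top"
proof -
  obtain g where g: "g \<in> expsum {\<mu>\<in>M. \<mu> \<bullet> w < \<alpha> \<bullet> w}" "\<forall>z\<in>A. f z = c * echar \<alpha> z + g z"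
    using assms by (auto simp: lead_def)
  have "f (z + (\<chi> i. - \<i> * of_real (s * w $ i))) * of_real (exp (- (2 * pi * s * (\<alpha> \<bullet> w))))
     = c * echar \<alpha> z +
        g (z + (\<chi> i. - \<i> * of_real (s * w $ i))) * of_real (exp (- (2 * pi * s * (\<alpha> \<bullet> w))))" for s
  proof -
    have 1: "of_real (exp (2 * pi * s * (\<alpha> \<bullet> w))) * of_real (exp (- (2 * pi * s * (\<alpha> \<bullet> w)))) = (1::complex)"
      by (simp add: of_real_mult[symmetric] exp_add[symmetric] del: of_real_mult)
    have "f (z + (\<chi> i. - \<i> * of_real (s * w $ i)))
        = c * (echar \<alpha> z * of_real (exp (2 * pi * s * (\<alpha> \<bullet> w)))) + g (z + (\<chi> i. - \<i> * of_real (s * w $ i)))"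
      using g(2) A_shift[OF assms(2), of s] unfolding echar_shift[symmetric] by blast
    then show ?thesis using 1 by (simp only: distrib_right mult.assoc) simp
  qed
  then show ?thesis using tendsto_add[OF tendsto_const expsum_decay[OF g(1)], of "c * echar \<alpha> z" z] by simp
qed

lemma lead_nonzero: "lead f \<alpha> c \<Longrightarrow> \<exists>z\<in>A. f z \<noteq> 0"
proof (rule ccontr)
  assume *: "lead f \<alpha> c" "\<not> (\<exists>z\<in>A. f z \<noteq> 0)"
  obtain z where z: "z \<in> A" using A_nonempty by auto
  have "((\<lambda>s::real. 0) \<longlongrightarrow> c * echar \<alpha> z) at_top"
    using lead_limit[OF *(1) z] *(2) A_shift[OF z] by simp
  then have "c * echar \<alpha> z = 0" using tendsto_unique[OF trivial_limit_at_top_linorder] tendsto_const by blast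
  then show False using *(1) by (simp add: lead_def)
qed

text \<open>
  If \<open>\<beta>\<close> were below \<open>\<alpha>\<close>, then \<open>f\<close>, divided by the growth of \<open>\<alpha>\<close>, would tend to zero because of its
  second leading term, and to a nonzero number because of its first.
\<close>
lemma lead_unique_le:
  assumes f: "lead f \<alpha> c" and g: "lead f \<beta> d" shows "\<alpha> \<bullet> w \<le> \<beta> \<bullet> w"
proof (rule ccontr)
  assume less: "\<not> \<alpha> \<bullet> w \<le> \<beta> \<bullet> w"
  obtain z where z: "z \<in> A" using A_nonempty by auto
  obtain g where g': "g \<in> expsum {\<mu>\<in>M. \<mu> \<bullet> w < \<beta> \<bullet> w}" "\<forall>z\<in>A. f z = d * echar \<beta> z + g z"
    using g by (auto simp: lead_def)
  have \<beta>: "\<beta> \<in> M" using g by (auto simp: lead_def)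
  have "{\<mu>\<in>M. \<mu> \<bullet> w < \<beta> \<bullet> w} \<subseteq> {\<mu>\<in>M. \<mu> \<bullet> w < \<alpha> \<bullet> w}" using less by auto
  then have "g \<in> expsum {\<mu>\<in>M. \<mu> \<bullet> w < \<alpha> \<bullet> w}" using g'(1) expsum_mono by blast
  then have "(\<lambda>z. d * echar \<beta> z + g z) \<in> expsum {\<mu>\<in>M. \<mu> \<bullet> w < \<alpha> \<bullet> w}"
    using \<beta> less by (intro expsum_add expsum_cmult expsum_echar) auto
  note decay = expsum_decay[OF this, of z]
  have "((\<lambda>s. f (z + (\<chi> i. - \<i> * of_real (s * w $ i))) * of_real (exp (- (2 * pi * s * (\<alpha> \<bullet> w))))) \<longlongrightarrow> 0) at_top"
    using decay g'(2) A_shift[OF z] by simp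
  then have "c * echar \<alpha> z = 0"
    using tendsto_unique[OF trivial_limit_at_top_linorder lead_limit[OF f z]] by blast
  then show False using f by (simp add: lead_def)
qed

lemma lead_unique: "lead f \<alpha> c \<Longrightarrow> lead f \<beta> d \<Longrightarrow> \<alpha> = \<beta>"
  using lead_unique_le[of f \<alpha> c \<beta> d] lead_unique_le[of f \<beta> d \<alpha> c] generic_eq
  by (auto simp: lead_def)

lemma lead_exists:
  assumes f: "f \<in> expsum S" and S: "S \<subseteq> M" and z: "z \<in> A" "f z \<noteq> 0"
  shows "\<exists>\<alpha>\<in>S. \<exists>c. lead f \<alpha> c"
proof -
  obtain T c where T: "f = (\<lambda>z. \<Sum>\<mu>\<in>T. c \<mu> * echar \<mu> z)" "finite T" "T \<subseteq> S"
    using f by (auto simp: expsum_def)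
  define T' where "T' = {\<mu>\<in>T. c \<mu> \<noteq> 0}"
  \<comment> \<open>Terms with coefficient zero must not compete for the greatest exponent.\<close>
  have T': "finite T'" "T' \<subseteq> S" using T by (auto simp: T'_def)
  have f': "f z = (\<Sum>\<mu>\<in>T'. c \<mu> * echar \<mu> z)" for z
    unfolding T(1) T'_def using T(2) by (intro sum.mono_neutral_right) auto
  then have "T' \<noteq> {}" using z by auto
  then have "Max ((\<lambda>\<mu>. \<mu> \<bullet> w) ` T') \<in> (\<lambda>\<mu>. \<mu> \<bullet> w) ` T'" using T' by (intro Max_in) auto
  then obtain \<alpha> where "\<alpha> \<in> T'" "Max ((\<lambda>\<mu>. \<mu> \<bullet> w) ` T') = \<alpha> \<bullet> w" by auto
  then have \<alpha>: "\<alpha> \<in> T'" "\<And>\<mu>. \<mu> \<in> T' \<Longrightarrow> \<mu> \<bullet> w \<le> \<alpha> \<bullet> w"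
    using Max_ge[OF finite_imageI[OF T'(1)] imageI, of _ "\<lambda>\<mu>. \<mu> \<bullet> w"] by simp_all
  define g where "g = (\<lambda>z. \<Sum>\<mu>\<in>T' - {\<alpha>}. c \<mu> * echar \<mu> z)"
  have "T' - {\<alpha>} \<subseteq> {\<mu>\<in>M. \<mu> \<bullet> w < \<alpha> \<bullet> w}"
  proof
    fix \<mu> assume "\<mu> \<in> T' - {\<alpha>}"
    then have "\<mu> \<in> M" "\<mu> \<bullet> w \<le> \<alpha> \<bullet> w" "\<mu> \<bullet> w \<noteq> \<alpha> \<bullet> w" using \<alpha> T' S generic_eq[of \<mu> \<alpha>] by auto
    then show "\<mu> \<in> {\<mu>\<in>M. \<mu> \<bullet> w < \<alpha> \<bullet> w}" by simp
  qed
  then have "g \<in> expsum {\<mu>\<in>M. \<mu> \<bullet> w < \<alpha> \<bullet> w}"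
    unfolding expsum_def g_def using T' by blast
  moreover have "f z = c \<alpha> * echar \<alpha> z + g z" for z
    unfolding f' g_def using \<alpha> T' by (simp add: sum.remove)
  ultimately have "lead f \<alpha> (c \<alpha>)"
    using \<alpha>(1) T' S by (auto simp: lead_def T'_def)
  then show ?thesis using \<alpha>(1) T' by blast
qed

lemma lead_mult:
  assumes "lead f \<alpha> c" "lead g \<beta> d" shows "lead (\<lambda>z. f z * g z) (\<alpha> + \<beta>) (c * d)"
proof -
  let ?lo = "\<lambda>\<gamma>. {\<mu>\<in>M. \<mu> \<bullet> w < \<gamma> \<bullet> w}"
  obtain F where F: "F \<in> expsum (?lo \<alpha>)" "\<forall>z\<in>A. f z = c * echar \<alpha> z + F z"
    using assms by (auto simp: lead_def)
  obtain G where G: "G \<in> expsum (?lo \<beta>)" "\<forall>z\<in>A. g z = d * echar \<beta> z + G z"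
    using assms by (auto simp: lead_def)
  have M: "\<alpha> \<in> M" "\<beta> \<in> M" "c \<noteq> 0" "d \<noteq> 0" using assms by (auto simp: lead_def)
  have cA: "(\<lambda>z. c * echar \<alpha> z) \<in> expsum {\<alpha>}" and dB: "(\<lambda>z. d * echar \<beta> z) \<in> expsum {\<beta>}"
    by (auto intro: expsum_cmult expsum_echar)
  have "(\<lambda>z. c * echar \<alpha> z * G z + (F z * (d * echar \<beta> z) + F z * G z)) \<in> expsum (?lo (\<alpha> + \<beta>))"
    by (intro expsum_add expsum_mult[OF cA G(1)] expsum_mult[OF F(1) dB] expsum_mult[OF F(1) G(1)])
      (use M in \<open>simp_all add: inner_add_left M_add\<close>)
  moreover have "f z * g z = c * d * echar (\<alpha> + \<beta>) z +
      (c * echar \<alpha> z * G z + (F z * (d * echar \<beta> z) + F z * G z))" if "z \<in> A" for z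
    using that F G by (simp add: algebra_simps echar_add)
  ultimately show ?thesis using M by (auto simp: lead_def M_add)
qed

lemma lead_one: "lead (\<lambda>_. 1) 0 1"
  unfolding lead_def by (auto simp: M_zero intro!: bexI[of _ "\<lambda>_. 0"])

lemma lead_pow: "lead f \<alpha> c \<Longrightarrow> lead (\<lambda>z. f z ^ m) (real m *\<^sub>R \<alpha>) (c ^ m)"
proof (induction m)
  case 0
  then show ?case by (simp add: lead_one)
next
  case (Suc m)
  then show ?case using lead_mult[OF Suc.prems Suc.IH[OF Suc.prems]] by (simp add: algebra_simps)
qed

text \<open>
  Leading terms multiply, and a function with a leading term does not vanish identically.
\<close>
theorem expsum_no_zero_divisors:
  assumes "f \<in> expsum M" "g \<in> expsum M" and "\<And>z. z \<in> A \<Longrightarrow> f z * g z = 0"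
  shows "(\<forall>z\<in>A. f z = 0) \<or> (\<forall>z\<in>A. g z = 0)"
proof (rule ccontr)
  assume *: "\<not> ?thesis"
  then obtain \<alpha> c where "lead f \<alpha> c" using lead_exists[OF assms(1) order_refl] by blast
  moreover obtain \<beta> d where "lead g \<beta> d" using * lead_exists[OF assms(2) order_refl] by blast
  ultimately show False using lead_nonzero[OF lead_mult] assms(3) by blast
qed

end

section \<open>Complete integral closedness of rings of exponential sums\<close>

context exponential_frame
begin

text \<open>
  Think of \<open>a / b\<close> as a function with leading exponent \<open>\<alpha> - \<beta>\<close>. The leading exponent of
  \<open>c (a / b)\<^sup>m = g m\<close> is \<open>\<gamma> + m (\<alpha> - \<beta>)\<close>, and it occurs in \<open>g m\<close>, so its norm is at most
  \<open>(m + 1) r\<close>. Divide by \<open>m\<close> and let \<open>m\<close> tend to infinity.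
\<close>
lemma quotient_lead_bounded:
  assumes a: "lead a \<alpha> a0" and b: "lead b \<beta> b0" and c: "lead c \<gamma> c0"
    and g: "\<And>m. g m \<in> expsum (M \<inter> cball 0 (real (Suc m) * r))"
    and eq: "\<And>m z. z \<in> A \<Longrightarrow> c z * a z ^ m = b z ^ m * g m z"
  shows "norm (\<alpha> - \<beta>) \<le> r"
proof -
  define \<delta> where "\<delta> = \<alpha> - \<beta>"
  have nb: "norm (\<gamma> + real m *\<^sub>R \<delta>) \<le> real (Suc m) * r" for m
  proof -
    have "lead (\<lambda>z. c z * a z ^ m) (\<gamma> + real m *\<^sub>R \<alpha>) (c0 * a0 ^ m)"
      by (rule lead_mult[OF c lead_pow[OF a]])
    then have l: "lead (\<lambda>z. b z ^ m * g m z) (\<gamma> + real m *\<^sub>R \<alpha>) (c0 * a0 ^ m)"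
      by (rule iffD1[OF lead_cong, rotated]) (rule eq)
    then obtain z where "z \<in> A" "g m z \<noteq> 0" using lead_nonzero[OF l] by auto
    then obtain \<eta> e where \<eta>: "\<eta> \<in> M \<inter> cball 0 (real (Suc m) * r)" "lead (g m) \<eta> e"
      using lead_exists[OF g[of m]] by blast
    have "\<gamma> + real m *\<^sub>R \<alpha> = real m *\<^sub>R \<beta> + \<eta>"
      by (rule lead_unique[OF l lead_mult[OF lead_pow[OF b] \<eta>(2)]])
    then have "\<gamma> + real m *\<^sub>R \<delta> = \<eta>" by (simp add: \<delta>_def algebra_simps)
    then show ?thesis using \<eta>(1) by simp
  qed
  have "real m * norm \<delta> \<le> real m * r + (r + norm \<gamma>)" for m
  proof -
    have "real m * norm \<delta> = norm ((\<gamma> + real m *\<^sub>R \<delta>) - \<gamma>)" by simp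
    also have "\<dots> \<le> norm (\<gamma> + real m *\<^sub>R \<delta>) + norm \<gamma>" by (rule norm_triangle_ineq4)
    finally show ?thesis using nb[of m] by (simp add: distrib_right)
  qed
  then have "norm \<delta> \<le> r" by (rule le_of_nat_mult_bound)
  then show ?thesis by (simp add: \<delta>_def)
qed

text \<open>
  The growth condition on the powers of \<open>a / b\<close> survives the addition of a multiple of a character in
  the ball of radius \<open>r\<close>: expand by the binomial theorem and note that the summand with \<open>j\<close> factors
  \<open>a / b\<close> has its exponents in the ball of radius \<open>(j + 1) r + (m - j) r = (m + 1) r\<close>.
\<close>
lemma subtract_monomial_bounded:
  assumes \<delta>: "\<delta> \<in> M" "norm \<delta> \<le> r"
    and g: "\<And>m. g m \<in> expsum (M \<inter> cball 0 (real (Suc m) * r))"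
    and eq: "\<And>m z. z \<in> A \<Longrightarrow> c z * a z ^ m = b z ^ m * g m z"
  shows "\<exists>g \<in> expsum (M \<inter> cball 0 (real (Suc m) * r)).
    \<forall>z\<in>A. c z * (a z + k * (b z * echar \<delta> z)) ^ m = b z ^ m * g z"
proof (intro bexI ballI)
  let ?G = "\<lambda>z. \<Sum>j\<le>m. (of_nat (m choose j) * k ^ (m - j)) * (g j z * echar (real (m - j) *\<^sub>R \<delta>) z)"
  show "?G \<in> expsum (M \<inter> cball 0 (real (Suc m) * r))"
  proof (rule expsum_sum, rule expsum_cmult)
    fix j assume j: "j \<in> {..m}"
    show "(\<lambda>z. g j z * echar (real (m - j) *\<^sub>R \<delta>) z) \<in> expsum (M \<inter> cball 0 (real (Suc m) * r))"
    proof (rule expsum_mult[OF g expsum_echar])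
      show "real (m - j) *\<^sub>R \<delta> \<in> {real (m - j) *\<^sub>R \<delta>}" by simp
      fix \<mu> \<nu> assume "\<mu> \<in> M \<inter> cball 0 (real (Suc j) * r)" "\<nu> \<in> {real (m - j) *\<^sub>R \<delta>}"
      then have \<mu>: "\<mu> \<in> M" "norm \<mu> \<le> real (Suc j) * r" "\<nu> = real (m - j) *\<^sub>R \<delta>" by auto
      have "norm (\<mu> + \<nu>) \<le> real (Suc j) * r + real (m - j) * norm \<delta>"
        using norm_triangle_ineq[of \<mu> \<nu>] \<mu> by simp
      also have "\<dots> \<le> real (Suc j) * r + real (m - j) * r"
        using \<delta> by (intro add_left_mono mult_left_mono) auto
      also have "\<dots> = real (Suc m) * r" using j by (simp add: of_nat_diff algebra_simps)
      finally show "\<mu> + \<nu> \<in> M \<inter> cball 0 (real (Suc m) * r)"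
        using \<mu> \<delta> by (simp add: M_add M_scale)
    qed
  qed
  fix z assume z: "z \<in> A"
  have "c z * (a z + k * (b z * echar \<delta> z)) ^ m
      = (\<Sum>j\<le>m. of_nat (m choose j) * (c z * a z ^ j) * (k * (b z * echar \<delta> z)) ^ (m - j))"
    unfolding binomial_ring sum_distrib_left by (intro sum.cong refl) (simp only: mult_ac)
  also have "\<dots> = (\<Sum>j\<le>m. of_nat (m choose j) * (b z ^ j * g j z) * (k * (b z * echar \<delta> z)) ^ (m - j))"
    by (simp only: eq[OF z])
  also have "\<dots> = b z ^ m * ?G z"
    unfolding sum_distrib_left
  proof (intro sum.cong refl)
    fix j assume "j \<in> {..m}"
    then have "b z ^ m = b z ^ j * b z ^ (m - j)" by (simp add: power_add[symmetric])
    then show "of_nat (m choose j) * (b z ^ j * g j z) * (k * (b z * echar \<delta> z)) ^ (m - j)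
      = b z ^ m * ((of_nat (m choose j) * k ^ (m - j)) * (g j z * echar (real (m - j) *\<^sub>R \<delta>) z))"
      unfolding echar_pow power_mult_distrib by (simp only: mult_ac)
  qed
  finally show "c z * (a z + k * (b z * echar \<delta> z)) ^ m = b z ^ m * ?G z" .
qed

text \<open>
  One step of the division of \<open>a\<close> by \<open>b\<close>: subtracting the quotient of the leading terms times \<open>b\<close>
  lowers the leading exponent of \<open>a\<close>.
\<close>
lemma subtract_lead:
  assumes a: "lead a \<alpha> a0" and b: "lead b \<beta> b0"
  shows "\<exists>H \<in> expsum {\<mu>\<in>M. \<mu> \<bullet> w < \<alpha> \<bullet> w}.
    \<forall>z\<in>A. a z + (- (a0 / b0)) * (b z * echar (\<alpha> - \<beta>) z) = H z"
proof -
  let ?lo = "\<lambda>\<gamma>. {\<mu>\<in>M. \<mu> \<bullet> w < \<gamma> \<bullet> w}" and ?k = "a0 / b0" and ?\<delta> = "\<alpha> - \<beta>"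
  obtain F where F: "F \<in> expsum (?lo \<alpha>)" "\<forall>z\<in>A. a z = a0 * echar \<alpha> z + F z"
    using a by (auto simp: lead_def)
  obtain G where G: "G \<in> expsum (?lo \<beta>)" "\<forall>z\<in>A. b z = b0 * echar \<beta> z + G z"
    using b by (auto simp: lead_def)
  have M: "?\<delta> \<in> M" "b0 \<noteq> 0" using a b by (auto simp: lead_def M_diff)
  have "(\<lambda>z. G z * echar ?\<delta> z) \<in> expsum (?lo \<alpha>)"
    by (rule expsum_mult[OF G(1) expsum_echar[of ?\<delta> "{?\<delta>}"]])
      (use M in \<open>auto simp: inner_diff_left inner_add_left intro: M_add\<close>)
  from expsum_add[OF F(1) expsum_cmult[OF this, of "- ?k"]]
  have "(\<lambda>z. F z + (- ?k) * (G z * echar ?\<delta> z)) \<in> expsum (?lo \<alpha>)" .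
  moreover have "\<forall>z\<in>A. a z + (- ?k) * (b z * echar ?\<delta> z) = F z + (- ?k) * (G z * echar ?\<delta> z)"
  proof
    fix z assume that: "z \<in> A"
    have expand: "(p + f) + (- k) * ((q + g) * e) = p + f - k * (q * e) - k * (g * e)"
      for p f q g e k :: complex by (simp add: algebra_simps)
    have "echar \<alpha> z = echar \<beta> z * echar ?\<delta> z" by (simp add: echar_add[symmetric])
    then have k: "?k * (b0 * echar \<beta> z * echar ?\<delta> z) = a0 * echar \<alpha> z"
      using M(2) by simp
    have cancel: "p + f - p - k * x = f + (- k) * x" for p f k x :: complex by simp
    have "a z + (- ?k) * (b z * echar ?\<delta> z) = a0 * echar \<alpha> z + F z
        - ?k * (b0 * echar \<beta> z * echar ?\<delta> z) - ?k * (G z * echar ?\<delta> z)"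
      unfolding bspec[OF F(2) that] bspec[OF G(2) that] by (rule expand)
    also have "\<dots> = F z + (- ?k) * (G z * echar ?\<delta> z)" unfolding k by (rule cancel)
    finally show "a z + (- ?k) * (b z * echar ?\<delta> z) = F z + (- ?k) * (G z * echar ?\<delta> z)" .
  qed
  ultimately show ?thesis by - (rule rev_bexI)
qed

text \<open>
  A quotient \<open>a / b\<close> whose powers have a common denominator \<open>c\<close>, with exponents growing at most
  linearly, is an exponential sum. Divide \<open>a\<close> by \<open>b\<close> with respect to leading terms. All exponents
  produced lie in the ball of radius \<open>r\<close> by \<open>quotient_lead_bounded\<close>, and they decrease strictly.
  As this ball contains only finitely many exponents, the division ends, and it can only end with
  remainder zero.
\<close>
theorem expsum_completely_integrally_closed:
  assumes b: "b \<in> expsum M" "lead b \<beta> b0" and c: "lead c \<gamma> c0"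
    and fin: "finite (M \<inter> cball 0 r)"
    and a: "a \<in> expsum M"
    and bounded: "\<And>m. \<exists>g \<in> expsum (M \<inter> cball 0 (real (Suc m) * r)).
        \<forall>z\<in>A. c z * a z ^ m = b z ^ m * g z"
  shows "\<exists>h\<in>expsum M. \<forall>z\<in>A. a z = b z * h z"
proof -
  define low where "low \<delta> = {\<mu> \<in> M \<inter> cball 0 r. \<mu> \<bullet> w \<le> \<delta> \<bullet> w}" for \<delta>
  have fin_low: "finite (low \<delta>)" for \<delta>
    using fin by (rule rev_finite_subset) (auto simp: low_def)
  have step: "\<exists>h\<in>expsum M. \<forall>z\<in>A. a z = b z * h z"
    if "a \<in> expsum M" "lead a \<alpha> a0" "\<And>m. \<exists>g \<in> expsum (M \<inter> cball 0 (real (Suc m) * r)).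
        \<forall>z\<in>A. c z * a z ^ m = b z ^ m * g z" for a \<alpha> a0
    using that
  proof (induction "card (low (\<alpha> - \<beta>))" arbitrary: a \<alpha> a0 rule: less_induct)
    case less
    let ?\<delta> = "\<alpha> - \<beta>"
    have "\<forall>m. \<exists>g. g \<in> expsum (M \<inter> cball 0 (real (Suc m) * r)) \<and>
        (\<forall>z\<in>A. c z * a z ^ m = b z ^ m * g z)"
      using less.prems(3) by blast
    from choice[OF this] obtain g where
      g': "\<forall>m. g m \<in> expsum (M \<inter> cball 0 (real (Suc m) * r)) \<and> (\<forall>z\<in>A. c z * a z ^ m = b z ^ m * g m z)" ..
    have g: "g m \<in> expsum (M \<inter> cball 0 (real (Suc m) * r))" for m using spec[OF g'] ..
    have gz: "c z * a z ^ m = b z ^ m * g m z" if "z \<in> A" for m z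
      using bspec[OF conjunct2[OF spec[OF g']] that] .
    have M: "?\<delta> \<in> M"
      using less.prems(2) b c by (auto simp: lead_def M_diff)
    have \<delta>r: "norm ?\<delta> \<le> r"
      using quotient_lead_bounded[OF less.prems(2) b(2) c g gz] by simp
    define k where "k = - (a0 / b0)"
    define a' where "a' = (\<lambda>z. a z + k * (b z * echar ?\<delta> z))"
    have "(\<lambda>z. b z * echar ?\<delta> z) \<in> expsum M"
      by (rule expsum_mult[OF b(1) expsum_echar[OF M]]) (rule M_add)
    then have a': "a' \<in> expsum M"
      unfolding a'_def by (intro expsum_add[OF less.prems(1)] expsum_cmult)
    have bounded': "\<exists>g \<in> expsum (M \<inter> cball 0 (real (Suc m) * r)).
        \<forall>z\<in>A. c z * a' z ^ m = b z ^ m * g z" for m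
      unfolding a'_def by (rule subtract_monomial_bounded[OF M \<delta>r g gz])
    have "\<exists>h\<in>expsum M. \<forall>z\<in>A. a' z = b z * h z"
    proof (cases "\<exists>z\<in>A. a' z \<noteq> 0")
      case False
      then show ?thesis by (intro bexI[of _ "\<lambda>_. 0"]) auto
    next
      case True
      obtain H where H: "H \<in> expsum {\<mu>\<in>M. \<mu> \<bullet> w < \<alpha> \<bullet> w}" "\<forall>z\<in>A. a' z = H z"
        using subtract_lead[OF less.prems(2) b(2)] unfolding a'_def k_def by (rule bexE)
      then obtain z where "z \<in> A" "H z \<noteq> 0" using True by auto
      then obtain \<alpha>' a0' where \<alpha>': "\<alpha>' \<in> {\<mu>\<in>M. \<mu> \<bullet> w < \<alpha> \<bullet> w}" "lead H \<alpha>' a0'"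
        using lead_exists[OF H(1), of z] by blast
      from \<alpha>'(2) have l: "lead a' \<alpha>' a0'"
        by (rule iffD1[OF lead_cong, rotated]) (simp add: H(2))
      \<comment> \<open>The number of admissible exponents below the leading one drops, which is the induction measure.\<close>
      have "?\<delta> \<in> low ?\<delta>" "?\<delta> \<notin> low (\<alpha>' - \<beta>)" "low (\<alpha>' - \<beta>) \<subseteq> low ?\<delta>"
        using \<alpha>'(1) \<delta>r M by (auto simp: low_def inner_diff_left)
      then have "low (\<alpha>' - \<beta>) \<subset> low ?\<delta>" by blast
      then have "card (low (\<alpha>' - \<beta>)) < card (low ?\<delta>)" by (rule psubset_card_mono[OF fin_low])
      from less.hyps[OF this a' l bounded'] show ?thesis .
    qed
    then obtain h where h: "h \<in> expsum M" "\<forall>z\<in>A. a' z = b z * h z" by blast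
    have "(\<lambda>z. h z + (- k) * echar ?\<delta> z) \<in> expsum M"
      by (rule expsum_add[OF h(1) expsum_cmult[OF expsum_echar[OF M]]])
    moreover have "\<forall>z\<in>A. a z = b z * (h z + (- k) * echar ?\<delta> z)"
    proof
      fix z assume "z \<in> A"
      then have "a z = b z * h z - k * (b z * echar ?\<delta> z)"
        using h(2) unfolding a'_def by (metis add_diff_cancel_right')
      then show "a z = b z * (h z + (- k) * echar ?\<delta> z)" by (simp add: algebra_simps)
    qed
    ultimately show ?case by - (rule rev_bexI)
  qed
  show ?thesis
  proof (cases "\<exists>z\<in>A. a z \<noteq> 0")
    case False
    then show ?thesis by (intro bexI[of _ "\<lambda>_. 0"]) auto
  next
    case True
    then obtain \<alpha> a0 where "lead a \<alpha> a0" using lead_exists[OF a order_refl] by blast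
    from step[OF a this bounded] show ?thesis .
  qed
qed

end

section \<open>Lattices of type A and the extended affine Weyl group\<close>

definition perm_act :: "('n \<Rightarrow> 'n) \<Rightarrow> 'a ^ 'n \<Rightarrow> 'a ^ 'n" where
  "perm_act p x = (\<chi> i. x $ p i)"

lemma perm_act_nth [simp]: "perm_act p x $ i = x $ p i"
  by (simp add: perm_act_def)

lemma perm_act_comp: "perm_act p (perm_act q x) = perm_act (q \<circ> p) x"
  by (simp add: vec_eq_iff)

lemma sum_permute_UNIV:
  "p permutes (UNIV :: 'n::finite set) \<Longrightarrow> (\<Sum>i\<in>UNIV. f (p i)) = (\<Sum>i\<in>UNIV. f i)"
  by (rule sum.reindex_bij_betw) (auto intro: permutes_imp_bij)

lemma inner_root: "(axis i 1 - axis j 1) \<bullet> (x :: real ^ 'n) = x $ i - x $ j"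
  by (simp add: inner_diff_left inner_axis')

lemma coroot_root: "i \<noteq> j \<Longrightarrow> coroot (axis i 1 - axis j 1 :: real ^ 'n) = axis i 1 - axis j 1"
  by (simp add: coroot_def inner_root) (simp add: axis_def)

lemma reflection_root:
  assumes "i \<noteq> j"
  shows "reflection (axis i 1 - axis j 1 :: real ^ 'a) = perm_act (Transposition.transpose i j)"
proof
  fix x :: "real ^ 'a"
  have "(x - (x $ i - x $ j) *\<^sub>R (axis i 1 - axis j 1)) $ k = x $ Transposition.transpose i j k" for k
    using assms by (auto simp: axis_def Transposition.transpose_def)
  then show "reflection (axis i 1 - axis j 1) x = perm_act (Transposition.transpose i j) x"
    unfolding reflection_def coroot_root[OF assms] inner_root by (simp add: vec_eq_iff)
qed

text \<open>
  The reflection in a root interchanges two coordinates, and every permutation is a product of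
  transpositions.
\<close>
lemma weyl_group_eq: "weyl_group = perm_act ` {p. p permutes (UNIV :: 'n::finite set)}"
proof (intro Set.set_eqI iffI)
  fix w :: "real ^ 'n \<Rightarrow> real ^ 'n" assume "w \<in> weyl_group"
  then show "w \<in> perm_act ` {p. p permutes UNIV}"
  proof induction
    case weyl_id
    show ?case by (rule image_eqI[of _ _ id]) (auto simp: perm_act_def fun_eq_iff vec_eq_iff)
  next
    case (weyl_reflection w \<alpha>)
    then obtain p i j where p: "w = perm_act p" "p permutes UNIV" "i \<noteq> j" "\<alpha> = axis i 1 - axis j 1"
      by (auto simp: roots_def)
    have "reflection \<alpha> \<circ> w = perm_act (p \<circ> Transposition.transpose i j)"
      unfolding p(1,4) reflection_root[OF p(3)] by (rule ext) (simp only: comp_apply perm_act_comp)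
    moreover have "p \<circ> Transposition.transpose i j permutes UNIV"
      using p(2) by (intro permutes_compose permutes_swap_id) auto
    ultimately show ?case by simp
  qed
next
  fix w :: "real ^ 'n \<Rightarrow> real ^ 'n" assume "w \<in> perm_act ` {p. p permutes UNIV}"
  then obtain p where p: "p permutes UNIV" "w = perm_act p" by auto
  have "perm_act p \<in> (weyl_group :: (real ^ 'n \<Rightarrow> real ^ 'n) set)"
  proof (rule permutes_rev_induct[OF finite p(1)])
    show "perm_act id \<in> (weyl_group :: (real ^ 'n \<Rightarrow> real ^ 'n) set)"
    proof -
      have "perm_act id = (id :: real ^ 'n \<Rightarrow> real ^ 'n)" by (simp add: fun_eq_iff vec_eq_iff)
      then show ?thesis using weyl_id by simp
    qed
  next
    fix a b :: 'n and p :: "'n \<Rightarrow> 'n"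
    assume "perm_act p \<in> (weyl_group :: (real ^ 'n \<Rightarrow> real ^ 'n) set)" "a \<noteq> b"
    then have "reflection (axis a 1 - axis b 1) \<circ> perm_act p \<in> (weyl_group :: (real ^ 'n \<Rightarrow> real ^ 'n) set)"
      by (intro weyl_reflection) (auto simp: roots_def)
    then show "perm_act (p \<circ> Transposition.transpose a b) \<in> (weyl_group :: (real ^ 'n \<Rightarrow> real ^ 'n) set)"
      using \<open>a \<noteq> b\<close> by (simp add: reflection_root comp_def perm_act_comp)
  qed
  then show "w \<in> weyl_group" using p by simp
qed

lemma extend_map_perm_act: "extend_map (perm_act p) z = perm_act p z"
  by (simp add: extend_map_def cvec_def vec_eq_iff)

lemma ext_affine_weyl_eq:
  "ext_affine_weyl (N :: (real ^ 'a) set) = {\<lambda>z. perm_act p z + cvec \<nu> 0 | p \<nu>. p permutes UNIV \<and> \<nu> \<in> N}"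
proof (intro Set.set_eqI iffI)
  have eq: "extend_map (perm_act p) = perm_act p" for p :: "'a \<Rightarrow> 'a"
    by (rule ext) (rule extend_map_perm_act)
  fix f :: "complex ^ 'a \<Rightarrow> complex ^ 'a"
  assume "f \<in> ext_affine_weyl N"
  then obtain p \<nu> where f: "f = (\<lambda>z. extend_map (perm_act p) z + cvec \<nu> 0)" "p permutes UNIV" "\<nu> \<in> N"
    unfolding ext_affine_weyl_def weyl_group_eq by auto
  show "f \<in> {\<lambda>z. perm_act p z + cvec \<nu> 0 | p \<nu>. p permutes UNIV \<and> \<nu> \<in> N}"
    by (intro CollectI exI[of _ p] exI[of _ \<nu>] conjI f(2,3)) (simp only: f(1) eq)
next
  have eq: "extend_map (perm_act p) = perm_act p" for p :: "'a \<Rightarrow> 'a"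
    by (rule ext) (rule extend_map_perm_act)
  fix f :: "complex ^ 'a \<Rightarrow> complex ^ 'a"
  assume "f \<in> {\<lambda>z. perm_act p z + cvec \<nu> 0 | p \<nu>. p permutes UNIV \<and> \<nu> \<in> N}"
  then obtain p \<nu> where f: "f = (\<lambda>z. perm_act p z + cvec \<nu> 0)" "p permutes UNIV" "\<nu> \<in> N"
    by auto
  show "f \<in> ext_affine_weyl N"
    unfolding ext_affine_weyl_def weyl_group_eq
    by (intro CollectI exI[of _ "perm_act p"] exI[of _ \<nu>] conjI f(3) imageI f(2)) (simp only: f(1) eq)
qed

lemma cvec_nth [simp]: "cvec x y $ i = Complex (x $ i) (y $ i)"
  by (simp add: cvec_def)

lemma complexify_E_space: "complexify E_space = {z :: complex ^ 'n. (\<Sum>i\<in>UNIV. z $ i) = 0}"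
proof (intro Set.set_eqI iffI)
  fix z :: "complex ^ 'n" assume "z \<in> complexify E_space"
  then show "z \<in> {z. (\<Sum>i\<in>UNIV. z $ i) = 0}"
    by (auto simp: complexify_def E_space_def complex_eq_iff sum_subtractf)
next
  fix z :: "complex ^ 'n" assume "z \<in> {z. (\<Sum>i\<in>UNIV. z $ i) = 0}"
  then have "(\<Sum>i\<in>UNIV. Re (z $ i)) = 0 \<and> (\<Sum>i\<in>UNIV. Im (z $ i)) = 0"
    using Re_sum[of "\<lambda>i. z $ i" UNIV] Im_sum[of "\<lambda>i. z $ i" UNIV] by simp
  then show "z \<in> complexify E_space"
    unfolding complexify_def E_space_def
    by (intro CollectI exI[of _ "\<chi> i. Re (z $ i)"] exI[of _ "\<chi> i. Im (z $ i)"] exI[of _ "0::real ^ 'n"])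
      (simp add: vec_eq_iff)
qed

lemma finite_roots: "finite (roots :: (real ^ 'n) set)"
proof -
  have "(roots :: (real ^ 'n) set) = (\<lambda>(i, j). axis i 1 - axis j 1) ` {(i, j). i \<noteq> j}"
    by (auto simp: roots_def)
  then show ?thesis by (metis finite finite_imageI)
qed

lemma coroot_lattice_add:
  assumes "x \<in> coroot_lattice" "y \<in> coroot_lattice" shows "x + y \<in> coroot_lattice"
proof -
  obtain c d where "x = (\<Sum>\<alpha>\<in>roots. of_int (c \<alpha>) *\<^sub>R coroot \<alpha>)" "y = (\<Sum>\<alpha>\<in>roots. of_int (d \<alpha>) *\<^sub>R coroot \<alpha>)"
    using assms by (auto simp: coroot_lattice_def)
  then have "x + y = (\<Sum>\<alpha>\<in>roots. of_int (c \<alpha> + d \<alpha>) *\<^sub>R coroot \<alpha>)"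
    by (simp add: scaleR_add_left sum.distrib)
  then show ?thesis unfolding coroot_lattice_def by (intro CollectI exI[of _ "\<lambda>\<alpha>. c \<alpha> + d \<alpha>"]) simp
qed

lemma coroot_lattice_root:
  assumes "\<alpha> \<in> roots" shows "of_int k *\<^sub>R coroot \<alpha> \<in> coroot_lattice"
proof -
  have "of_int k *\<^sub>R coroot \<alpha> = (\<Sum>\<beta>\<in>roots. of_int (if \<beta> = \<alpha> then k else 0) *\<^sub>R coroot \<beta>)"
  proof -
    have "(\<Sum>\<beta>\<in>roots. of_int (if \<beta> = \<alpha> then k else 0) *\<^sub>R coroot \<beta>)
        = (\<Sum>\<beta>\<in>roots. if \<beta> = \<alpha> then of_int k *\<^sub>R coroot \<alpha> else 0)"
      by (intro sum.cong) auto
    then show ?thesis using assms by (simp add: sum.delta[OF finite_roots])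
  qed
  then show ?thesis unfolding coroot_lattice_def by (intro CollectI exI[of _ "\<lambda>\<beta>. if \<beta> = \<alpha> then k else 0"]) simp
qed

lemma sum_zero_root_combination:
  fixes x :: "real ^ 'n"
  assumes "(\<Sum>i\<in>UNIV. x $ i) = 0"
  shows "x = (\<Sum>i\<in>UNIV. (x $ i) *\<^sub>R (axis i 1 - axis j 1))"
proof -
  have "(\<Sum>i\<in>UNIV. (x $ i) *\<^sub>R (axis i 1 - axis j 1 :: real ^ 'n)) $ k
      = (\<Sum>i\<in>UNIV. if i = k then x $ i else 0) - (\<Sum>i\<in>UNIV. x $ i) * axis j 1 $ k" for k
    unfolding sum_distrib_right sum_subtractf[symmetric] sum_component
    by (intro sum.cong) (auto simp: axis_def algebra_simps)
  then show ?thesis using assms by (simp add: vec_eq_iff)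
qed

text \<open>
  By \<open>sum_zero_root_combination\<close> such a vector is an integral combination of roots, and the roots are
  their own coroots.
\<close>
lemma integral_vector_in_coroot_lattice:
  fixes x :: "real ^ 'n"
  assumes "\<And>i. x $ i \<in> \<int>" "(\<Sum>i\<in>UNIV. x $ i) = 0"
  shows "x \<in> coroot_lattice"
proof -
  obtain j :: 'n where True by auto
  let ?v = "\<lambda>i. (x $ i) *\<^sub>R (axis i 1 - axis j 1 :: real ^ 'n)"
  have zero: "0 \<in> (coroot_lattice :: (real ^ 'n) set)"
    unfolding coroot_lattice_def by (intro CollectI exI[of _ "\<lambda>_. 0"]) simp
  have "?v i \<in> coroot_lattice" for i
  proof (cases "i = j")
    case False
    then show ?thesis
      using coroot_lattice_root[of "axis i 1 - axis j 1" "\<lfloor>x $ i\<rfloor>"] assms(1)[of i]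
      by (auto simp: roots_def coroot_root)
  qed (simp add: zero)
  then have "(\<Sum>i\<in>S. ?v i) \<in> coroot_lattice" for S
    by (induction S rule: infinite_finite_induct) (auto simp: zero intro: coroot_lattice_add)
  from this[of UNIV] show ?thesis unfolding sum_zero_root_combination[OF assms(2), of j, symmetric] .
qed

lemma coroot_lattice_integral:
  assumes "x \<in> coroot_lattice"
  shows "x $ i \<in> \<int>" "(\<Sum>i\<in>UNIV. x $ i) = 0"
proof -
  obtain c where x: "x = (\<Sum>\<alpha>\<in>roots. of_int (c \<alpha>) *\<^sub>R coroot \<alpha>)"
    using assms by (auto simp: coroot_lattice_def)
  have *: "coroot \<alpha> $ i \<in> \<int>" "(\<Sum>i\<in>UNIV. coroot \<alpha> $ i) = 0" if root: "\<alpha> \<in> roots" for i and \<alpha> :: "real ^ 'a"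
  proof -
    obtain j k where "j \<noteq> k" "\<alpha> = axis j 1 - axis k 1" using root by (auto simp: roots_def)
    then have "coroot \<alpha> = axis j 1 - axis k 1" by (simp add: coroot_root)
    then show "coroot \<alpha> $ i \<in> \<int>" "(\<Sum>i\<in>UNIV. coroot \<alpha> $ i) = 0"
      by (auto simp: axis_def sum_subtractf)
  qed
  show "x $ i \<in> \<int>" unfolding x sum_component by (intro Ints_sum) (simp add: *(1))
  have "(\<Sum>i\<in>UNIV. x $ i) = (\<Sum>\<alpha>\<in>roots. of_int (c \<alpha>) * (\<Sum>i\<in>UNIV. coroot \<alpha> $ i))"
    unfolding x sum_component by (subst sum.swap) (simp add: sum_distrib_left)
  also have "\<dots> = 0" by (intro sum.neutral ballI) (simp add: *(2))
  finally show "(\<Sum>i\<in>UNIV. x $ i) = 0" .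
qed

lemma coweight_lattice_iff:
  "x \<in> coweight_lattice \<longleftrightarrow> (\<Sum>i\<in>UNIV. x $ i) = 0 \<and> (\<forall>i j. x $ i - x $ j \<in> \<int>)"
proof -
  have "(\<forall>\<alpha>\<in>roots. \<alpha> \<bullet> x \<in> \<int>) \<longleftrightarrow> (\<forall>i j. i \<noteq> j \<longrightarrow> (axis i 1 - axis j 1) \<bullet> x \<in> \<int>)"
    unfolding roots_def by blast
  also have "\<dots> \<longleftrightarrow> (\<forall>i j. i \<noteq> j \<longrightarrow> x $ i - x $ j \<in> \<int>)" by (simp only: inner_root)
  also have "\<dots> \<longleftrightarrow> (\<forall>i j. x $ i - x $ j \<in> \<int>)" by (metis Ints_0 diff_self)
  finally show ?thesis by (simp add: coweight_lattice_def E_space_def)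
qed

lemma cocharacter_coroot_lattice: "cocharacter_lattice coroot_lattice"
  unfolding cocharacter_lattice_def
proof (intro conjI ballI subsetI)
  fix x :: "real ^ 'n" assume "x \<in> coroot_lattice"
  then show "x \<in> coweight_lattice"
    using coroot_lattice_integral[of x] by (auto simp: coweight_lattice_iff)
next
  fix x y :: "real ^ 'n" assume "x \<in> coroot_lattice" "y \<in> coroot_lattice"
  then show "x - y \<in> coroot_lattice"
    using coroot_lattice_integral[of x] coroot_lattice_integral[of y]
    by (intro integral_vector_in_coroot_lattice) (auto simp: sum_subtractf)
qed

locale cocharacters =
  fixes N :: "(real ^ 'n) set"
  assumes cocharacter_lattice: "cocharacter_lattice N"
begin

lemma integral_vector: "(\<And>i. x $ i \<in> \<int>) \<Longrightarrow> (\<Sum>i\<in>UNIV. x $ i) = 0 \<Longrightarrow> x \<in> N"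
  using integral_vector_in_coroot_lattice[of x] cocharacter_lattice
  by (auto simp: cocharacter_lattice_def)

lemma N_sum: "\<nu> \<in> N \<Longrightarrow> (\<Sum>i\<in>UNIV. \<nu> $ i) = 0"
  and N_integral: "\<nu> \<in> N \<Longrightarrow> \<nu> $ i - \<nu> $ j \<in> \<int>"
  using cocharacter_lattice coweight_lattice_iff[of \<nu>] by (auto simp: cocharacter_lattice_def)

lemma N_diff: "\<nu> \<in> N \<Longrightarrow> \<nu>' \<in> N \<Longrightarrow> \<nu> - \<nu>' \<in> N"
  using cocharacter_lattice by (auto simp: cocharacter_lattice_def)

lemma N_zero: "0 \<in> N" by (rule integral_vector) auto

lemma N_uminus: "\<nu> \<in> N \<Longrightarrow> - \<nu> \<in> N" using N_diff[OF N_zero, of \<nu>] by simp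

lemma N_add: "\<nu> \<in> N \<Longrightarrow> \<nu>' \<in> N \<Longrightarrow> \<nu> + \<nu>' \<in> N"
  using N_diff[of \<nu> "- \<nu>'"] N_uminus by simp

text \<open>
  The coordinates of a coweight differ by integers, so permuting them changes the vector by an integral
  vector of sum zero, that is, by an element of the coroot lattice.
\<close>
lemma N_perm:
  assumes "\<nu> \<in> N" "p permutes UNIV" shows "perm_act p \<nu> \<in> N"
proof -
  have "perm_act p \<nu> - \<nu> \<in> N"
    using assms by (intro integral_vector) (auto simp: N_integral sum_subtractf sum_permute_UNIV)
  then show ?thesis using N_add assms(1) by fastforce
qed

abbreviation "G \<equiv> ext_affine_weyl N"
abbreviation "EC \<equiv> complexify E_space"

lemma G_memI: "p permutes UNIV \<Longrightarrow> \<nu> \<in> N \<Longrightarrow> (\<lambda>z. perm_act p z + cvec \<nu> 0) \<in> G"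
  unfolding ext_affine_weyl_eq by blast

lemma G_memE:
  assumes "g \<in> G"
  obtains p \<nu> where "p permutes UNIV" "\<nu> \<in> N" "g = (\<lambda>z. perm_act p z + cvec \<nu> 0)"
  using assms unfolding ext_affine_weyl_eq by blast

lemma G_id: "(\<lambda>z. z) \<in> G"
proof -
  have "(\<lambda>z. perm_act id z + cvec 0 0) \<in> G" by (rule G_memI[OF permutes_id N_zero])
  moreover have "(\<lambda>z. perm_act id z + cvec 0 0) = (\<lambda>z :: complex ^ 'n. z)"
    by (auto simp: vec_eq_iff complex_eq_iff)
  ultimately show ?thesis by simp
qed

lemma G_comp:
  assumes "g \<in> G" "h \<in> G" shows "(\<lambda>z. g (h z)) \<in> G"
proof -
  obtain p \<nu> where g: "p permutes UNIV" "\<nu> \<in> N" "g = (\<lambda>z. perm_act p z + cvec \<nu> 0)"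
    using assms by (auto elim: G_memE)
  obtain q \<eta> where h: "q permutes UNIV" "\<eta> \<in> N" "h = (\<lambda>z. perm_act q z + cvec \<eta> 0)"
    using assms by (auto elim: G_memE)
  have "(\<lambda>z. perm_act (q \<circ> p) z + cvec (perm_act p \<eta> + \<nu>) 0) \<in> G"
    using g h by (intro G_memI permutes_compose N_add N_perm)
  moreover have "(\<lambda>z. perm_act (q \<circ> p) z + cvec (perm_act p \<eta> + \<nu>) 0) = (\<lambda>z. g (h z))"
    unfolding g h by (auto simp: vec_eq_iff complex_eq_iff)
  ultimately show ?thesis by simp
qed

lemma G_inverse:
  assumes "g \<in> G" shows "\<exists>h\<in>G. \<forall>z. h (g z) = z"
proof -
  obtain p \<nu> where g: "p permutes UNIV" "\<nu> \<in> N" "g = (\<lambda>z. perm_act p z + cvec \<nu> 0)"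
    using assms by (auto elim: G_memE)
  let ?q = "Hilbert_Choice.inv p"
  have q: "?q permutes UNIV" by (rule permutes_inv[OF g(1)])
  have "(\<lambda>z. perm_act ?q z + cvec (- perm_act ?q \<nu>) 0) \<in> G"
    by (rule G_memI[OF q N_uminus[OF N_perm[OF g(2) q]]])
  moreover have "\<forall>z. perm_act ?q (g z) + cvec (- perm_act ?q \<nu>) 0 = z"
    unfolding g(3) using permutes_inverses[OF g(1)] by (simp add: vec_eq_iff complex_eq_iff)
  ultimately show ?thesis by - (rule rev_bexI)
qed

lemma weyl_orbitI: "h \<in> G \<Longrightarrow> h z \<in> weyl_orbit N z"
  unfolding weyl_orbit_def by (rule CollectI) (rule exI[of _ h], simp)

lemma weyl_orbitE: "y \<in> weyl_orbit N z \<Longrightarrow> (\<And>h. h \<in> G \<Longrightarrow> y = h z \<Longrightarrow> thesis) \<Longrightarrow> thesis"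
  unfolding weyl_orbit_def by auto

lemma weyl_orbit_eq:
  assumes "g \<in> G" shows "weyl_orbit N (g z) = weyl_orbit N z"
proof -
  obtain g' where g': "g' \<in> G" "\<forall>z. g' (g z) = z" using G_inverse[OF assms] by (rule bexE)
  show ?thesis
  proof (intro Set.set_eqI iffI)
    fix y assume "y \<in> weyl_orbit N (g z)"
    then obtain h where h: "h \<in> G" "y = h (g z)" by (rule weyl_orbitE)
    show "y \<in> weyl_orbit N z" unfolding h(2) by (rule weyl_orbitI[OF G_comp[OF h(1) assms]])
  next
    fix y assume "y \<in> weyl_orbit N z"
    then obtain h where h: "h \<in> G" "y = h z" by (rule weyl_orbitE)
    have "h (g' (g z)) \<in> weyl_orbit N (g z)" by (rule weyl_orbitI[OF G_comp[OF h(1) g'(1)]])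
    then show "y \<in> weyl_orbit N (g z)" using g'(2) h(2) by simp
  qed
qed

lemma stratum_eq: "stratum N L = weyl_orbit N ` complexify L"
proof
  show "stratum N L \<subseteq> weyl_orbit N ` complexify L"
    by (auto simp: stratum_def weyl_orbit_eq)
  show "weyl_orbit N ` complexify L \<subseteq> stratum N L"
  proof -
    have "(\<lambda>z. z) ` complexify L \<subseteq> (\<Union>g\<in>G. g ` complexify L)" by (rule UN_upper[OF G_id])
    then show ?thesis unfolding stratum_def by (intro image_mono) simp
  qed
qed

lemma G_preserves_E: "g \<in> G \<Longrightarrow> z \<in> EC \<Longrightarrow> g z \<in> EC"
proof (elim G_memE)
  fix p \<nu> assume *: "z \<in> EC" "p permutes UNIV" "\<nu> \<in> N" "g = (\<lambda>z. perm_act p z + cvec \<nu> 0)"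
  have "(\<Sum>i\<in>UNIV. Complex (\<nu> $ i) 0) = 0"
    using N_sum[OF *(3)] by (simp add: complex_eq_iff)
  then show ?thesis using * by (simp add: complexify_E_space sum.distrib sum_permute_UNIV)
qed

text \<open>
  Pullbacks of the regular functions on the quotient of the torus by the Weyl group. Only
  orbits of vectors of coordinate sum zero are points of this quotient, so invariance is a condition on
  these vectors.
\<close>
definition invariant_functions :: "(complex ^ 'n \<Rightarrow> complex) set" where
  "invariant_functions = {h \<in> expsum (character_lattice N).
     \<forall>g\<in>G. \<forall>z\<in>EC. h (g z) = h z}"

lemma quotient_function_pullback:
  assumes "f \<in> quotient_functions N"
  obtains h where "h \<in> invariant_functions" "\<And>z. z \<in> EC \<Longrightarrow> f (weyl_orbit N z) = h z"
proof -
  obtain h where h: "h \<in> expsum (character_lattice N)" "\<And>z. z \<in> EC \<Longrightarrow> f (weyl_orbit N z) = h z"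
    using assms by (auto simp: quotient_functions_def torus_functions_eq_expsum)
  have "h (g z) = h z" if "g \<in> G" "z \<in> EC" for g z
    using h(2)[OF that(2)] h(2)[OF G_preserves_E[OF that]] weyl_orbit_eq[OF that(1)] by simp
  then show ?thesis using that[of h] h by (auto simp: invariant_functions_def)
qed

lemma invariant_function_descends:
  assumes h: "h \<in> invariant_functions"
  obtains f where "f \<in> quotient_functions N" "\<And>z. z \<in> EC \<Longrightarrow> f (weyl_orbit N z) = h z"
proof -
  define f where "f Q = h (SOME y. y \<in> Q)" for Q
  have "f (weyl_orbit N z) = h z" if z: "z \<in> EC" for z
  proof -
    have "z \<in> weyl_orbit N z" by (rule weyl_orbitI[OF G_id])
    then have "(SOME y. y \<in> weyl_orbit N z) \<in> weyl_orbit N z" by (rule someI)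
    then obtain g where "g \<in> G" "(SOME y. y \<in> weyl_orbit N z) = g z" by (rule weyl_orbitE)
    then show ?thesis using h z by (simp add: f_def invariant_functions_def)
  qed
  then show ?thesis
    using that[of f] h by (auto simp: quotient_functions_def torus_functions_eq_expsum invariant_functions_def)
qed

lemma character_lattice_sum: "\<mu> \<in> character_lattice N \<Longrightarrow> (\<Sum>i\<in>UNIV. \<mu> $ i) = 0"
  by (simp add: character_lattice_def E_space_def)

lemma character_lattice_integral:
  assumes "\<mu> \<in> character_lattice N" shows "\<mu> $ i - \<mu> $ j \<in> \<int>"
proof -
  have "axis i 1 - axis j 1 \<in> N"
    by (rule integral_vector) (auto simp: axis_def sum_subtractf)
  then have "\<mu> \<bullet> (axis i 1 - axis j 1) \<in> \<int>" using assms by (auto simp: character_lattice_def)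
  then show ?thesis by (simp add: inner_diff_right inner_axis)
qed

lemma character_lattice_zero: "0 \<in> character_lattice N"
  and character_lattice_add: "\<mu> \<in> character_lattice N \<Longrightarrow> \<mu>' \<in> character_lattice N \<Longrightarrow> \<mu> + \<mu>' \<in> character_lattice N"
  and character_lattice_diff: "\<mu> \<in> character_lattice N \<Longrightarrow> \<mu>' \<in> character_lattice N \<Longrightarrow> \<mu> - \<mu>' \<in> character_lattice N"
  by (auto simp: character_lattice_def E_space_def inner_add_left inner_diff_left sum.distrib sum_subtractf)

lemma character_lattice_multiple_integral:
  assumes "\<mu> \<in> character_lattice N" shows "real CARD('n) * \<mu> $ i \<in> \<int>"
proof -
  have "(\<Sum>j\<in>UNIV. \<mu> $ i - \<mu> $ j) \<in> \<int>" using assms by (intro Ints_sum character_lattice_integral)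
  then show ?thesis using character_lattice_sum[OF assms] by (simp add: sum_subtractf)
qed

lemma invariant_const: "(\<lambda>_. k) \<in> invariant_functions"
  and invariant_add: "f \<in> invariant_functions \<Longrightarrow> g \<in> invariant_functions \<Longrightarrow> (\<lambda>z. f z + g z) \<in> invariant_functions"
  and invariant_mult: "f \<in> invariant_functions \<Longrightarrow> g \<in> invariant_functions \<Longrightarrow> (\<lambda>z. f z * g z) \<in> invariant_functions"
  by (auto simp: invariant_functions_def intro: expsum_const character_lattice_zero expsum_add
      expsum_mult character_lattice_add)

end

section \<open>Flats, their blocks and the torus cosets they define\<close>

text \<open>
  The vectors orthogonal to a given nonzero vector form a null set, and countably many null sets do not
  cover the space.
\<close>
lemma generic_vector:
  fixes M :: "(real ^ 'n) set"
  assumes "countable M"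
  shows "\<exists>w. \<forall>\<mu>\<in>M. \<mu> \<bullet> w = 0 \<longrightarrow> \<mu> = 0"
proof -
  have "negligible (\<Union>\<mu>\<in>M - {0}. {w. \<mu> \<bullet> w = 0})"
    using assms by (intro negligible_countable_Union) (auto intro: negligible_hyperplane)
  then have "(\<Union>\<mu>\<in>M - {0}. {w. \<mu> \<bullet> w = 0}) \<noteq> UNIV" by auto
  then obtain w where "w \<notin> (\<Union>\<mu>\<in>M - {0}. {w. \<mu> \<bullet> w = 0})" by blast
  then show ?thesis by (intro exI[of _ w]) auto
qed

lemma finite_discrete_ball:
  fixes D :: real
  assumes "D > 0"
  shows "finite ({x :: real ^ 'n. \<forall>i. D * x $ i \<in> \<int>} \<inter> cball 0 r)"
proof -
  define K where "K = \<lceil>D * r\<rceil>"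
  have "{x :: real ^ 'n. \<forall>i. D * x $ i \<in> \<int>} \<inter> cball 0 r
      \<subseteq> (\<lambda>f. \<chi> i. of_int (f i) / D) ` (UNIV \<rightarrow>\<^sub>E {-K..K})"
  proof
    fix x :: "real ^ 'n" assume x: "x \<in> {x. \<forall>i. D * x $ i \<in> \<int>} \<inter> cball 0 r"
    then have fl: "of_int \<lfloor>D * x $ i\<rfloor> = D * x $ i" for i by simp
    have "\<lfloor>D * x $ i\<rfloor> \<in> {-K..K}" for i
    proof -
      have "\<bar>x $ i\<bar> \<le> r" using component_le_norm_cart[of x i] x by simp
      then have "\<bar>D * x $ i\<bar> \<le> D * r" using assms by (simp add: abs_mult)
      also have "\<dots> \<le> of_int K" by (simp add: K_def)
      finally have "\<bar>real_of_int \<lfloor>D * x $ i\<rfloor>\<bar> \<le> of_int K" by (simp add: fl)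
      then show ?thesis by (auto simp: abs_le_iff)
    qed
    then show "x \<in> (\<lambda>f. \<chi> i. of_int (f i) / D) ` (UNIV \<rightarrow>\<^sub>E {-K..K})"
      using assms by (intro image_eqI[of _ _ "\<lambda>i. \<lfloor>D * x $ i\<rfloor>"]) (auto simp: vec_eq_iff fl)
  qed
  then show ?thesis by (rule finite_subset) (intro finite_imageI finite_PiE finite, simp)
qed

text \<open>
  The integrality of the constant difference makes the torus coordinates \<open>i\<close> and \<open>j\<close> equal.
\<close>
definition block :: "(real ^ 'n) set \<Rightarrow> 'n \<Rightarrow> 'n set" where
  "block L i = {j. \<exists>m::int. \<forall>x\<in>L. x $ i - x $ j = of_int m}"

lemma block_refl: "i \<in> block L i"
  unfolding block_def by (auto intro: exI[of _ 0])

lemma block_sym: "j \<in> block L i \<Longrightarrow> i \<in> block L j"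
proof -
  assume "j \<in> block L i"
  then obtain m :: int where "\<forall>x\<in>L. x $ i - x $ j = of_int m" by (auto simp: block_def)
  then have "\<forall>x\<in>L. x $ j - x $ i = of_int (- m)" by (auto simp: algebra_simps)
  then show ?thesis unfolding block_def by blast
qed

lemma block_trans: "j \<in> block L i \<Longrightarrow> k \<in> block L j \<Longrightarrow> k \<in> block L i"
proof -
  assume "j \<in> block L i" "k \<in> block L j"
  then obtain m m' :: int where "\<forall>x\<in>L. x $ i - x $ j = of_int m" "\<forall>x\<in>L. x $ j - x $ k = of_int m'"
    by (auto simp: block_def)
  then have "\<forall>x\<in>L. x $ i - x $ k = of_int (m + m')" by (auto simp: algebra_simps)
  then show ?thesis unfolding block_def by blast
qed

lemma block_eq: "j \<in> block L i \<Longrightarrow> block L j = block L i"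
  using block_trans block_sym by blast

lemma block_eq_iff: "block L i = block L j \<longleftrightarrow> j \<in> block L i"
  using block_eq block_refl by blast

locale flat = cocharacters N for N :: "(real ^ 'n) set" +
  fixes L :: "(real ^ 'n) set"
  assumes is_flat: "is_flat L"
begin

abbreviation "LC \<equiv> complexify L"

definition base :: "real ^ 'n" where "base = (SOME x. x \<in> L)"

lemma base: "base \<in> L"
  unfolding base_def using is_flat by (simp add: is_flat_def some_in_eq)

lemma base_integral: "j \<in> block L i \<Longrightarrow> base $ i - base $ j \<in> \<int>"
  using base by (auto simp: block_def)

lemma base_sum: "(\<Sum>i\<in>UNIV. base $ i) = 0"
  using base is_flat by (auto simp: is_flat_def E_space_def)

text \<open>
  Every hyperplane in a family that cuts out \<open>L\<close> prescribes one difference of coordinates as an integer,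
  so it relates two elements of a block and is implied by the differences found at \<open>base\<close>.
\<close>
lemma flat_iff:
  "x \<in> L \<longleftrightarrow> (\<Sum>i\<in>UNIV. x $ i) = 0 \<and> (\<forall>i. \<forall>j\<in>block L i. x $ i - x $ j = base $ i - base $ j)"
proof (intro iffI conjI allI ballI)
  assume "x \<in> L"
  then show "(\<Sum>i\<in>UNIV. x $ i) = 0" using is_flat by (auto simp: is_flat_def E_space_def)
  fix i j assume "j \<in> block L i"
  then show "x $ i - x $ j = base $ i - base $ j" using \<open>x \<in> L\<close> base by (auto simp: block_def)
next
  assume x: "(\<Sum>i\<in>UNIV. x $ i) = 0 \<and> (\<forall>i. \<forall>j\<in>block L i. x $ i - x $ j = base $ i - base $ j)"
  obtain S where S: "S \<subseteq> hyperplanes" "L = E_space \<inter> \<Inter>S" using is_flat by (auto simp: is_flat_def)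
  have "x \<in> H" if "H \<in> S" for H
  proof -
    have "H \<in> hyperplanes" using that S by auto
    then obtain \<alpha> and m :: int where "\<alpha> \<in> roots" "H = {x \<in> E_space. \<alpha> \<bullet> x = of_int m}"
      by (auto simp: hyperplanes_def)
    then obtain i j where H: "H = {x \<in> E_space. x $ i - x $ j = of_int m}"
      by (auto simp: roots_def inner_root)
    have "L \<subseteq> H" using S that by auto
    then have "\<forall>x\<in>L. x $ i - x $ j = of_int m" using H by auto
    then have "j \<in> block L i" "base $ i - base $ j = of_int m" using base by (auto simp: block_def)
    then show ?thesis using x by (auto simp: H E_space_def)
  qed
  then show "x \<in> L" using x S by (auto simp: E_space_def)
qed

lemma complexify_flat_iff:
  "z \<in> LC \<longleftrightarrow> (\<Sum>i\<in>UNIV. z $ i) = 0 \<and>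
     (\<forall>i. \<forall>j\<in>block L i. z $ i - z $ j = of_real (base $ i - base $ j))"
proof
  assume "z \<in> LC"
  then obtain x u v where z: "z = cvec x (u - v)" "x \<in> L" "u \<in> L" "v \<in> L" by (auto simp: complexify_def)
  have "z $ i - z $ j = of_real (base $ i - base $ j)" if "j \<in> block L i" for i j
    using z(2-4)[unfolded flat_iff] that unfolding z(1) by (force simp: complex_eq_iff)
  moreover have "(\<Sum>i\<in>UNIV. z $ i) = 0"
    using z(2-4)[unfolded flat_iff] unfolding z(1) by (simp add: complex_eq_iff sum_subtractf)
  ultimately show "(\<Sum>i\<in>UNIV. z $ i) = 0 \<and>
     (\<forall>i. \<forall>j\<in>block L i. z $ i - z $ j = of_real (base $ i - base $ j))" by simp
next
  assume *: "(\<Sum>i\<in>UNIV. z $ i) = 0 \<and>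
     (\<forall>i. \<forall>j\<in>block L i. z $ i - z $ j = of_real (base $ i - base $ j))"
  have s: "(\<Sum>i\<in>UNIV. Re (z $ i)) = 0" "(\<Sum>i\<in>UNIV. Im (z $ i)) = 0"
    using * Re_sum[of "\<lambda>i. z $ i" UNIV] Im_sum[of "\<lambda>i. z $ i" UNIV] by simp_all
  have d: "Re (z $ i) - Re (z $ j) = base $ i - base $ j" "Im (z $ i) = Im (z $ j)"
    if "j \<in> block L i" for i j
  proof -
    have e: "z $ i - z $ j = of_real (base $ i - base $ j)" using * that by blast
    show "Re (z $ i) - Re (z $ j) = base $ i - base $ j" using arg_cong[OF e, of Re] by simp
    show "Im (z $ i) = Im (z $ j)" using arg_cong[OF e, of Im] by simp
  qed
  have "(\<chi> i. Re (z $ i)) \<in> L" unfolding flat_iff by (auto simp: s d)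
  moreover have "base + (\<chi> i. Im (z $ i)) \<in> L"
    unfolding flat_iff using d(2) by (auto simp: s base_sum sum.distrib)
  moreover have "z = cvec (\<chi> i. Re (z $ i)) ((base + (\<chi> i. Im (z $ i))) - base)"
    by (simp add: vec_eq_iff)
  ultimately show "z \<in> LC" unfolding complexify_def using base by blast
qed

lemma complexify_flat_subset: "LC \<subseteq> EC"
  by (auto simp: complexify_flat_iff complexify_E_space)

lemma base_mem: "cvec base 0 \<in> LC"
  by (auto simp: complexify_flat_iff complex_eq_iff base_sum)

lemma complexify_shift:
  assumes "z \<in> LC" "(\<Sum>i\<in>UNIV. w $ i) = 0" "\<And>i j. j \<in> block L i \<Longrightarrow> w $ i = w $ j"
  shows "z + (\<chi> i. t * of_real (w $ i)) \<in> LC"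
proof -
  have "(\<Sum>i\<in>UNIV. t * of_real (w $ i)) = t * of_real (\<Sum>i\<in>UNIV. w $ i)"
    by (simp add: sum_distrib_left)
  then show ?thesis using assms(1,2) assms(3) unfolding complexify_flat_iff
    by (auto simp: sum.distrib)
qed

text \<open>
  The orthogonal projection to the vectors that are constant on blocks. Two characters agree up to a
  factor on \<open>LC\<close> when their projections agree, so projected exponents are a normal form for
  restrictions to \<open>LC\<close>.
\<close>
definition avg :: "real ^ 'n \<Rightarrow> real ^ 'n" where
  "avg \<mu> = (\<chi> i. (\<Sum>j\<in>block L i. \<mu> $ j) / real (card (block L i)))"

lemma card_block_pos: "card (block L i) > 0"
  using block_refl[of i L] by (auto simp: card_gt_0_iff)

lemma avg_const: "j \<in> block L i \<Longrightarrow> avg \<mu> $ i = avg \<mu> $ j"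
  by (simp add: avg_def block_eq)

lemma avg_zero: "avg 0 = 0"
  and avg_add: "avg (\<mu> + \<nu>) = avg \<mu> + avg \<nu>"
  and avg_diff: "avg (\<mu> - \<nu>) = avg \<mu> - avg \<nu>"
  by (simp_all add: avg_def vec_eq_iff sum.distrib sum_subtractf add_divide_distrib diff_divide_distrib)

lemma avg_adjoint:
  fixes w :: "'n \<Rightarrow> 'a :: real_field"
  assumes w: "\<And>i j. j \<in> block L i \<Longrightarrow> w i = w j"
  shows "(\<Sum>i\<in>UNIV. of_real (avg \<mu> $ i) * w i) = (\<Sum>i\<in>UNIV. of_real (\<mu> $ i) * w i)"
proof -
  let ?t = "\<lambda>i j. if j \<in> block L i then of_real (\<mu> $ j / card (block L i)) * w i else 0"
  have "(\<Sum>i\<in>UNIV. of_real (avg \<mu> $ i) * w i) = (\<Sum>i\<in>UNIV. \<Sum>j\<in>UNIV. ?t i j)"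
  proof (rule sum.cong[OF refl])
    fix i
    have "of_real (avg \<mu> $ i) * w i = (\<Sum>j\<in>block L i. of_real (\<mu> $ j / card (block L i)) * w i)"
      by (simp only: avg_def vec_lambda_beta sum_divide_distrib sum_distrib_right of_real_sum)
    also have "\<dots> = (\<Sum>j\<in>UNIV. ?t i j)" by (intro sum.mono_neutral_cong_left) auto
    finally show "of_real (avg \<mu> $ i) * w i = (\<Sum>j\<in>UNIV. ?t i j)" .
  qed
  also have "\<dots> = (\<Sum>j\<in>UNIV. \<Sum>i\<in>UNIV. ?t i j)" by (rule sum.swap)
  also have "\<dots> = (\<Sum>j\<in>UNIV. of_real (\<mu> $ j) * w j)"
  proof (rule sum.cong[OF refl])
    fix j
    have "(\<Sum>i\<in>UNIV. ?t i j) = (\<Sum>i\<in>UNIV. if i \<in> block L j then of_real (\<mu> $ j / card (block L j)) * w j else 0)"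
    proof (rule sum.cong[OF refl])
      fix i show "?t i j = (if i \<in> block L j then of_real (\<mu> $ j / card (block L j)) * w j else 0)"
      proof (cases "j \<in> block L i")
        case True
        show ?thesis unfolding w[OF True] using True block_sym[OF True] block_eq[OF True] by simp
      next
        case False
        then have "i \<notin> block L j" using block_sym by blast
        then show ?thesis using False by simp
      qed
    qed
    also have "\<dots> = (\<Sum>i\<in>block L j. of_real (\<mu> $ j / card (block L j)) * w j)"
      by (intro sum.mono_neutral_cong_right) auto
    also have "\<dots> = of_real (\<mu> $ j) * w j"
      using block_refl[of j L] by auto
    finally show "(\<Sum>i\<in>UNIV. ?t i j) = of_real (\<mu> $ j) * w j" .
  qed
  finally show ?thesis .
qed

lemma avg_sum: "(\<Sum>i\<in>UNIV. avg \<mu> $ i) = (\<Sum>i\<in>UNIV. \<mu> $ i)"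
  using avg_adjoint[of "\<lambda>_. 1 :: real" \<mu>] by simp

abbreviation "\<Lambda> \<equiv> character_lattice N"
abbreviation "M \<equiv> avg ` \<Lambda>"

lemma echar_avg:
  "\<exists>k. k \<noteq> 0 \<and> (\<forall>z\<in>LC. echar \<mu> z = k * echar (avg \<mu>) z)"
proof (intro exI conjI ballI)
  let ?b = "cvec base 0"
  let ?k = "exp (2 * of_real pi * \<i> * (cpair \<mu> ?b - cpair (avg \<mu>) ?b))"
  show "?k \<noteq> 0" by simp
  fix z assume z: "z \<in> LC"
  have "(z - ?b) $ i = (z - ?b) $ j" if "j \<in> block L i" for i j
    using that z unfolding complexify_flat_iff by (auto simp: complex_eq_iff algebra_simps)
  from avg_adjoint[of "\<lambda>i. (z - ?b) $ i", OF this]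
  have "cpair (avg \<mu>) (z - ?b) = cpair \<mu> (z - ?b)" by (simp add: cpair_def)
  moreover have "cpair \<nu> z = cpair \<nu> ?b + cpair \<nu> (z - ?b)" for \<nu>
    unfolding cpair_add_right[symmetric] by simp
  ultimately have "cpair \<mu> z = (cpair \<mu> ?b - cpair (avg \<mu>) ?b) + cpair (avg \<mu>) z" by (simp add: algebra_simps)
  then show "echar \<mu> z = ?k * echar (avg \<mu>) z"
    by (simp only: echar_def distrib_left exp_add)
qed

lemma expsum_to_avg:
  assumes "f \<in> expsum \<Lambda>" shows "\<exists>g\<in>expsum M. \<forall>z\<in>LC. f z = g z"
  using assms
proof (induction rule: expsum_induct)
  case zero
  show ?case by (rule bexI[of _ "\<lambda>_. 0"]) auto
next
  case (add c \<mu> f)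
  then obtain g where g: "g \<in> expsum M" "\<forall>z\<in>LC. f z = g z" by auto
  obtain k where k: "\<forall>z\<in>LC. echar \<mu> z = k * echar (avg \<mu>) z" using echar_avg by blast
  have "(\<lambda>z. (c * k) * echar (avg \<mu>) z + g z) \<in> expsum M"
    using add g by (intro expsum_add expsum_cmult expsum_echar) auto
  moreover have "\<forall>z\<in>LC. c * echar \<mu> z + f z = (c * k) * echar (avg \<mu>) z + g z"
    using g(2) k by simp
  ultimately show ?case by - (rule rev_bexI)
qed

lemma expsum_from_avg:
  assumes "f \<in> expsum M" shows "\<exists>g\<in>expsum \<Lambda>. \<forall>z\<in>LC. f z = g z"
  using assms
proof (induction rule: expsum_induct)
  case zero
  show ?case by (rule bexI[of _ "\<lambda>_. 0"]) auto
next
  case (add c \<nu> f)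
  then obtain g where g: "g \<in> expsum \<Lambda>" "\<forall>z\<in>LC. f z = g z" by auto
  obtain \<mu> where \<mu>: "\<mu> \<in> \<Lambda>" "\<nu> = avg \<mu>" using add by auto
  obtain k where k: "k \<noteq> 0" "\<forall>z\<in>LC. echar \<mu> z = k * echar (avg \<mu>) z" using echar_avg by blast
  have "(\<lambda>z. (c / k) * echar \<mu> z + g z) \<in> expsum \<Lambda>"
    using \<mu> g by (intro expsum_add expsum_cmult expsum_echar) auto
  moreover have "\<forall>z\<in>LC. c * echar \<nu> z + f z = (c / k) * echar \<mu> z + g z"
    using g(2) k \<mu> by simp
  ultimately show ?case by - (rule rev_bexI)
qed

text \<open>
  The coordinates of characters have the common denominator \<open>C\<close>, the number of coordinates. Averaging
  over a block introduces its size, which divides \<open>C!\<close>.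
\<close>
lemma finite_avg_ball: "finite (M \<inter> cball 0 r)"
proof (rule finite_subset[OF _ finite_discrete_ball])
  let ?D = "real CARD('n) * fact CARD('n)"
  show "?D > 0" by simp
  show "M \<inter> cball 0 r \<subseteq> {x. \<forall>i. ?D * x $ i \<in> \<int>} \<inter> cball 0 r"
  proof safe
    fix \<mu> i assume \<mu>: "\<mu> \<in> \<Lambda>"
    have "card (block L i) dvd fact CARD('n)"
      using card_block_pos[of i] by (intro dvd_fact) (auto intro: card_mono)
    then obtain q where q: "fact CARD('n) = card (block L i) * q" by auto
    have "(\<Sum>j\<in>block L i. real CARD('n) * \<mu> $ j) \<in> \<int>"
      by (intro Ints_sum character_lattice_multiple_integral \<mu>)
    then have "real q * (\<Sum>j\<in>block L i. real CARD('n) * \<mu> $ j) \<in> \<int>" by (intro Ints_mult) auto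
    moreover have "?D * avg \<mu> $ i = real q * (\<Sum>j\<in>block L i. real CARD('n) * \<mu> $ j)"
    proof -
      have "(fact CARD('n) :: real) = real (card (block L i)) * real q"
        by (metis of_nat_fact of_nat_mult q)
      moreover have "real (card (block L i)) \<noteq> 0" using card_block_pos[of i] by (metis less_irrefl of_nat_eq_0_iff)
      ultimately show ?thesis by (simp add: avg_def sum_distrib_left[symmetric])
    qed
    ultimately show "?D * avg \<mu> $ i \<in> \<int>" by simp
  qed
qed

lemma countable_avg: "countable M"
proof -
  have eq: "M = (\<Union>k::nat. M \<inter> cball 0 (real k))"
  proof
    show "M \<subseteq> (\<Union>k::nat. M \<inter> cball 0 (real k))"
    proof
      fix x assume x: "x \<in> M"
      obtain k :: nat where "norm x \<le> real k" using real_arch_simple[of "norm x"] ..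
      then show "x \<in> (\<Union>k::nat. M \<inter> cball 0 (real k))" using x by auto
    qed
    show "(\<Union>k::nat. M \<inter> cball 0 (real k)) \<subseteq> M" by (rule UN_least) (rule Int_lower1)
  qed
  have "countable (\<Union>k::nat. M \<inter> cball 0 (real k))"
    by (intro countable_UN countableI_type) (rule countable_finite, rule finite_avg_ball)
  then show ?thesis by (subst eq)
qed

text \<open>
  Choose any vector that pairs nontrivially with the countably many nonzero projected exponents, and
  project it to the directions of \<open>L\<close>. The exponents are fixed by the projection, so the pairings do
  not change.
\<close>
lemma exponential_frame_exists: "\<exists>w. exponential_frame LC M w"
proof -
  obtain w' where w': "\<And>\<mu>. \<mu> \<in> M \<Longrightarrow> \<mu> \<bullet> w' = 0 \<Longrightarrow> \<mu> = 0"
    using generic_vector[OF countable_avg] by blast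
  define m where "m = (\<Sum>i\<in>UNIV. w' $ i) / real CARD('n)"
  define w where "w = avg (\<chi> i. w' $ i - m)"
  have w_sum: "(\<Sum>i\<in>UNIV. w $ i) = 0"
    by (simp add: w_def avg_sum sum_subtractf m_def)
  have inner: "\<mu> \<bullet> w = \<mu> \<bullet> w'" if "\<mu> \<in> M" for \<mu>
  proof -
    obtain \<mu>' where \<mu>: "\<mu> = avg \<mu>'" "\<mu>' \<in> \<Lambda>" using \<open>\<mu> \<in> M\<close> by auto
    have "(\<Sum>i\<in>UNIV. w $ i * \<mu> $ i) = (\<Sum>i\<in>UNIV. (w' $ i - m) * \<mu> $ i)"
      using avg_adjoint[of "\<lambda>i. \<mu> $ i" "\<chi> i. w' $ i - m"] avg_const by (simp add: w_def \<mu>(1))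
    also have "\<dots> = (\<Sum>i\<in>UNIV. w' $ i * \<mu> $ i) - m * (\<Sum>i\<in>UNIV. \<mu> $ i)"
      by (simp add: left_diff_distrib sum_subtractf sum_distrib_left)
    also have "(\<Sum>i\<in>UNIV. \<mu> $ i) = 0" using \<mu> by (simp add: avg_sum character_lattice_sum)
    finally show ?thesis by (simp add: inner_vec_def mult.commute)
  qed
  have "exponential_frame LC M w"
  proof
    show "LC \<noteq> {}" using base_mem by auto
    show "z + (\<chi> i. - \<i> * of_real (s * w $ i)) \<in> LC" if "z \<in> LC" for z s
    proof -
      have "z + (\<chi> i. (- \<i> * of_real s) * of_real (w $ i)) \<in> LC"
        by (rule complexify_shift[OF that w_sum]) (simp add: w_def avg_const)
      then show ?thesis by (simp add: mult.assoc)
    qed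
    show "0 \<in> M" using character_lattice_zero avg_zero by (metis image_eqI)
    show "\<mu> + \<nu> \<in> M" "\<mu> - \<nu> \<in> M" if "\<mu> \<in> M" "\<nu> \<in> M" for \<mu> \<nu>
      using that by (auto simp: avg_add[symmetric] avg_diff[symmetric]
          intro!: imageI character_lattice_add character_lattice_diff)
    show "\<mu> = 0" if "\<mu> \<in> M" "\<mu> \<bullet> w = 0" for \<mu>
      using w' that inner by simp
  qed
  then show ?thesis ..
qed

lemma torus_no_zero_divisors:
  assumes f: "f \<in> expsum \<Lambda>" and g: "g \<in> expsum \<Lambda>" and "\<And>z. z \<in> LC \<Longrightarrow> f z * g z = 0"
  shows "(\<forall>z\<in>LC. f z = 0) \<or> (\<forall>z\<in>LC. g z = 0)"
proof -
  obtain w where "exponential_frame LC M w" using exponential_frame_exists ..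
  then interpret exponential_frame "LC" M w .
  obtain f' where f': "f' \<in> expsum M" "\<forall>z\<in>LC. f z = f' z" using expsum_to_avg[OF f] ..
  obtain g' where g': "g' \<in> expsum M" "\<forall>z\<in>LC. g z = g' z" using expsum_to_avg[OF g] ..
  show ?thesis using expsum_no_zero_divisors[OF f'(1) g'(1)] f'(2) g'(2) assms(3) by auto
qed

end

lemma expsum_bounded:
  assumes "f \<in> expsum M" shows "\<exists>r. f \<in> expsum (M \<inter> cball 0 r)"
  using assms
proof (induction rule: expsum_induct)
  case (add c \<mu> f)
  then obtain r where r: "f \<in> expsum (M \<inter> cball 0 r)" by auto
  have "f \<in> expsum (M \<inter> cball 0 (max r (norm \<mu>)))"
    using r expsum_mono[of "M \<inter> cball 0 r" "M \<inter> cball 0 (max r (norm \<mu>))"] by fastforce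
  then show ?case using add(1)
    by (intro exI[of _ "max r (norm \<mu>)"] expsum_add expsum_cmult expsum_echar) auto
qed auto

lemma expsum_uniformly_bounded:
  assumes "finite I" "\<And>i. i \<in> I \<Longrightarrow> f i \<in> expsum M"
  shows "\<exists>r\<ge>0. \<forall>i\<in>I. f i \<in> expsum (M \<inter> cball 0 r)"
  using assms
proof (induction I)
  case empty
  then show ?case by (auto intro: exI[of _ 0])
next
  case (insert i I)
  then obtain r where r: "r \<ge> 0" "\<forall>i\<in>I. f i \<in> expsum (M \<inter> cball 0 r)" by auto
  obtain s where s: "f i \<in> expsum (M \<inter> cball 0 s)" using expsum_bounded[of "f i" M] insert by auto
  have "expsum (M \<inter> cball 0 r) \<subseteq> expsum (M \<inter> cball 0 (max r s))"
    "expsum (M \<inter> cball 0 s) \<subseteq> expsum (M \<inter> cball 0 (max r s))"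
    by (intro expsum_mono; auto)+
  then show ?case using r s by (intro exI[of _ "max r s"]) auto
qed

text \<open>
  Integral quotients have powers with a common denominator, namely \<open>b ^ k\<close>: the monic equation expresses
  \<open>b\<^sup>k (a / b)\<^sup>m\<close> for \<open>m \<ge> k\<close> by the coefficients and the \<open>k\<close> preceding powers. Each recursion step
  enlarges the exponents at most by the bound for the coefficients, whence linear growth.
\<close>
lemma (in exponential_frame) expsum_integrally_closed:
  assumes a: "a \<in> expsum M" and b: "b \<in> expsum M" "\<exists>z\<in>A. b z \<noteq> 0"
    and c: "\<And>j. j < k \<Longrightarrow> c j \<in> expsum M"
    and fin: "\<And>r. finite (M \<inter> cball 0 r)"
    and eq: "\<And>z. z \<in> A \<Longrightarrow> b z \<noteq> 0 \<Longrightarrow> (a z / b z) ^ k + (\<Sum>j<k. c j z * (a z / b z) ^ j) = 0"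
  shows "\<exists>h\<in>expsum M. \<forall>z\<in>A. a z = b z * h z"
proof -
  \<comment> \<open>For \<open>k = 0\<close> the monic equation would read \<open>1 = 0\<close>.\<close>
  have k: "k > 0" using b(2) eq by (cases k) auto
  have pow: "f \<in> expsum M \<Longrightarrow> (\<lambda>z. f z ^ m) \<in> expsum M" for f m
    by (induction m) (auto intro: expsum_const M_zero expsum_mult[of f M _ M] M_add)
  have "\<exists>r\<ge>0. \<forall>m\<in>{..<k}. (\<lambda>z. b z ^ (k - m) * a z ^ m) \<in> expsum (M \<inter> cball 0 r)"
    by (intro expsum_uniformly_bounded expsum_mult[OF pow[OF b(1)] pow[OF a]] M_add) auto
  then obtain r1 where r1: "r1 \<ge> 0"
    "\<And>m. m < k \<Longrightarrow> (\<lambda>z. b z ^ (k - m) * a z ^ m) \<in> expsum (M \<inter> cball 0 r1)" by auto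
  have "\<exists>r\<ge>0. \<forall>j\<in>{..<k}. c j \<in> expsum (M \<inter> cball 0 r)"
    by (intro expsum_uniformly_bounded c) auto
  then obtain r2 where r2: "r2 \<ge> 0" "\<And>j. j < k \<Longrightarrow> c j \<in> expsum (M \<inter> cball 0 r2)" by auto
  define r where "r = max r1 r2"
  have r: "r \<ge> 0" using r1 by (simp add: r_def)
  have bounded: "\<exists>g \<in> expsum (M \<inter> cball 0 (real (Suc m) * r)). \<forall>z\<in>A. b z ^ k * a z ^ m = b z ^ m * g z" for m
  proof (induction m rule: less_induct)
    case (less m)
    show ?case
    proof (cases "m < k")
      case True
      have "r1 \<le> real (Suc m) * r" using r1(1) mult_mono[of 1 "real (Suc m)" r1 r] by (simp add: r_def)
      then have "(\<lambda>z. b z ^ (k - m) * a z ^ m) \<in> expsum (M \<inter> cball 0 (real (Suc m) * r))"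
        using r1(2)[OF True] expsum_mono[of "M \<inter> cball 0 r1" "M \<inter> cball 0 (real (Suc m) * r)"] by fastforce
      moreover have "\<forall>z\<in>A. b z ^ k * a z ^ m = b z ^ m * (b z ^ (k - m) * a z ^ m)"
        using True by (simp add: mult.assoc[symmetric] power_add[symmetric])
      ultimately show ?thesis by - (rule rev_bexI)
    next
      case False
      have "\<forall>j\<in>{..<k}. \<exists>g. g \<in> expsum (M \<inter> cball 0 (real (Suc (m - k + j)) * r)) \<and>
          (\<forall>z\<in>A. b z ^ k * a z ^ (m - k + j) = b z ^ (m - k + j) * g z)"
      proof
        fix j assume "j \<in> {..<k}"
        then have "m - k + j < m" using False by auto
        from less[OF this] show "\<exists>g. g \<in> expsum (M \<inter> cball 0 (real (Suc (m - k + j)) * r)) \<and>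
          (\<forall>z\<in>A. b z ^ k * a z ^ (m - k + j) = b z ^ (m - k + j) * g z)" by (simp only: Bex_def)
      qed
      from bchoice[OF this] obtain g where
        g': "\<forall>j\<in>{..<k}. g j \<in> expsum (M \<inter> cball 0 (real (Suc (m - k + j)) * r)) \<and>
          (\<forall>z\<in>A. b z ^ k * a z ^ (m - k + j) = b z ^ (m - k + j) * g j z)" ..
      have g: "g j \<in> expsum (M \<inter> cball 0 (real (Suc (m - k + j)) * r))" if "j < k" for j
        using g' that by simp
      have gz: "b z ^ k * a z ^ (m - k + j) = b z ^ (m - k + j) * g j z" if "j < k" "z \<in> A" for j z
        using g' that by simp
      let ?G = "\<lambda>z. (-1) * (\<Sum>j<k. c j z * g j z)"
      have "?G \<in> expsum (M \<inter> cball 0 (real (Suc m) * r))"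
      proof (intro expsum_cmult expsum_sum)
        fix j assume j: "j \<in> {..<k}"
        show "(\<lambda>z. c j z * g j z) \<in> expsum (M \<inter> cball 0 (real (Suc m) * r))"
        proof (rule expsum_mult[OF r2(2) g])
          fix \<mu> \<nu> assume \<mu>: "\<mu> \<in> M \<inter> cball 0 r2" and \<nu>: "\<nu> \<in> M \<inter> cball 0 (real (Suc (m - k + j)) * r)"
          have "norm (\<mu> + \<nu>) \<le> r + real (Suc (m - k + j)) * r"
          proof -
            have "norm \<mu> \<le> r" "norm \<nu> \<le> real (Suc (m - k + j)) * r"
              using \<mu> \<nu> max.coboundedI1[of r2 r2 r1] by (auto simp: r_def max.commute)
            then show ?thesis using norm_triangle_ineq[of \<mu> \<nu>] by linarith
          qed
          also have "\<dots> = real (Suc (Suc (m - k + j))) * r" by (simp add: algebra_simps)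
          also have "\<dots> \<le> real (Suc m) * r" using j False r by (intro mult_right_mono) auto
          finally show "\<mu> + \<nu> \<in> M \<inter> cball 0 (real (Suc m) * r)" using \<mu> \<nu> M_add by simp
        qed (use j in auto)
      qed
      moreover have "\<forall>z\<in>A. b z ^ k * a z ^ m = b z ^ m * ?G z"
      proof
        fix z assume z: "z \<in> A"
        show "b z ^ k * a z ^ m = b z ^ m * ?G z"
        proof (cases "b z = 0")
          case True
          moreover have "m > 0" using k False by simp
          ultimately show ?thesis using k by (simp add: zero_power)
        next
          case nz: False
          have "b z ^ k * a z ^ m = b z ^ m * (b z ^ k * (a z ^ (m - k) * (a z / b z) ^ k) / b z ^ (m - k))"
            using nz False by (simp add: power_divide power_diff field_simps power_add[symmetric])
          also have "(a z / b z) ^ k = - (\<Sum>j<k. c j z * (a z / b z) ^ j)"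
            using eq[OF z nz] by (simp add: eq_neg_iff_add_eq_0)
          also have "b z ^ k * (a z ^ (m - k) * - (\<Sum>j<k. c j z * (a z / b z) ^ j)) / b z ^ (m - k)
              = - (\<Sum>j<k. c j z * (b z ^ k * a z ^ (m - k + j)) / b z ^ (m - k + j))"
            by (simp add: sum_distrib_left sum_divide_distrib power_divide power_add mult_ac)
          also have "\<dots> = ?G z"
          proof -
            have "c j z * (b z ^ k * a z ^ (m - k + j)) / b z ^ (m - k + j) = c j z * g j z" if "j < k" for j
              unfolding gz[OF that z] using nz by simp
            then show ?thesis by simp
          qed
          finally show ?thesis .
        qed
      qed
      ultimately show ?thesis by - (rule rev_bexI)
    qed
  qed
  obtain \<beta> b0 where l: "lead b \<beta> b0" using b lead_exists[OF b(1) order_refl] by blast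
  show ?thesis
    by (rule expsum_completely_integrally_closed[OF b(1) l lead_pow[OF l] fin a bounded])
qed

context flat
begin

text \<open>
  The image of \<open>LC\<close> in the torus is a coset of a subtorus, so it is normal.
\<close>
theorem torus_integrally_closed:
  assumes a: "a \<in> expsum \<Lambda>" and b: "b \<in> expsum \<Lambda>" "\<exists>z\<in>LC. b z \<noteq> 0"
    and c: "\<And>j. j < k \<Longrightarrow> c j \<in> expsum \<Lambda>"
    and eq: "\<And>z. z \<in> LC \<Longrightarrow> b z \<noteq> 0 \<Longrightarrow> (a z / b z) ^ k + (\<Sum>j<k. c j z * (a z / b z) ^ j) = 0"
  shows "\<exists>h\<in>expsum \<Lambda>. \<forall>z\<in>LC. a z = b z * h z"
proof -
  obtain w where "exponential_frame LC M w" using exponential_frame_exists ..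
  then interpret exponential_frame "LC" M w .
  obtain a' where a': "a' \<in> expsum M" "\<forall>z\<in>LC. a z = a' z" using expsum_to_avg[OF a] ..
  obtain b' where b': "b' \<in> expsum M" "\<forall>z\<in>LC. b z = b' z" using expsum_to_avg[OF b(1)] ..
  have "\<forall>j\<in>{..<k}. \<exists>c'. c' \<in> expsum M \<and> (\<forall>z\<in>LC. c j z = c' z)"
  proof
    fix j assume "j \<in> {..<k}"
    then have "c j \<in> expsum \<Lambda>" using c by simp
    from expsum_to_avg[OF this] show "\<exists>c'. c' \<in> expsum M \<and> (\<forall>z\<in>LC. c j z = c' z)"
      by (simp only: Bex_def)
  qed
  from bchoice[OF this] obtain c' where
    c': "\<forall>j\<in>{..<k}. c' j \<in> expsum M \<and> (\<forall>z\<in>LC. c j z = c' j z)" ..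
  have "\<exists>h\<in>expsum M. \<forall>z\<in>LC. a' z = b' z * h z"
  proof (rule expsum_integrally_closed[OF a'(1) b'(1) _ _ finite_avg_ball])
    show "\<exists>z\<in>LC. b' z \<noteq> 0" using b(2) b'(2) by auto
    show "c' j \<in> expsum M" if "j < k" for j using c' that by simp
    show "(a' z / b' z) ^ k + (\<Sum>j<k. c' j z * (a' z / b' z) ^ j) = 0" if "z \<in> LC" "b' z \<noteq> 0" for z
      using eq[of z] that a'(2) b'(2) c' by simp
  qed
  then obtain h where h: "h \<in> expsum M" "\<forall>z\<in>LC. a' z = b' z * h z" ..
  obtain h' where h': "h' \<in> expsum \<Lambda>" "\<forall>z\<in>LC. h z = h' z" using expsum_from_avg[OF h(1)] ..
  then show ?thesis using h(2) a'(2) b'(2) by (intro bexI[OF _ h'(1)]) auto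
qed

theorem normal_subvariety_iff:
  "normal_subvariety N (stratum N L) \<longleftrightarrow>
    contains_integral_quotients LC invariant_functions"
proof -
  let ?Q = "quotient_functions N" and ?o = "weyl_orbit N"
  have sub: "z \<in> EC" if "z \<in> LC" for z using complexify_flat_subset that by auto
  interpret function_algebra "stratum N L" ?Q
  proof
    show "stratum N L \<noteq> {}" unfolding stratum_eq using base_mem by auto
    show "(\<lambda>_. k) \<in> ?Q" for k
      using expsum_const[OF character_lattice_zero, of k]
      by (auto simp: quotient_functions_def torus_functions_eq_expsum intro!: bexI[of _ "\<lambda>_. k"])
  next
    fix f g assume "f \<in> ?Q" "g \<in> ?Q"
    obtain f' where f': "f' \<in> invariant_functions" "\<And>z. z \<in> EC \<Longrightarrow> f (?o z) = f' z"
      using quotient_function_pullback[OF \<open>f \<in> ?Q\<close>] by blast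
    obtain g' where g': "g' \<in> invariant_functions" "\<And>z. z \<in> EC \<Longrightarrow> g (?o z) = g' z"
      using quotient_function_pullback[OF \<open>g \<in> ?Q\<close>] by blast
    show "(\<lambda>y. f y + g y) \<in> ?Q"
      unfolding quotient_functions_def torus_functions_eq_expsum
      using invariant_add[OF f'(1) g'(1)] f'(2) g'(2)
      by (intro CollectI bexI[of _ "\<lambda>z. f' z + g' z"]) (auto simp: invariant_functions_def)
    show "(\<lambda>y. f y * g y) \<in> ?Q"
      unfolding quotient_functions_def torus_functions_eq_expsum
      using invariant_mult[OF f'(1) g'(1)] f'(2) g'(2)
      by (intro CollectI bexI[of _ "\<lambda>z. f' z * g' z"]) (auto simp: invariant_functions_def)
    assume zero: "\<And>y. y \<in> stratum N L \<Longrightarrow> f y * g y = 0"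
    have "f' z * g' z = 0" if "z \<in> LC" for z
      using zero[of "?o z"] that f'(2)[OF sub[OF that]] g'(2)[OF sub[OF that]] by (simp add: stratum_eq)
    then have "(\<forall>z\<in>LC. f' z = 0) \<or> (\<forall>z\<in>LC. g' z = 0)"
      using f'(1) g'(1) by (intro torus_no_zero_divisors) (auto simp: invariant_functions_def)
    then show "(\<forall>y\<in>stratum N L. f y = 0) \<or> (\<forall>y\<in>stratum N L. g y = 0)"
      unfolding stratum_eq using f'(2) g'(2) sub by auto
  qed
  have pull: "\<exists>h\<in>invariant_functions. \<forall>z\<in>LC. f (?o z) = h z"
    "\<exists>h\<in>invariant_functions. \<forall>z\<in>LC. h z = f (?o z)" if "f \<in> ?Q" for f
    using quotient_function_pullback[OF that] sub by metis+
  have push: "\<exists>f\<in>?Q. \<forall>z\<in>LC. f (?o z) = h z"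
    "\<exists>f\<in>?Q. \<forall>z\<in>LC. h z = f (?o z)" if "h \<in> invariant_functions" for h
    using invariant_function_descends[OF that] sub by metis+
  have "contains_integral_quotients (?o ` LC) ?Q \<longleftrightarrow>
      contains_integral_quotients ((\<lambda>z. z) ` LC) invariant_functions"
  proof
    show "contains_integral_quotients ((\<lambda>z. z) ` LC) invariant_functions"
      if "contains_integral_quotients (?o ` LC) ?Q"
      by (rule contains_integral_quotients_transfer[OF that push(2) pull(2)])
    show "contains_integral_quotients (?o ` LC) ?Q"
      if "contains_integral_quotients ((\<lambda>z. z) ` LC) invariant_functions"
      by (rule contains_integral_quotients_transfer[OF that pull(1) push(1)])
  qed
  then show ?thesis
    unfolding normal_subvariety_def coordinate_ring_def integrally_closed_iff by (simp add: stratum_eq)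
qed

end

section \<open>Symmetric functions of the torus coordinates\<close>

lemma exp_2pi_integer: "x \<in> \<int> \<Longrightarrow> exp (2 * of_real pi * \<i> * of_real x) = 1"
proof -
  assume "x \<in> \<int>"
  from exp_integer_2pi[OF this] show ?thesis by (simp add: mult_ac)
qed

lemma echar_perm:
  assumes "p permutes UNIV"
  shows "echar \<mu> (perm_act p z) = echar (perm_act (Hilbert_Choice.inv p) \<mu>) z"
proof -
  define F where "F j = of_real (\<mu> $ Hilbert_Choice.inv p j) * z $ j" for j
  have "cpair \<mu> (perm_act p z) = (\<Sum>i\<in>UNIV. F (p i))"
    unfolding cpair_def F_def using permutes_inverses(2)[OF assms] by simp
  also have "\<dots> = (\<Sum>i\<in>UNIV. F i)" by (rule sum_permute_UNIV[OF assms])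
  also have "\<dots> = cpair (perm_act (Hilbert_Choice.inv p) \<mu>) z" by (simp add: cpair_def F_def)
  finally show ?thesis by (simp add: echar_def)
qed

lemma cpair_real: "cpair \<mu> (cvec \<nu> 0) = of_real (\<mu> \<bullet> \<nu>)"
  by (simp add: cpair_def inner_vec_def complex_eq_iff)

lemma echar_translate:
  "\<mu> \<bullet> \<nu> \<in> \<int> \<Longrightarrow> echar \<mu> (z + cvec \<nu> 0) = echar \<mu> z"
  by (simp add: echar_def cpair_add_right cpair_real distrib_left exp_add exp_2pi_integer)

text \<open>
  Where the coordinate sum is zero, exponents only matter up to constant vectors. This allows integral
  and even nonnegative exponents.
\<close>
lemma echar_add_const:
  assumes "z \<in> complexify E_space"
  shows "echar (\<mu> + (\<chi> i. r)) z = echar \<mu> z"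
proof -
  have "cpair (\<chi> i. r) z = 0"
    using assms by (simp add: cpair_def complexify_E_space sum_distrib_left[symmetric])
  then show ?thesis by (simp add: echar_def cpair_add)
qed

definition tcoord :: "'n \<Rightarrow> complex ^ 'n \<Rightarrow> complex" where
  "tcoord i z = exp (2 * of_real pi * \<i> * z $ i)"

lemma echar_nat_vector: "echar (\<chi> i. real (k i)) z = (\<Prod>i\<in>UNIV. tcoord i z ^ k i)"
  by (simp add: echar_def cpair_def tcoord_def sum_distrib_left exp_sum exp_of_nat_mult[symmetric] mult_ac)

text \<open>
  Maps are made extensional so that they form a finite set.
\<close>
definition injections :: "'b set \<Rightarrow> 'c set \<Rightarrow> ('b \<Rightarrow> 'c) set" where
  "injections J B = {f \<in> J \<rightarrow>\<^sub>E B. inj_on f J}"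

lemma finite_injections: "finite J \<Longrightarrow> finite B \<Longrightarrow> finite (injections J B)"
  unfolding injections_def by (intro finite_subset[OF _ finite_PiE[of J "\<lambda>_. B"]]) auto

text \<open>
  An injection of \<open>insert j J\<close> is an injection of \<open>J\<close> together with a value outside its image.
\<close>
lemma sum_injections_insert:
  fixes F :: "('b \<Rightarrow> 'c) \<Rightarrow> 'a::comm_monoid_add"
  assumes "finite J" "finite B" "j \<notin> J"
  shows "(\<Sum>f\<in>injections (insert j J) B. F f) = (\<Sum>f\<in>injections J B. \<Sum>v\<in>B - f ` J. F (f(j := v)))"
proof -
  have "(\<Sum>f\<in>injections J B. \<Sum>v\<in>B - f ` J. F (f(j := v)))
      = (\<Sum>(f, v)\<in>Sigma (injections J B) (\<lambda>f. B - f ` J). F (f(j := v)))"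
    using assms by (intro sum.Sigma) (auto intro: finite_injections)
  also have "\<dots> = (\<Sum>f\<in>injections (insert j J) B. F f)"
  proof (rule sum.reindex_bij_witness[where i = "\<lambda>g. (g(j := undefined), g j)" and j = "\<lambda>(f, v). f(j := v)"])
    fix x assume x: "x \<in> Sigma (injections J B) (\<lambda>f. B - f ` J)"
    then obtain f v where fv: "x = (f, v)" "f \<in> J \<rightarrow>\<^sub>E B" "inj_on f J" "v \<in> B" "v \<notin> f ` J"
      by (auto simp: injections_def)
    have "f j = undefined" using fv(2) assms(3) by (auto simp: PiE_def extensional_def)
    then show "((case x of (f, v) \<Rightarrow> f(j := v))(j := undefined), (case x of (f, v) \<Rightarrow> f(j := v)) j) = x"
      using fv(1) by (simp add: fun_eq_iff)
    have img: "(f(j := v)) ` J = f ` J" using assms(3) by (intro image_cong) auto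
    have "inj_on (f(j := v)) J" using fv(3) assms(3) by (auto simp: inj_on_def)
    then have "inj_on (f(j := v)) (insert j J)"
      unfolding inj_on_insert using fv(5) img assms(3) by simp
    moreover have "f(j := v) \<in> insert j J \<rightarrow>\<^sub>E B"
      using fv(2,4) by (auto simp: PiE_def extensional_def Pi_def)
    ultimately show "(case x of (f, v) \<Rightarrow> f(j := v)) \<in> injections (insert j J) B"
      using fv(1) by (simp add: injections_def)
    show "F (case x of (f, v) \<Rightarrow> f(j := v)) = (case x of (f, v) \<Rightarrow> F (f(j := v)))" by (simp add: fv(1))
  next
    fix g assume g: "g \<in> injections (insert j J) B"
    then have g': "g \<in> insert j J \<rightarrow>\<^sub>E B" "inj_on g (insert j J)" by (auto simp: injections_def)
    show "(case (g(j := undefined), g j) of (f, v) \<Rightarrow> f(j := v)) = g" by simp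
    have img: "(g(j := undefined)) ` J = g ` J" using assms(3) by (intro image_cong) auto
    have "g(j := undefined) \<in> J \<rightarrow>\<^sub>E B" using g'(1) assms(3)
      by (auto simp: PiE_def extensional_def Pi_def)
    moreover have "inj_on (g(j := undefined)) J" using g'(2) assms(3) by (auto simp: inj_on_def)
    moreover have "g j \<in> B" "g j \<notin> g ` J" using g' assms(3) by (auto simp: inj_on_def PiE_def Pi_def)
    ultimately show "(g(j := undefined), g j) \<in> Sigma (injections J B) (\<lambda>f. B - f ` J)"
      unfolding injections_def mem_Sigma_iff img by blast
  qed
  finally show ?thesis by simp
qed

text \<open>
  For \<open>J = B\<close> this is the sum of all permutations of a monomial in variables indexed by \<open>B\<close>. Smaller
  sets \<open>J\<close> occur in the induction that expresses it by power sums.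
\<close>
definition augmented_monomial :: "'b set \<Rightarrow> 'c set \<Rightarrow> ('b \<Rightarrow> nat) \<Rightarrow> ('c \<Rightarrow> complex) \<Rightarrow> complex" where
  "augmented_monomial J B \<kappa> T = (\<Sum>f\<in>injections J B. \<Prod>i\<in>J. T (f i) ^ \<kappa> i)"

text \<open>
  Summing the new factor over all of \<open>B\<close> gives a power sum. The values already taken by \<open>f\<close> have to be
  subtracted; there, the new exponent is added to the exponent of the index with that value.
\<close>
lemma augmented_monomial_insert:
  assumes "finite J" "finite B" "j \<notin> J"
  shows "augmented_monomial (insert j J) B \<kappa> T = (\<Sum>b\<in>B. T b ^ \<kappa> j) * augmented_monomial J B \<kappa> T
    - (\<Sum>l\<in>J. augmented_monomial J B (\<kappa>(l := \<kappa> l + \<kappa> j)) T)"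
proof -
  let ?m = "\<lambda>f. \<Prod>i\<in>J. T (f i) ^ \<kappa> i"
  have merge: "T (f l) ^ \<kappa> j * ?m f = (\<Prod>i\<in>J. T (f i) ^ (\<kappa>(l := \<kappa> l + \<kappa> j)) i)" if "l \<in> J" for f l
  proof -
    have "(\<Prod>i\<in>J. T (f i) ^ (\<kappa>(l := \<kappa> l + \<kappa> j)) i)
        = T (f l) ^ (\<kappa> l + \<kappa> j) * (\<Prod>i\<in>J - {l}. T (f i) ^ \<kappa> i)"
      using assms(1) that by (subst prod.remove[of _ l]) auto
    moreover have "?m f = T (f l) ^ \<kappa> l * (\<Prod>i\<in>J - {l}. T (f i) ^ \<kappa> i)"
      using assms(1) that by (rule prod.remove)
    ultimately show ?thesis by (simp add: power_add mult_ac)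
  qed
  have inner: "(\<Sum>v\<in>B - f ` J. \<Prod>i\<in>insert j J. T ((f(j := v)) i) ^ \<kappa> i)
      = (\<Sum>b\<in>B. T b ^ \<kappa> j) * ?m f - (\<Sum>l\<in>J. \<Prod>i\<in>J. T (f i) ^ (\<kappa>(l := \<kappa> l + \<kappa> j)) i)"
    if "f \<in> injections J B" for f
  proof -
    have f: "f ` J \<subseteq> B" "inj_on f J" using that by (auto simp: injections_def)
    have "(\<Prod>i\<in>insert j J. T ((f(j := v)) i) ^ \<kappa> i) = T v ^ \<kappa> j * ?m f" for v
    proof -
      have "(\<Prod>i\<in>J. T ((f(j := v)) i) ^ \<kappa> i) = ?m f" using assms(3) by (intro prod.cong) auto
      then show ?thesis using assms by simp
    qed
    then have "(\<Sum>v\<in>B - f ` J. \<Prod>i\<in>insert j J. T ((f(j := v)) i) ^ \<kappa> i)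
        = (\<Sum>v\<in>B - f ` J. T v ^ \<kappa> j) * ?m f" by (simp add: sum_distrib_right)
    also have "(\<Sum>v\<in>B - f ` J. T v ^ \<kappa> j) = (\<Sum>b\<in>B. T b ^ \<kappa> j) - (\<Sum>l\<in>J. T (f l) ^ \<kappa> j)"
      using f assms by (simp add: sum_diff sum.reindex)
    also have "((\<Sum>b\<in>B. T b ^ \<kappa> j) - (\<Sum>l\<in>J. T (f l) ^ \<kappa> j)) * ?m f
        = (\<Sum>b\<in>B. T b ^ \<kappa> j) * ?m f - (\<Sum>l\<in>J. T (f l) ^ \<kappa> j * ?m f)"
      by (simp only: left_diff_distrib sum_distrib_right)
    also have "(\<Sum>l\<in>J. T (f l) ^ \<kappa> j * ?m f) = (\<Sum>l\<in>J. \<Prod>i\<in>J. T (f i) ^ (\<kappa>(l := \<kappa> l + \<kappa> j)) i)"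
      by (intro sum.cong refl merge)
    finally show ?thesis .
  qed
  have "augmented_monomial (insert j J) B \<kappa> T
      = (\<Sum>f\<in>injections J B. \<Sum>v\<in>B - f ` J. \<Prod>i\<in>insert j J. T ((f(j := v)) i) ^ \<kappa> i)"
    unfolding augmented_monomial_def by (rule sum_injections_insert[OF assms])
  also have "\<dots> = (\<Sum>f\<in>injections J B. (\<Sum>b\<in>B. T b ^ \<kappa> j) * ?m f
      - (\<Sum>l\<in>J. \<Prod>i\<in>J. T (f i) ^ (\<kappa>(l := \<kappa> l + \<kappa> j)) i))"
    by (intro sum.cong refl inner)
  also have "\<dots> = (\<Sum>b\<in>B. T b ^ \<kappa> j) * augmented_monomial J B \<kappa> T
    - (\<Sum>l\<in>J. augmented_monomial J B (\<kappa>(l := \<kappa> l + \<kappa> j)) T)"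
    unfolding sum_subtractf augmented_monomial_def sum_distrib_left by (simp only: sum.swap[of _ J])
  finally show ?thesis .
qed

text \<open>
  Permuted sums of a monomial are polynomials in the power sums, homogeneous of the degree of the
  monomial. The sets \<open>P D\<close> abstract from what a polynomial of degree \<open>D\<close> in the power sums is.
\<close>
lemma augmented_monomial_in_graded:
  fixes P :: "nat \<Rightarrow> ('z \<Rightarrow> complex) set" and J :: "'b set" and B :: "'c set"
  assumes "finite J" "finite B"
    and one: "(\<lambda>_. 1) \<in> P 0"
    and add: "\<And>D f g. f \<in> P D \<Longrightarrow> g \<in> P D \<Longrightarrow> (\<lambda>z. f z + g z) \<in> P D"
    and cmult: "\<And>D c f. f \<in> P D \<Longrightarrow> (\<lambda>z. c * f z) \<in> P D"
    and power_sum: "\<And>D m f. f \<in> P D \<Longrightarrow> (\<lambda>z. (\<Sum>b\<in>B. T z b ^ m) * f z) \<in> P (D + m)"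
  shows "(\<lambda>z. augmented_monomial J B \<kappa> (T z)) \<in> P (sum \<kappa> J)"
  using assms(1)
proof (induction J arbitrary: \<kappa>)
  case empty
  have "(\<lambda>z. augmented_monomial {} B \<kappa> (T z)) = (\<lambda>_. 1)"
    by (simp add: augmented_monomial_def injections_def)
  then show ?case using one by simp
next
  case (insert j J)
  have sums: "(\<And>i. i \<in> I \<Longrightarrow> F i \<in> P D) \<Longrightarrow> I \<noteq> {} \<Longrightarrow> finite I \<Longrightarrow> (\<lambda>z. \<Sum>i\<in>I. F i z) \<in> P D" for I :: "'b set" and F D
  proof (induction I rule: infinite_finite_induct)
    case (insert i I)
    then show ?case using add[of "F i" D "\<lambda>z. \<Sum>i\<in>I. F i z"] by (cases "I = {}") auto
  qed auto
  have deg: "sum (\<kappa>(l := \<kappa> l + \<kappa> j)) J = sum \<kappa> (insert j J)" if "l \<in> J" for l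
  proof -
    have "sum (\<kappa>(l := \<kappa> l + \<kappa> j)) J = (\<kappa> l + \<kappa> j) + sum \<kappa> (J - {l})"
      using insert(1) that by (subst sum.remove[of _ l]) auto
    also have "\<dots> = \<kappa> j + sum \<kappa> J" using insert(1) that by (simp add: sum.remove)
    finally show ?thesis using insert by simp
  qed
  have "(\<lambda>z. (\<Sum>b\<in>B. T z b ^ \<kappa> j) * augmented_monomial J B \<kappa> (T z)) \<in> P (sum \<kappa> J + \<kappa> j)"
    by (rule power_sum[OF insert.IH])
  then have main: "(\<lambda>z. (\<Sum>b\<in>B. T z b ^ \<kappa> j) * augmented_monomial J B \<kappa> (T z)) \<in> P (sum \<kappa> (insert j J))"
    using insert by (simp add: add.commute)
  show ?case
  proof (cases "J = {}")
    case True
    then show ?thesis using main insert unfolding augmented_monomial_insert[OF insert(1) assms(2) insert(2)] by simp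
  next
    case False
    have "(\<lambda>z. augmented_monomial J B (\<kappa>(l := \<kappa> l + \<kappa> j)) (T z)) \<in> P (sum \<kappa> (insert j J))" if "l \<in> J" for l
      using insert.IH[of "\<kappa>(l := \<kappa> l + \<kappa> j)"] unfolding deg[OF that] .
    then have "(\<lambda>z. \<Sum>l\<in>J. augmented_monomial J B (\<kappa>(l := \<kappa> l + \<kappa> j)) (T z)) \<in> P (sum \<kappa> (insert j J))"
      by (intro sums[OF _ False insert(1)])
    from add[OF main cmult[OF this, of "-1"]] show ?thesis
      unfolding augmented_monomial_insert[OF insert(1) assms(2) insert(2)] by simp
  qed
qed

context cocharacters
begin

lemma character_lattice_perm:
  assumes "\<mu> \<in> character_lattice N" "p permutes UNIV" shows "perm_act p \<mu> \<in> character_lattice N"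
proof -
  have "perm_act p \<mu> \<bullet> \<nu> \<in> \<int>" if "\<nu> \<in> N" for \<nu>
  proof -
    define F where "F j = \<mu> $ j * \<nu> $ Hilbert_Choice.inv p j" for j
    have "perm_act p \<mu> \<bullet> \<nu> = (\<Sum>i\<in>UNIV. F (p i))"
      using permutes_inverses(2)[OF assms(2)] by (simp add: inner_vec_def F_def)
    also have "\<dots> = (\<Sum>i\<in>UNIV. F i)" by (rule sum_permute_UNIV[OF assms(2)])
    also have "\<dots> = \<mu> \<bullet> perm_act (Hilbert_Choice.inv p) \<nu>" by (simp add: inner_vec_def F_def)
    finally show ?thesis
      using assms(1) N_perm[OF that permutes_inv[OF assms(2)]] by (auto simp: character_lattice_def)
  qed
  then show ?thesis using assms by (auto simp: character_lattice_def E_space_def sum_permute_UNIV)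
qed

lemma integral_vector_character:
  assumes "\<And>i. x $ i \<in> \<int>" "(\<Sum>i\<in>UNIV. x $ i) = 0" shows "x \<in> character_lattice N"
proof -
  have "x \<bullet> \<nu> \<in> \<int>" if \<nu>: "\<nu> \<in> N" for \<nu>
  proof -
    obtain j :: 'n where True by auto
    have "x \<bullet> \<nu> = (\<Sum>i\<in>UNIV. x $ i * (\<nu> $ i - \<nu> $ j)) + (\<Sum>i\<in>UNIV. x $ i) * \<nu> $ j"
      by (simp add: inner_vec_def right_diff_distrib sum_subtractf sum_distrib_right)
    also have "\<dots> \<in> \<int>" unfolding assms(2) by (auto intro!: Ints_sum Ints_mult assms(1) N_integral[OF \<nu>])
    finally show ?thesis .
  qed
  then show ?thesis using assms(2) by (simp add: character_lattice_def E_space_def)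
qed

lemma expsum_compose_G:
  assumes "f \<in> expsum (character_lattice N)" "g \<in> G"
  shows "(\<lambda>z. f (g z)) \<in> expsum (character_lattice N)"
proof -
  obtain p \<nu> where g: "p permutes UNIV" "\<nu> \<in> N" "g = (\<lambda>z. perm_act p z + cvec \<nu> 0)"
    using assms(2) by (rule G_memE)
  show ?thesis using assms(1)
  proof (induction rule: expsum_induct)
    case (add c \<mu> f)
    have "\<mu> \<bullet> \<nu> \<in> \<int>" using add g by (auto simp: character_lattice_def)
    then have "echar \<mu> (g z) = echar (perm_act (Hilbert_Choice.inv p) \<mu>) z" for z
      unfolding g(3) by (simp add: echar_translate echar_perm[OF g(1)])
    then show ?case using add
      by (auto intro!: expsum_add expsum_cmult expsum_echar character_lattice_perm permutes_inv g(1))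
  qed simp
qed

text \<open>
  Translations by \<open>N\<close> leave each character of \<open>N\<close> unchanged, so only permutations have to be
  considered.
\<close>
lemma invariantI:
  assumes f: "f \<in> expsum (character_lattice N)"
    and perm: "\<And>p z. p permutes UNIV \<Longrightarrow> z \<in> EC \<Longrightarrow> f (perm_act p z) = f z"
  shows "f \<in> invariant_functions"
proof -
  have translate: "f (z + cvec \<nu> 0) = f z" if "\<nu> \<in> N" for z :: "complex ^ 'n" and \<nu>
    using f
  proof (induction rule: expsum_induct)
    case (add c \<mu> f)
    then show ?case using that by (simp add: echar_translate character_lattice_def)
  qed simp
  show ?thesis unfolding invariant_functions_def
  proof (intro CollectI conjI f ballI)
    fix g and z :: "complex ^ 'n" assume "g \<in> G" "z \<in> EC"
    then show "f (g z) = f z" by (elim G_memE) (simp add: translate perm)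
  qed
qed

text \<open>
  Adding a large constant to all coordinates of a character makes them natural numbers.
\<close>
lemma character_as_monomial:
  assumes \<mu>: "\<mu> \<in> character_lattice N"
  obtains k :: "'n \<Rightarrow> nat" and r where "\<mu> = (\<chi> i. real (k i)) + (\<chi> i. r)"
    and "\<And>z. z \<in> EC \<Longrightarrow> echar \<mu> z = (\<Prod>i\<in>UNIV. tcoord i z ^ k i)"
proof -
  obtain j :: 'n where True by auto
  \<comment> \<open>Large enough to make all coordinates nonnegative.\<close>
  define K where "K = (\<Sum>i\<in>UNIV. \<lceil>\<bar>\<mu> $ i - \<mu> $ j\<bar>\<rceil>)"
  define k where "k i = nat \<lfloor>\<mu> $ i - \<mu> $ j + of_int K\<rfloor>" for i
  have k: "real (k i) = \<mu> $ i - \<mu> $ j + of_int K" for i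
  proof -
    have "\<bar>\<mu> $ i - \<mu> $ j\<bar> \<le> of_int \<lceil>\<bar>\<mu> $ i - \<mu> $ j\<bar>\<rceil>" by simp
    also have "\<lceil>\<bar>\<mu> $ i - \<mu> $ j\<bar>\<rceil> \<le> K" unfolding K_def
      by (rule member_le_sum) (auto simp: ceiling_mono[of 0, simplified])
    finally have "0 \<le> \<mu> $ i - \<mu> $ j + of_int K" by linarith
    moreover have "\<mu> $ i - \<mu> $ j + of_int K \<in> \<int>" using character_lattice_integral[OF \<mu>] by simp
    ultimately obtain m :: int where "\<mu> $ i - \<mu> $ j + of_int K = of_int m" "m \<ge> 0"
      by (metis Ints_cases of_int_0_le_iff)
    then show ?thesis unfolding k_def by simp
  qed
  then have eq: "\<mu> = (\<chi> i. real (k i)) + (\<chi> i. \<mu> $ j - of_int K)" by (simp add: vec_eq_iff)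
  have "echar \<mu> z = (\<Prod>i\<in>UNIV. tcoord i z ^ k i)" if "z \<in> EC" for z
    by (subst eq) (simp only: echar_add_const[OF that] echar_nat_vector)
  then show ?thesis using that eq by blast
qed

text \<open>
  The exponents of Laurent monomials of degree \<open>D\<close> in the torus coordinates.
\<close>
definition integer_vectors :: "nat \<Rightarrow> (real ^ 'n) set" where
  "integer_vectors D = {k. (\<forall>i. k $ i \<in> \<int>) \<and> (\<Sum>i\<in>UNIV. k $ i) = real D}"

definition symmetric_functions :: "nat \<Rightarrow> (complex ^ 'n \<Rightarrow> complex) set" where
  "symmetric_functions D = {F \<in> expsum (integer_vectors D). \<forall>p z. p permutes UNIV \<longrightarrow> F (perm_act p z) = F z}"

lemma power_sum_symmetric: "(\<lambda>z. \<Sum>i\<in>UNIV. tcoord i z ^ m) \<in> symmetric_functions m"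
  unfolding symmetric_functions_def
proof (intro CollectI conjI allI impI)
  have "echar (axis i (real m)) = (\<lambda>z. tcoord i z ^ m)" for i :: 'n
  proof
    fix z :: "complex ^ 'n"
    have "axis i (real m) = (\<chi> j. real (if j = i then m else 0))" by (simp add: axis_def vec_eq_iff)
    moreover have "(\<Prod>j\<in>UNIV. tcoord j z ^ (if j = i then m else 0)) = (\<Prod>j\<in>{i}. tcoord j z ^ m)"
      by (intro prod.mono_neutral_cong_right) auto
    ultimately show "echar (axis i (real m)) z = tcoord i z ^ m" by (simp only: echar_nat_vector) simp
  qed
  moreover have "axis i (real m) \<in> integer_vectors m" for i :: 'n
    by (simp add: integer_vectors_def axis_def)
  ultimately have "(\<lambda>z. tcoord i z ^ m) \<in> expsum (integer_vectors m)" for i :: 'n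
    using expsum_echar by metis
  then show "(\<lambda>z. \<Sum>i\<in>UNIV. tcoord i z ^ m) \<in> expsum (integer_vectors m)" by (rule expsum_sum)
next
  fix p :: "'n \<Rightarrow> 'n" and z :: "complex ^ 'n" assume p: "p permutes UNIV"
  have "tcoord i (perm_act p z) = tcoord (p i) z" for i by (simp add: tcoord_def)
  then show "(\<Sum>i\<in>UNIV. tcoord i (perm_act p z) ^ m) = (\<Sum>i\<in>UNIV. tcoord i z ^ m)"
    using sum_permute_UNIV[OF p, of "\<lambda>i. tcoord i z ^ m"] by simp
qed

lemma symmetric_one: "(\<lambda>_. 1) \<in> symmetric_functions 0"
  by (auto simp: symmetric_functions_def integer_vectors_def intro: expsum_const)

lemma symmetric_add: "f \<in> symmetric_functions D \<Longrightarrow> g \<in> symmetric_functions D \<Longrightarrow> (\<lambda>z. f z + g z) \<in> symmetric_functions D"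
  and symmetric_cmult: "f \<in> symmetric_functions D \<Longrightarrow> (\<lambda>z. c * f z) \<in> symmetric_functions D"
  by (auto simp: symmetric_functions_def intro: expsum_add expsum_cmult)

lemma symmetric_mult:
  "f \<in> symmetric_functions D \<Longrightarrow> g \<in> symmetric_functions D' \<Longrightarrow> (\<lambda>z. f z * g z) \<in> symmetric_functions (D + D')"
  by (auto simp: symmetric_functions_def integer_vectors_def sum.distrib intro!: expsum_mult)

text \<open>
  Integral vectors of equal sum differ by an element of the root lattice, and the root lattice consists
  of characters of every \<open>N\<close>. So, up to constant vectors, if one exponent of degree \<open>D\<close> is a character
  of \<open>N\<close>, then all are.
\<close>
lemma symmetric_to_invariant:
  assumes F: "F \<in> symmetric_functions D"
    and D: "\<mu> \<in> character_lattice N" "\<mu> = k + (\<chi> i. r)" "k \<in> integer_vectors D"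
  shows "\<exists>F'\<in>invariant_functions. \<forall>z\<in>EC. F z = F' z"
proof -
  have r: "r = - real D / real CARD('n)"
  proof -
    have "real D + real CARD('n) * r = 0"
      using character_lattice_sum[OF D(1)] D(3) by (simp add: D(2) sum.distrib integer_vectors_def)
    then show ?thesis by (simp add: field_simps)
  qed
  have shift: "k' + (\<chi> i. r) \<in> character_lattice N" if "k' \<in> integer_vectors D" for k'
  proof -
    have "k' - k \<in> character_lattice N"
      using that D(3) by (intro integral_vector_character) (auto simp: integer_vectors_def sum_subtractf)
    from character_lattice_add[OF this D(1)] show ?thesis by (simp add: D(2))
  qed
  have "F \<in> expsum (integer_vectors D)" using F by (simp add: symmetric_functions_def)
  then have "\<exists>F'\<in>expsum (character_lattice N). \<forall>z\<in>EC. F z = F' z"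
  proof (induction rule: expsum_induct)
    case zero
    show ?case by (rule bexI[of _ "\<lambda>_. 0"]) auto
  next
    case (add c k' f)
    then obtain f' where f': "f' \<in> expsum (character_lattice N)" "\<forall>z\<in>EC. f z = f' z" by auto
    have "(\<lambda>z. c * echar (k' + (\<chi> i. r)) z + f' z) \<in> expsum (character_lattice N)"
      by (intro expsum_add expsum_cmult expsum_echar shift add f')
    moreover have "\<forall>z\<in>EC. c * echar k' z + f z = c * echar (k' + (\<chi> i. r)) z + f' z"
      using f'(2) by (simp add: echar_add_const)
    ultimately show ?case by - (rule rev_bexI)
  qed
  then obtain F' where F': "F' \<in> expsum (character_lattice N)" "\<forall>z\<in>EC. F z = F' z" ..
  have "F' \<in> invariant_functions"
  proof (rule invariantI[OF F'(1)])
    fix p and z :: "complex ^ 'n" assume p: "p permutes (UNIV :: 'n set)" and z: "z \<in> EC"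
    have "perm_act p z \<in> EC" using z by (simp add: complexify_E_space sum_permute_UNIV[OF p])
    then have "F' (perm_act p z) = F (perm_act p z)" using F'(2) by simp
    also have "\<dots> = F z" using F p by (simp add: symmetric_functions_def)
    also have "\<dots> = F' z" using F'(2) z by simp
    finally show "F' (perm_act p z) = F' z" .
  qed
  then show ?thesis using F'(2) by - (rule rev_bexI)
qed

end

context flat
begin

text \<open>
  Within a block the coordinates of \<open>base\<close> have equal fractional parts.
\<close>
lemma base_floor: "j \<in> block L i \<Longrightarrow> base $ i - base $ j = of_int (\<lfloor>base $ i\<rfloor> - \<lfloor>base $ j\<rfloor>)"
proof -
  assume "j \<in> block L i"
  from base_integral[OF this] obtain m :: int where "base $ i - base $ j = of_int m" by (rule Ints_cases)
  then have "base $ i = base $ j + of_int m" by simp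
  then show ?thesis by simp
qed

text \<open>
  The permutation \<open>p\<close>, corrected by an integral translation that makes up for the different integral
  parts. It belongs to the affine Weyl group, permutes the torus coordinates, and maps \<open>LC\<close> to itself
  if \<open>p\<close> maps blocks into blocks.
\<close>
definition block_shift :: "('n \<Rightarrow> 'n) \<Rightarrow> complex ^ 'n \<Rightarrow> complex ^ 'n" where
  "block_shift p z = perm_act p z + cvec (\<chi> i. of_int (\<lfloor>base $ i\<rfloor> - \<lfloor>base $ p i\<rfloor>)) 0"

lemma block_shift_G: "p permutes UNIV \<Longrightarrow> block_shift p \<in> G"
  unfolding block_shift_def[abs_def]
  by (rule G_memI) (auto intro!: integral_vector simp: sum_subtractf sum_permute_UNIV[where f = "\<lambda>i. real_of_int \<lfloor>base $ i\<rfloor>"])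

lemma block_shift_preserves:
  assumes p: "p permutes UNIV" and blk: "\<And>i j. j \<in> block L i \<Longrightarrow> p j \<in> block L (p i)" and z: "z \<in> LC"
  shows "block_shift p z \<in> LC"
proof -
  have E: "block_shift p z \<in> EC"
    using G_preserves_E[OF block_shift_G[OF p]] z complexify_flat_subset by blast
  have "block_shift p z $ i - block_shift p z $ j = of_real (base $ i - base $ j)" if j: "j \<in> block L i" for i j
  proof -
    have "z $ p i - z $ p j = of_real (base $ p i - base $ p j)"
      using z blk[OF j] by (simp add: complexify_flat_iff)
    then show ?thesis
      unfolding base_floor[OF blk[OF j]] base_floor[OF j] block_shift_def
      by (simp add: complex_eq_iff)
  qed
  then show ?thesis using E unfolding complexify_flat_iff complexify_E_space by auto
qed

lemma tcoord_block_shift: "tcoord i (block_shift p z) = tcoord (p i) z"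
proof -
  have "exp (2 * of_real pi * \<i> * Complex (of_int (\<lfloor>base $ i\<rfloor> - \<lfloor>base $ p i\<rfloor>)) 0) = 1"
    using exp_2pi_integer[of "of_int (\<lfloor>base $ i\<rfloor> - \<lfloor>base $ p i\<rfloor>)"] by (simp add: complex_of_real_def)
  then show ?thesis by (simp add: tcoord_def block_shift_def distrib_left exp_add)
qed

lemma tcoord_block: "z \<in> LC \<Longrightarrow> j \<in> block L i \<Longrightarrow> tcoord j z = tcoord i z"
proof -
  assume z: "z \<in> LC" and j: "j \<in> block L i"
  have "z $ i - z $ j = of_real (base $ i - base $ j)"
    using z j unfolding complexify_flat_iff by blast
  then have "z $ i = z $ j + of_real (base $ i - base $ j)" by (simp only: diff_eq_eq add.commute)
  then show ?thesis
    using exp_2pi_integer[OF base_integral[OF j]] unfolding tcoord_def by (simp only: distrib_left exp_add) simp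
qed

end

section \<open>Equal block sizes: invariant functions extend\<close>

context flat
begin

abbreviation "blocks \<equiv> range (block L)"

lemma block_fibre: "{i. block L i = b} = b" if "b \<in> blocks"
proof -
  obtain x where x: "b = block L x" using \<open>b \<in> blocks\<close> by blast
  have "block L i = block L x \<longleftrightarrow> i \<in> block L x" for i using block_eq_iff[of L x i] by metis
  then show ?thesis unfolding x by simp
qed

lemma block_of_mem: "b \<in> blocks \<Longrightarrow> i \<in> b \<Longrightarrow> block L i = b"
  using block_eq by fastforce

text \<open>
  On \<open>LC\<close> the choice of the element of the block does not matter.
\<close>
definition block_tcoord :: "complex ^ 'n \<Rightarrow> 'n set \<Rightarrow> complex" where
  "block_tcoord z b = tcoord (SOME i. i \<in> b) z"

lemma block_tcoord: "z \<in> LC \<Longrightarrow> block_tcoord z (block L i) = tcoord i z"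
  unfolding block_tcoord_def by (rule tcoord_block, assumption) (rule someI, rule block_refl)

lemma prod_by_blocks:
  "(\<Prod>i\<in>UNIV. F (block L i) ^ k i) = (\<Prod>b\<in>blocks. F b ^ (\<Sum>i\<in>b. k i))"
proof -
  have "(\<Prod>i\<in>UNIV. F (block L i) ^ k i) = (\<Prod>b\<in>blocks. \<Prod>i\<in>{i \<in> UNIV. block L i = b}. F (block L i) ^ k i)"
    by (rule prod.group[symmetric]) auto
  also have "\<dots> = (\<Prod>b\<in>blocks. F b ^ (\<Sum>i\<in>b. k i))"
  proof (rule prod.cong[OF refl])
    fix b assume b: "b \<in> blocks"
    have "(\<Prod>i\<in>{i \<in> UNIV. block L i = b}. F (block L i) ^ k i) = (\<Prod>i\<in>b. F b ^ k i)"
      using block_fibre[OF b] by (intro prod.cong) auto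
    then show "(\<Prod>i\<in>{i \<in> UNIV. block L i = b}. F (block L i) ^ k i) = F b ^ (\<Sum>i\<in>b. k i)"
      by (simp add: power_sum)
  qed
  finally show ?thesis .
qed

lemma sum_by_blocks: "(\<Sum>b\<in>blocks. \<Sum>i\<in>b. F i) = (\<Sum>i\<in>UNIV. F i)"
proof -
  have "(\<Sum>b\<in>blocks. \<Sum>i\<in>b. F i) = (\<Sum>b\<in>blocks. \<Sum>i\<in>{i \<in> UNIV. block L i = b}. F i)"
    by (rule sum.cong[OF refl]) (simp add: block_fibre)
  also have "\<dots> = (\<Sum>i\<in>UNIV. F i)" by (rule sum.group) auto
  finally show ?thesis .
qed

text \<open>
  Blocks of the same size are in bijection, and bijections from each block to its image are the parts of
  one permutation.
\<close>
lemma permutation_of_blocks: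
  assumes eqc: "\<And>i j. card (block L i) = card (block L j)" and f: "f \<in> injections blocks blocks"
  shows "\<exists>p. p permutes UNIV \<and> (\<forall>i. block L (p i) = f (block L i))"
proof -
  have f': "inj_on f blocks" "\<And>b. b \<in> blocks \<Longrightarrow> f b \<in> blocks" using f by (auto simp: injections_def)
  have "\<forall>b\<in>blocks. \<exists>\<phi>. bij_betw \<phi> b (f b)"
  proof
    fix b assume b: "b \<in> blocks"
    then obtain i j where "b = block L i" "f b = block L j" using f'(2)[OF b] by blast
    then show "\<exists>\<phi>. bij_betw \<phi> b (f b)" using eqc by (intro finite_same_card_bij) auto
  qed
  from bchoice[OF this] obtain \<phi> where \<phi>: "\<forall>b\<in>blocks. bij_betw (\<phi> b) b (f b)" ..
  define p where "p i = \<phi> (block L i) i" for i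
  have blk: "block L (p i) = f (block L i)" for i
  proof -
    have "p i \<in> f (block L i)" unfolding p_def using \<phi> block_refl[of i L] by (auto dest: bij_betwE)
    moreover obtain k where "f (block L i) = block L k" using f'(2)[of "block L i"] by blast
    ultimately show ?thesis by (simp add: block_eq)
  qed
  have "inj p"
  proof (rule injI)
    fix i j assume ij: "p i = p j"
    then have "f (block L i) = f (block L j)" using blk by metis
    then have "block L i = block L j" using f'(1) by (auto dest: inj_onD)
    moreover have "inj_on (\<phi> (block L i)) (block L i)" using \<phi> by (auto dest: bij_betw_imp_inj_on)
    moreover have "j \<in> block L i" using calculation(1) block_refl[of j L] by simp
    ultimately show "i = j" using ij block_refl[of i L] unfolding p_def by (auto dest: inj_onD)
  qed
  then have "bij p" by (simp add: bij_def finite_UNIV_inj_surj)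
  then have "p permutes UNIV" by (intro bij_imp_permutes) auto
  then show ?thesis using blk by blast
qed

text \<open>
  For a single character, written as a monomial in the torus coordinates, the sum over all permutations
  of the blocks is the permuted sum of a monomial in the values \<open>t\<^sub>b\<close>, with exponent of \<open>b\<close> the total
  exponent in the block. It is a polynomial in the power sums of the \<open>t\<^sub>b\<close>; for blocks of size \<open>d\<close>
  these are \<open>1/d\<close> times the power sums of all torus coordinates, which are defined on the whole
  torus.
\<close>
lemma block_average_extends:
  assumes eqc: "\<And>i j. card (block L i) = card (block L j)"
    and p: "\<And>f. f \<in> injections blocks blocks \<Longrightarrow> p f permutes UNIV \<and> (\<forall>i. block L (p f i) = f (block L i))"
    and h: "h \<in> expsum \<Lambda>"
  shows "\<exists>F\<in>invariant_functions. \<forall>z\<in>LC.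
    (\<Sum>f\<in>injections blocks blocks. h (block_shift (p f) z)) = F z"
  using h
proof (induction rule: expsum_induct)
  case zero
  show ?case by (rule bexI[of _ "\<lambda>_. 0"]) (auto intro: invariant_const)
next
  case (add c \<mu> h)
  then obtain F where F: "F \<in> invariant_functions"
    "\<forall>z\<in>LC. (\<Sum>f\<in>injections blocks blocks. h (block_shift (p f) z)) = F z" by auto
  obtain k :: "'n \<Rightarrow> nat" and r where k: "\<mu> = (\<chi> i. real (k i)) + (\<chi> i. r)"
    "\<And>z. z \<in> EC \<Longrightarrow> echar \<mu> z = (\<Prod>i\<in>UNIV. tcoord i z ^ k i)"
    using character_as_monomial[OF \<open>\<mu> \<in> \<Lambda>\<close>] by metis
  define \<kappa> where "\<kappa> b = (\<Sum>i\<in>b. k i)" for b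
  define d where "d = card (block L undefined)"
  have d: "card b = d" if "b \<in> blocks" for b using that eqc unfolding d_def by auto
  have d0: "d > 0" unfolding d_def by (rule card_block_pos)
  have monomial: "(\<Sum>f\<in>injections blocks blocks. echar \<mu> (block_shift (p f) z))
      = augmented_monomial blocks blocks \<kappa> (block_tcoord z)" if z: "z \<in> LC" for z
    unfolding augmented_monomial_def
  proof (rule sum.cong[OF refl])
    fix f assume f: "f \<in> injections blocks blocks"
    have "block_shift (p f) z \<in> EC"
      using G_preserves_E[OF block_shift_G] p[OF f] z complexify_flat_subset by blast
    then have "echar \<mu> (block_shift (p f) z) = (\<Prod>i\<in>UNIV. tcoord (p f i) z ^ k i)"
      by (simp add: k(2) tcoord_block_shift)
    also have "\<dots> = (\<Prod>i\<in>UNIV. block_tcoord z (f (block L i)) ^ k i)"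
      using p[OF f] by (simp add: block_tcoord[OF z, symmetric])
    also have "\<dots> = (\<Prod>b\<in>blocks. block_tcoord z (f b) ^ \<kappa> b)"
      unfolding \<kappa>_def by (rule prod_by_blocks)
    finally show "echar \<mu> (block_shift (p f) z) = (\<Prod>b\<in>blocks. block_tcoord z (f b) ^ \<kappa> b)" .
  qed
  let ?P = "\<lambda>D. {u. \<exists>F\<in>symmetric_functions D. \<forall>z\<in>LC. u z = F z}"
  have "(\<lambda>z. augmented_monomial blocks blocks \<kappa> (block_tcoord z)) \<in> ?P (sum \<kappa> blocks)"
  proof (rule augmented_monomial_in_graded)
    show "(\<lambda>_. 1) \<in> ?P 0" by (intro CollectI bexI[OF _ symmetric_one]) simp
    show "(\<lambda>z. f z + g z) \<in> ?P D" if fg: "f \<in> ?P D" "g \<in> ?P D" for D f g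
    proof -
      obtain F G where "F \<in> symmetric_functions D" "\<forall>z\<in>LC. f z = F z"
        "G \<in> symmetric_functions D" "\<forall>z\<in>LC. g z = G z" using fg by auto
      then show ?thesis by (intro CollectI bexI[OF _ symmetric_add[of F D G]]) auto
    qed
    show "(\<lambda>z. c * f z) \<in> ?P D" if f: "f \<in> ?P D" for D c f
    proof -
      obtain F where "F \<in> symmetric_functions D" "\<forall>z\<in>LC. f z = F z" using f by auto
      then show ?thesis by (intro CollectI bexI[OF _ symmetric_cmult[of F D c]]) auto
    qed
    show "(\<lambda>z. (\<Sum>b\<in>blocks. block_tcoord z b ^ m) * f z) \<in> ?P (D + m)" if f: "f \<in> ?P D" for D m f
    proof -
      obtain F where F: "F \<in> symmetric_functions D" "\<forall>z\<in>LC. f z = F z" using f by auto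
      \<comment> \<open>Each block contributes \<open>d\<close> times its value to the sum over all coordinates.\<close>
      let ?S = "\<lambda>z. (1 / of_nat d) * (\<Sum>i\<in>UNIV. tcoord i z ^ m)"
      have S: "(\<Sum>b\<in>blocks. block_tcoord z b ^ m) = ?S z" if z: "z \<in> LC" for z
      proof -
        have "(\<Sum>i\<in>UNIV. tcoord i z ^ m) = (\<Sum>i\<in>UNIV. block_tcoord z (block L i) ^ m)"
          by (simp add: block_tcoord[OF z])
        also have "\<dots> = (\<Sum>b\<in>blocks. \<Sum>i\<in>b. block_tcoord z (block L i) ^ m)" by (rule sum_by_blocks[symmetric])
        also have "\<dots> = (\<Sum>b\<in>blocks. \<Sum>i\<in>b. block_tcoord z b ^ m)"
        proof (rule sum.cong[OF refl], rule sum.cong[OF refl])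
          fix b i assume "b \<in> blocks" "i \<in> b"
          then have "block L i = b" by (rule block_of_mem)
          then show "block_tcoord z (block L i) ^ m = block_tcoord z b ^ m" by simp
        qed
        also have "\<dots> = of_nat d * (\<Sum>b\<in>blocks. block_tcoord z b ^ m)"
          by (simp add: d sum_distrib_left)
        finally show ?thesis using d0 by simp
      qed
      have "(\<lambda>z. F z * ?S z) \<in> symmetric_functions (D + m)"
        by (rule symmetric_mult[OF F(1) symmetric_cmult[OF power_sum_symmetric]])
      moreover have "\<forall>z\<in>LC. (\<Sum>b\<in>blocks. block_tcoord z b ^ m) * f z = F z * ?S z"
        using F(2) S by simp
      ultimately show ?thesis by (intro CollectI) (rule rev_bexI)
    qed
  qed auto
  then obtain S where S: "S \<in> symmetric_functions (sum \<kappa> blocks)"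
    "\<forall>z\<in>LC. augmented_monomial blocks blocks \<kappa> (block_tcoord z) = S z" by auto
  have "(\<chi> i. real (k i)) \<in> integer_vectors (sum \<kappa> blocks)"
    unfolding \<kappa>_def sum_by_blocks by (simp add: integer_vectors_def)
  from symmetric_to_invariant[OF S(1) \<open>\<mu> \<in> \<Lambda>\<close> k(1) this]
  obtain S' where S': "S' \<in> invariant_functions" "\<forall>z\<in>EC. S z = S' z" ..
  have "(\<lambda>z. c * S' z + F z) \<in> invariant_functions"
    by (intro invariant_add invariant_mult invariant_const S' F)
  moreover have "\<forall>z\<in>LC. (\<Sum>f\<in>injections blocks blocks.
      c * echar \<mu> (block_shift (p f) z) + h (block_shift (p f) z)) = c * S' z + F z"
  proof
    fix z assume z: "z \<in> LC"
    then have "S z = S' z" using S'(2) complexify_flat_subset by blast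
    then show "(\<Sum>f\<in>injections blocks blocks.
      c * echar \<mu> (block_shift (p f) z) + h (block_shift (p f) z)) = c * S' z + F z"
      using F(2) S(2) z by (simp add: sum.distrib sum_distrib_left[symmetric] monomial)
  qed
  ultimately show ?case by - (rule rev_bexI)
qed

text \<open>
  An integral quotient \<open>a / b\<close> is an exponential sum \<open>h\<close> on \<open>LC\<close> because the torus coset is normal. It is
  invariant under all permutations of the blocks, since \<open>a\<close> and \<open>b\<close> are and there are no zero
  divisors. So \<open>h\<close> is its own average, and averages extend to invariant functions.
\<close>
theorem normal_if_equal_blocks:
  assumes eqc: "\<And>i j. card (block L i) = card (block L j)"
  shows "normal_subvariety N (stratum N L)"
  unfolding normal_subvariety_iff contains_integral_quotients_def
proof (intro ballI impI allI)
  fix a b k c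
  assume a: "a \<in> invariant_functions" and b: "b \<in> invariant_functions" and nz: "\<exists>z\<in>LC. b z \<noteq> 0"
    and c: "\<forall>j<k. c j \<in> invariant_functions"
    and eq: "\<forall>z\<in>LC. b z \<noteq> 0 \<longrightarrow> (a z / b z) ^ k + (\<Sum>j<k. c j z * (a z / b z) ^ j) = 0"
  have torus: "f \<in> expsum \<Lambda>" and inv: "g \<in> G \<Longrightarrow> z \<in> LC \<Longrightarrow> f (g z) = f z"
    if "f \<in> invariant_functions" for f g z
    using that complexify_flat_subset by (auto simp: invariant_functions_def)
  obtain h where h: "h \<in> expsum \<Lambda>" "\<forall>z\<in>LC. a z = b z * h z"
    using torus_integrally_closed[OF torus[OF a] torus[OF b] nz, of k c] c eq torus by blast
  have "\<forall>f\<in>injections blocks blocks. \<exists>p. p permutes UNIV \<and> (\<forall>i. block L (p i) = f (block L i))"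
    using permutation_of_blocks[OF eqc] by blast
  from bchoice[OF this] obtain p where
    p: "\<forall>f\<in>injections blocks blocks. p f permutes UNIV \<and> (\<forall>i. block L (p f i) = f (block L i))" ..
  have h_inv: "h (block_shift (p f) z) = h z" if f: "f \<in> injections blocks blocks" and z: "z \<in> LC" for f z
  proof -
    let ?g = "block_shift (p f)"
    have g: "?g \<in> G" using p f by (intro block_shift_G) auto
    have pres: "?g z \<in> LC" if "z \<in> LC" for z
    proof (rule block_shift_preserves[OF _ _ that])
      show "p f permutes UNIV" using p f by simp
      fix i j assume "j \<in> block L i"
      then have "block L (p f i) = block L (p f j)" using p f by (simp add: block_eq)
      then show "p f j \<in> block L (p f i)" by (simp add: block_eq_iff)
    qed
    have "(\<lambda>z. h (?g z) + (-1) * h z) \<in> expsum \<Lambda>"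
      by (intro expsum_add expsum_cmult expsum_compose_G[OF h(1) g] h)
    moreover have "b z * (h (?g z) + (-1) * h z) = 0" if z: "z \<in> LC" for z
    proof -
      have "b z * h (?g z) = b (?g z) * h (?g z)" using inv[OF b g z] by simp
      also have "\<dots> = a (?g z)" using h(2) pres[OF z] by simp
      also have "\<dots> = b z * h z" using inv[OF a g z] h(2) z by simp
      finally show ?thesis by (simp add: algebra_simps)
    qed
    ultimately have "(\<forall>z\<in>LC. b z = 0) \<or> (\<forall>z\<in>LC. h (?g z) + (-1) * h z = 0)"
      by (rule torus_no_zero_divisors[OF torus[OF b]])
    then show ?thesis using nz z by auto
  qed
  obtain F where F: "F \<in> invariant_functions"
    "\<forall>z\<in>LC. (\<Sum>f\<in>injections blocks blocks. h (block_shift (p f) z)) = F z"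
    using block_average_extends[OF eqc _ h(1), of p] p by blast
  let ?m = "of_nat (card (injections blocks blocks)) :: complex"
  have "restrict id blocks \<in> injections blocks blocks" by (auto simp: injections_def inj_on_def)
  then have m: "?m \<noteq> 0" using finite_injections[of blocks blocks] by (auto simp: card_eq_0_iff)
  have "?m * h z = F z" if "z \<in> LC" for z
    using F(2) that h_inv by simp
  then have "\<forall>z\<in>LC. a z = b z * (1 / ?m * F z)"
    using h(2) m by (simp add: field_simps)
  moreover have "(\<lambda>z. 1 / ?m * F z) \<in> invariant_functions"
    by (intro invariant_mult invariant_const F)
  ultimately show "\<exists>h\<in>invariant_functions. \<forall>z\<in>LC. a z = b z * h z" by - (rule bexI)
qed

end

section \<open>Unequal block sizes: a cusp\<close>

context flat
begin

text \<open>
  The character \<open>t\<^sub>i\<^sup>C\<close>, where \<open>C\<close> is the number of coordinates. This power is chosen because its exponent,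
  after subtraction of a constant vector, is integral with sum zero, hence a character of every
  \<open>N\<close>.
\<close>
definition power_weight :: "'n \<Rightarrow> real ^ 'n" where
  "power_weight i = (\<chi> j. real (if j = i then CARD('n) else 0)) + (\<chi> j. - 1)"

lemma power_weight_character: "power_weight i \<in> \<Lambda>"
  by (rule integral_vector_character) (auto simp: power_weight_def sum_subtractf if_distrib[of real] cong: if_cong)

lemma power_weight_monomial:
  assumes "z \<in> EC" shows "echar (power_weight i) z = tcoord i z ^ CARD('n)"
proof -
  have "(\<Prod>j\<in>UNIV. tcoord j z ^ (if j = i then CARD('n) else 0)) = (\<Prod>j\<in>{i}. tcoord j z ^ CARD('n))"
    by (intro prod.mono_neutral_cong_right) auto
  then show ?thesis unfolding power_weight_def by (simp only: echar_add_const[OF assms] echar_nat_vector) simp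
qed

lemma power_weight_perm:
  assumes "z \<in> EC" "p permutes UNIV"
  shows "echar (power_weight i) (perm_act p z) = echar (power_weight (p i)) z"
proof -
  have "perm_act p z \<in> EC"
    using assms by (simp add: complexify_E_space sum_permute_UNIV)
  then show ?thesis using assms(1) by (simp add: power_weight_monomial) (simp add: tcoord_def)
qed

lemma power_weight_block: "z \<in> LC \<Longrightarrow> j \<in> block L i \<Longrightarrow> echar (power_weight j) z = echar (power_weight i) z"
  using complexify_flat_subset by (auto simp: power_weight_monomial subset_eq tcoord_block)

lemma expsum_prod:
  assumes "finite I" "\<And>i. i \<in> I \<Longrightarrow> f i \<in> expsum \<Lambda>"
  shows "(\<lambda>z. \<Prod>i\<in>I. f i z) \<in> expsum \<Lambda>"
  using assms
proof (induction I)
  case (insert i I)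
  then have "(\<lambda>z. f i z * (\<Prod>i\<in>I. f i z)) \<in> expsum \<Lambda>"
    by (intro expsum_mult[of "f i" \<Lambda> _ \<Lambda>] character_lattice_add) auto
  then show ?case using insert by simp
qed (simp add: expsum_const character_lattice_zero)

text \<open>
  Sets with as many elements as there are blocks. Only those that meet every block once will contribute
  to the sums below, but the family of all of them is invariant under permutations.
\<close>
abbreviation selections :: "'n set set" where
  "selections \<equiv> {I. card I = card blocks}"

text \<open>
  Up to sign the discriminant of the selected values. The product over ordered pairs needs no
  order on the indices. On \<open>LC\<close> it vanishes as soon as two selected indices lie in one block.
\<close>
definition selection_discr :: "'n set \<Rightarrow> complex ^ 'n \<Rightarrow> complex" where
  "selection_discr I z = (\<Prod>i\<in>I. \<Prod>j\<in>I - {i}. echar (power_weight i) z + (-1) * echar (power_weight j) z)"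

definition selection_sum :: "'n set \<Rightarrow> complex ^ 'n \<Rightarrow> complex" where
  "selection_sum I z = (\<Sum>i\<in>I. echar (power_weight i) z)"

lemma selection_discr_expsum: "selection_discr I \<in> expsum \<Lambda>"
  unfolding selection_discr_def[abs_def]
  by (intro expsum_prod expsum_add expsum_cmult expsum_echar power_weight_character) auto

lemma selection_sum_expsum: "selection_sum I \<in> expsum \<Lambda>"
  unfolding selection_sum_def[abs_def] by (intro expsum_sum expsum_echar power_weight_character)

lemma selection_discr_perm:
  assumes "z \<in> EC" "p permutes UNIV"
  shows "selection_discr I (perm_act p z) = selection_discr (p ` I) z"
proof -
  have inj: "inj_on p A" for A using permutes_inj[OF assms(2)] by (rule inj_on_subset) simp
  have "p ` I - {p i} = p ` (I - {i})" for i using permutes_inj[OF assms(2)] by (auto dest: injD)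
  then show ?thesis
    unfolding selection_discr_def by (simp add: prod.reindex[OF inj] power_weight_perm[OF assms])
qed

lemma selection_sum_perm:
  assumes "z \<in> EC" "p permutes UNIV"
  shows "selection_sum I (perm_act p z) = selection_sum (p ` I) z"
proof -
  have inj: "inj_on p A" for A using permutes_inj[OF assms(2)] by (rule inj_on_subset) simp
  show ?thesis unfolding selection_sum_def by (simp add: sum.reindex[OF inj] power_weight_perm[OF assms])
qed

lemma selections_perm:
  assumes "p permutes (UNIV :: 'n set)"
  shows "bij_betw (image p) selections selections"
proof (rule bij_betw_imageI)
  have inj: "inj p" using permutes_inj[OF assms] .
  show "inj_on (image p) selections" using inj by (meson inj_image_eq_iff inj_onI)
  have "I \<in> image p ` selections" if "I \<in> selections" for I
  proof (rule image_eqI)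
    show "I = p ` (Hilbert_Choice.inv p ` I)"
      using permutes_inverses(1)[OF assms] by (simp add: image_image)
    have "inj (Hilbert_Choice.inv p)" using permutes_inj[OF permutes_inv[OF assms]] .
    then show "Hilbert_Choice.inv p ` I \<in> selections" using that by (simp add: card_image inj_on_subset)
  qed
  moreover have "p ` I \<in> selections" if "I \<in> selections" for I
    using that inj by (simp add: card_image inj_on_subset)
  ultimately show "image p ` selections = selections" by blast
qed

text \<open>
  The quotient of \<open>numer\<close> by \<open>denom\<close> is the mean of \<open>selection_sum\<close> with the discriminants as weights. On \<open>LC\<close>
  the weights are concentrated on the selections that meet every block once, and for these the sum is
  always the same.
\<close>
definition numer :: "complex ^ 'n \<Rightarrow> complex" where
  "numer z = (\<Sum>I\<in>selections. selection_discr I z * selection_sum I z)"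

definition denom :: "complex ^ 'n \<Rightarrow> complex" where
  "denom z = (\<Sum>I\<in>selections. selection_discr I z)"

lemma numer_invariant: "numer \<in> invariant_functions"
proof (rule invariantI)
  show "numer \<in> expsum \<Lambda>" unfolding numer_def[abs_def]
    by (intro expsum_sum expsum_mult[OF selection_discr_expsum selection_sum_expsum] character_lattice_add)
  fix p and z :: "complex ^ 'n" assume *: "p permutes (UNIV :: 'n set)" "z \<in> EC"
  show "numer (perm_act p z) = numer z"
    unfolding numer_def selection_discr_perm[OF *(2,1)] selection_sum_perm[OF *(2,1)]
    by (rule sum.reindex_bij_betw[OF selections_perm[OF *(1)]])
qed

lemma denom_invariant: "denom \<in> invariant_functions"
proof (rule invariantI)
  show "denom \<in> expsum \<Lambda>" unfolding denom_def[abs_def] by (intro expsum_sum selection_discr_expsum)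
  fix p and z :: "complex ^ 'n" assume *: "p permutes (UNIV :: 'n set)" "z \<in> EC"
  show "denom (perm_act p z) = denom z"
    unfolding denom_def selection_discr_perm[OF *(2,1)]
    by (rule sum.reindex_bij_betw[OF selections_perm[OF *(1)]])
qed

text \<open>
  A monic polynomial with all selection sums as roots. Permutations only reorder its factors, so its
  coefficients are invariant.
\<close>
definition selection_sum_poly :: "complex ^ 'n \<Rightarrow> complex poly" where
  "selection_sum_poly z = (\<Prod>I\<in>selections. [:- selection_sum I z, 1:])"

lemma coeff_selection_sum_poly_invariant: "(\<lambda>z. Polynomial.coeff (selection_sum_poly z) m) \<in> invariant_functions"
proof (rule invariantI)
  have "(\<lambda>z. Polynomial.coeff (\<Prod>I\<in>\<I>. [:- selection_sum I z, 1:]) m) \<in> expsum \<Lambda>" if "finite \<I>" for \<I> :: "'n set set"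
    using that
  proof (induction \<I> arbitrary: m)
    case empty
    show ?case by (simp add: expsum_const character_lattice_zero)
  next
    case (insert I \<I>)
    have eq: "Polynomial.coeff (\<Prod>I\<in>insert I \<I>. [:- selection_sum I z, 1:]) m
        = (-1) * (selection_sum I z * Polynomial.coeff (\<Prod>I\<in>\<I>. [:- selection_sum I z, 1:]) m) +
          (if m = 0 then 0 else Polynomial.coeff (\<Prod>I\<in>\<I>. [:- selection_sum I z, 1:]) (m - 1))" for z
      using insert by (simp add: coeff_pCons split: nat.splits)
    have "(\<lambda>z. if m = 0 then 0 else Polynomial.coeff (\<Prod>I\<in>\<I>. [:- selection_sum I z, 1:]) (m - 1)) \<in> expsum \<Lambda>"
      using insert.IH by (cases "m = 0") auto
    then show ?case unfolding eq
      by (intro expsum_add expsum_cmult expsum_mult[OF selection_sum_expsum insert.IH] character_lattice_add)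
  qed
  then show "(\<lambda>z. Polynomial.coeff (selection_sum_poly z) m) \<in> expsum \<Lambda>" by (simp add: selection_sum_poly_def)
  fix p and z :: "complex ^ 'n" assume *: "p permutes (UNIV :: 'n set)" "z \<in> EC"
  have "selection_sum_poly (perm_act p z) = selection_sum_poly z"
    unfolding selection_sum_poly_def selection_sum_perm[OF *(2,1)]
    by (rule prod.reindex_bij_betw[OF selections_perm[OF *(1)]])
  then show "Polynomial.coeff (selection_sum_poly (perm_act p z)) m = Polynomial.coeff (selection_sum_poly z) m" by simp
qed

lemma selection_sum_root:
  assumes "I \<in> selections"
  shows "selection_sum I z ^ card selections + (\<Sum>j<card selections. Polynomial.coeff (selection_sum_poly z) j * selection_sum I z ^ j) = 0"
proof -
  have deg: "Polynomial.degree (\<Prod>I\<in>\<I>. [:- selection_sum I z, 1:]) = card \<I> \<and>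
      Polynomial.coeff (\<Prod>I\<in>\<I>. [:- selection_sum I z, 1:]) (card \<I>) = 1" if "finite \<I>" for \<I> :: "'n set set"
    using that
  proof (induction \<I>)
    case (insert I \<I>)
    let ?q = "\<Prod>I\<in>\<I>. [:- selection_sum I z, 1:]"
    have "?q \<noteq> 0" by simp
    then have "Polynomial.degree ([:- selection_sum I z, 1:] * ?q) = Suc (card \<I>)"
      using insert by (subst degree_mult_eq) auto
    moreover have "Polynomial.coeff ([:- selection_sum I z, 1:] * ?q) (Suc (card \<I>)) = 1"
      using insert coeff_eq_0[of ?q "Suc (card \<I>)"] by simp
    ultimately show ?case using insert by simp
  qed simp
  have "poly (selection_sum_poly z) (selection_sum I z) = 0"
    unfolding selection_sum_poly_def poly_prod using assms by (intro prod_zero) (auto intro!: bexI[of _ I])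
  moreover have "poly (selection_sum_poly z) x = x ^ card selections + (\<Sum>j<card selections. Polynomial.coeff (selection_sum_poly z) j * x ^ j)" for x
    unfolding poly_altdef using deg[of selections]
    by (simp add: selection_sum_poly_def[symmetric] lessThan_Suc_atMost[symmetric])
  ultimately show ?thesis by simp
qed

definition transversal :: "'n set" where
  "transversal = (\<lambda>b. SOME i. i \<in> b) ` blocks"

lemma some_in_block: "block L (SOME j. j \<in> block L i) = block L i"
  by (rule block_eq) (rule someI, rule block_refl)

lemma transversal_bij: "bij_betw (block L) transversal blocks"
proof -
  have "block L (SOME i. i \<in> b) = b" if "b \<in> blocks" for b using that some_in_block by auto
  then show ?thesis unfolding transversal_def
    by (intro bij_betwI[where g = "\<lambda>b. SOME i. i \<in> b"]) auto
qed

lemma transversal_selection: "transversal \<in> selections"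
  using bij_betw_same_card[OF transversal_bij] by simp

lemma selection_bij:
  assumes "I \<in> selections" "inj_on (block L) I" shows "bij_betw (block L) I blocks"
proof -
  have "block L ` I = blocks"
    using assms by (intro card_subset_eq) (auto simp: card_image)
  then show ?thesis using assms by (simp add: bij_betw_def)
qed

definition block_power :: "complex ^ 'n \<Rightarrow> 'n set \<Rightarrow> complex" where
  "block_power z b = echar (power_weight (SOME i. i \<in> b)) z"

lemma block_power: "z \<in> LC \<Longrightarrow> block_power z (block L i) = echar (power_weight i) z"
  unfolding block_power_def by (rule power_weight_block, assumption) (rule someI, rule block_refl)

lemma selection_sum_bij:
  assumes "z \<in> LC" "bij_betw (block L) I blocks"
  shows "selection_sum I z = (\<Sum>b\<in>blocks. block_power z b)"
  unfolding selection_sum_def sum.reindex_bij_betw[OF assms(2), symmetric] by (simp add: block_power assms(1))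

lemma selection_discr_bij:
  assumes z: "z \<in> LC" and I: "bij_betw (block L) I blocks"
  shows "selection_discr I z = (\<Prod>b\<in>blocks. \<Prod>b'\<in>blocks - {b}. block_power z b - block_power z b')"
proof -
  have "(\<Prod>b'\<in>blocks - {block L i}. block_power z (block L i) - block_power z b')
      = (\<Prod>j\<in>I - {i}. echar (power_weight i) z + (-1) * echar (power_weight j) z)" if i: "i \<in> I" for i
  proof -
    have "bij_betw (block L) (I - {i}) (blocks - {block L i})"
      using bij_betw_DiffI[OF I, of "{i}" "{block L i}"] i by (simp add: bij_betw_def)
    then show ?thesis by (simp add: prod.reindex_bij_betw[symmetric] block_power[OF z])
  qed
  then show ?thesis
    unfolding selection_discr_def prod.reindex_bij_betw[OF I, symmetric] by simp
qed

lemma selection_discr_zero: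
  assumes z: "z \<in> LC" and I: "\<not> inj_on (block L) I"
  shows "selection_discr I z = 0"
proof -
  obtain i j where ij: "i \<in> I" "j \<in> I" "i \<noteq> j" "block L i = block L j" using I by (auto simp: inj_on_def)
  then have "echar (power_weight j) z = echar (power_weight i) z" using power_weight_block[OF z] block_eq_iff by blast
  then have "(\<Prod>j\<in>I - {i}. echar (power_weight i) z + (-1) * echar (power_weight j) z) = 0"
    using ij by (intro prod_zero) (auto intro!: bexI[of _ j])
  then show ?thesis unfolding selection_discr_def using ij(1) by (intro prod_zero) auto
qed

lemma numer_eq:
  assumes z: "z \<in> LC"
  shows "numer z = denom z * selection_sum transversal z"
  unfolding numer_def denom_def sum_distrib_right
proof (rule sum.cong[OF refl])
  fix I assume I: "I \<in> selections"
  show "selection_discr I z * selection_sum I z = selection_discr I z * selection_sum transversal z"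
  proof (cases "inj_on (block L) I")
    case True
    from selection_sum_bij[OF z selection_bij[OF I this]] selection_sum_bij[OF z transversal_bij] show ?thesis by simp
  next
    case False
    then show ?thesis using selection_discr_zero[OF z] by simp
  qed
qed

text \<open>
  Choose the imaginary parts of the coordinates constant on blocks and different on different blocks.
  Then the values on different blocks have different absolute values, and all selections that meet
  every block once have the same nonzero discriminant.
\<close>
lemma denom_nonzero: "\<exists>z\<in>LC. denom z \<noteq> 0"
proof -
  obtain e :: "'n set \<Rightarrow> nat" where e: "inj_on e blocks"
    using finite_imp_inj_to_nat_seg[of blocks] by auto
  define m where "m = (\<Sum>i\<in>UNIV. real (e (block L i))) / real CARD('n)"
  \<comment> \<open>Subtracting the mean \<open>m\<close> makes the coordinate sum zero, so that \<open>y\<close> is a direction of \<open>L\<close>.\<close>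
  define y :: "real ^ 'n" where "y = (\<chi> i. real (e (block L i)) - m)"
  have ysum: "(\<Sum>i\<in>UNIV. y $ i) = 0" by (simp add: y_def m_def sum_subtractf)
  have yblk: "y $ i = y $ j" if "j \<in> block L i" for i j using block_eq[OF that] by (simp add: y_def)
  define z where "z = cvec base 0 + (\<chi> i. \<i> * of_real (y $ i))"
  have z: "z \<in> LC" unfolding z_def by (rule complexify_shift[OF base_mem ysum yblk])
  have norm_u: "norm (echar (power_weight i) z) = exp (- (2 * pi * y $ i)) ^ CARD('n)" for i
  proof -
    have "Re (2 * of_real pi * \<i> * z $ i) = - (2 * pi * y $ i)" by (simp add: z_def)
    then have "norm (tcoord i z) = exp (- (2 * pi * y $ i))" unfolding tcoord_def norm_exp_eq_Re by simp
    then show ?thesis using z complexify_flat_subset by (simp add: power_weight_monomial subset_eq norm_power)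
  qed
  have uneq: "block_power z b \<noteq> block_power z b'" if b: "b \<in> blocks" "b' \<in> blocks - {b}" for b b'
  proof
    assume eq: "block_power z b = block_power z b'"
    obtain i j where ij: "b = block L i" "b' = block L j" using b by blast
    have "exp (- (2 * pi * y $ i)) ^ CARD('n) = exp (- (2 * pi * y $ j)) ^ CARD('n)"
      using eq unfolding ij block_power[OF z] norm_u[symmetric] by simp
    then have "exp (- (2 * pi * y $ i)) = exp (- (2 * pi * y $ j))"
      by (rule power_eq_imp_eq_base) auto
    then have "e (block L i) = e (block L j)" by (simp add: y_def)
    then show False using e b ij by (auto dest: inj_onD)
  qed
  define \<delta> where "\<delta> = (\<Prod>b\<in>blocks. \<Prod>b'\<in>blocks - {b}. block_power z b - block_power z b')"
  have \<delta>: "\<delta> \<noteq> 0" unfolding \<delta>_def using uneq by (simp add: prod_zero_iff)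
  have "denom z = (\<Sum>I\<in>selections. if inj_on (block L) I then \<delta> else 0)"
    unfolding denom_def
  proof (rule sum.cong[OF refl])
    fix I assume I: "I \<in> selections"
    show "selection_discr I z = (if inj_on (block L) I then \<delta> else 0)"
      using selection_discr_zero[OF z] selection_discr_bij[OF z selection_bij[OF I]] by (simp add: \<delta>_def)
  qed
  also have "\<dots> = of_nat (card {I \<in> selections. inj_on (block L) I}) * \<delta>"
    by (simp add: sum.If_cases Int_def)
  also have "\<dots> \<noteq> 0"
  proof -
    have "transversal \<in> {I \<in> selections. inj_on (block L) I}"
      using transversal_selection transversal_bij by (auto dest: bij_betw_imp_inj_on)
    then have "card {I \<in> selections. inj_on (block L) I} \<noteq> 0" by (auto simp: card_eq_0_iff)
    then show ?thesis using \<delta> by simp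
  qed
  finally show ?thesis using z by blast
qed

text \<open>
  A point of \<open>LC\<close> at which all torus coordinates agree: its coordinates differ from integers by a
  common constant.
\<close>
definition origin :: "complex ^ 'n" where
  "origin = cvec (\<chi> i. of_int \<lfloor>base $ i\<rfloor> - (\<Sum>j\<in>UNIV. of_int \<lfloor>base $ j\<rfloor>) / real CARD('n)) 0"

lemma origin_mem: "origin \<in> LC"
  unfolding complexify_flat_iff
proof (intro conjI allI ballI)
  show "(\<Sum>i\<in>UNIV. origin $ i) = 0" by (simp add: origin_def complex_eq_iff sum_subtractf)
  show "origin $ i - origin $ j = of_real (base $ i - base $ j)" if "j \<in> block L i" for i j
    unfolding base_floor[OF that] by (simp add: origin_def complex_eq_iff)
qed

definition line :: "complex \<Rightarrow> real ^ 'n \<Rightarrow> complex ^ 'n" where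
  "line t v = origin + (\<chi> i. t * of_real (v $ i))"

lemma echar_line: "echar \<mu> (line t v) = echar \<mu> origin * exp (2 * of_real pi * \<i> * of_real (\<mu> \<bullet> v) * t)"
proof -
  have "cpair \<mu> (\<chi> i. t * of_real (v $ i)) = of_real (\<mu> \<bullet> v) * t"
    by (simp add: cpair_def inner_vec_def sum_distrib_right sum_distrib_left mult_ac)
  then show ?thesis unfolding line_def echar_def cpair_add_right by (simp add: distrib_left exp_add mult_ac)
qed

text \<open>
  The derivative at \<open>origin\<close> in a real direction is linear in the direction.
\<close>
lemma expsum_line_derivative:
  assumes "f \<in> expsum S"
  shows "\<exists>D. (\<forall>v. ((\<lambda>t. f (line t v)) has_field_derivative D v) (at 0)) \<and> linear D"
  using assms
proof (induction rule: expsum_induct)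
  case zero
  show ?case by (intro exI[of _ "\<lambda>_. 0"]) (auto intro: module_hom_zero)
next
  case (add c \<mu> f)
  then obtain D where D: "\<And>v. ((\<lambda>t. f (line t v)) has_field_derivative D v) (at 0)" "linear D" by auto
  let ?D = "\<lambda>v. c * echar \<mu> origin * (2 * of_real pi * \<i>) * of_real (\<mu> \<bullet> v) + D v"
  have "((\<lambda>t. c * echar \<mu> (line t v) + f (line t v)) has_field_derivative ?D v) (at 0)" for v
  proof -
    have "((\<lambda>t. c * (echar \<mu> origin * exp (2 * of_real pi * \<i> * of_real (\<mu> \<bullet> v) * t))) has_field_derivative
        c * echar \<mu> origin * (2 * of_real pi * \<i>) * of_real (\<mu> \<bullet> v)) (at 0)"
      by (auto intro!: derivative_eq_intros)
    from DERIV_add[OF this D(1)] show ?thesis by (simp only: echar_line)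
  qed
  moreover have "linear ?D"
  proof (rule linearI)
    show "?D (x + y) = ?D x + ?D y" for x y
      by (simp add: linear_add[OF D(2)] inner_add_right distrib_left)
    show "?D (r *\<^sub>R x) = r *\<^sub>R ?D x" for r x
      unfolding linear_scale[OF D(2)] inner_scaleR_right of_real_mult scaleR_conv_of_real[of _ "_ :: complex"]
      by (simp only: distrib_left mult_ac)
  qed
  ultimately show ?case by (intro exI[of _ ?D] conjI allI)
qed

lemma origin_shift:
  "block_shift p (line t v) = line t (perm_act p v)"
  by (simp add: line_def block_shift_def origin_def vec_eq_iff complex_eq_iff)

lemma line_in_E: "(\<Sum>i\<in>UNIV. v $ i) = 0 \<Longrightarrow> line t v \<in> EC"
proof -
  assume v: "(\<Sum>i\<in>UNIV. v $ i) = 0"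
  have "(\<Sum>i\<in>UNIV. t * of_real (v $ i)) = t * of_real (\<Sum>i\<in>UNIV. v $ i)" by (simp add: sum_distrib_left)
  then show ?thesis using v origin_mem complexify_flat_subset
    by (simp add: line_def complexify_E_space sum.distrib subset_eq)
qed

text \<open>
  The transposition of \<open>i\<close> and \<open>j\<close>, corrected by a translation, fixes \<open>origin\<close> and reverses the direction
  \<open>e\<^sub>i - e\<^sub>j\<close>. So an invariant function has derivative zero in these directions, which span all
  directions of coordinate sum zero.
\<close>
lemma invariant_line_derivative:
  assumes f: "f \<in> invariant_functions" and v: "(\<Sum>i\<in>UNIV. v $ i) = 0"
  shows "((\<lambda>t. f (line t v)) has_field_derivative 0) (at 0)"
proof -
  have "f \<in> expsum \<Lambda>" using f by (simp add: invariant_functions_def)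
  from expsum_line_derivative[OF this]
  obtain D where D: "\<And>v. ((\<lambda>t. f (line t v)) has_field_derivative D v) (at 0)" "linear D" by auto
  obtain j :: 'n where True by auto
  let ?r = "\<lambda>i. axis i 1 - axis j 1 :: real ^ 'n"
  have root: "D (?r i) = 0" for i
  proof -
    let ?p = "Transposition.transpose i j"
    have p: "?p permutes UNIV" by (rule permutes_swap_id) auto
    have perm: "perm_act ?p (?r i) = - ?r i"
      by (auto simp: vec_eq_iff axis_def Transposition.transpose_def)
    have "f (line t (?r i)) = f (line t (- ?r i))" for t
    proof -
      have "line t (?r i) \<in> EC" by (rule line_in_E) (simp add: axis_def sum_subtractf)
      then have "f (block_shift ?p (line t (?r i))) = f (line t (?r i))"
        using f block_shift_G[OF p] by (auto simp: invariant_functions_def)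
      then show ?thesis by (simp only: origin_shift perm)
    qed
    then have "D (?r i) = D (- ?r i)" using D(1)[of "?r i"] D(1)[of "- ?r i"] by (auto intro: DERIV_unique)
    then show ?thesis using linear_neg[OF D(2), of "?r i"] by simp
  qed
  have "D v = D (\<Sum>i\<in>UNIV. (v $ i) *\<^sub>R ?r i)"
    by (rule arg_cong) (rule sum_zero_root_combination[OF v])
  also have "\<dots> = (\<Sum>i\<in>UNIV. D ((v $ i) *\<^sub>R ?r i))" by (rule linear_sum[OF D(2)])
  also have "\<dots> = (\<Sum>i\<in>UNIV. (v $ i) *\<^sub>R D (?r i))" by (simp only: linear_scale[OF D(2)])
  also have "\<dots> = 0" by (simp add: root)
  finally have "D v = 0" .
  then show ?thesis using D(1)[of v] by simp
qed

lemma echar_uvec_origin: "echar (power_weight i) origin = echar (power_weight j) origin"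
proof -
  let ?m = "(\<Sum>j\<in>UNIV. of_int \<lfloor>base $ j\<rfloor>) / real CARD('n)"
  have "tcoord i origin = exp (2 * of_real pi * \<i> * of_real (- ?m))" for i
  proof -
    have "origin $ i = of_real (of_int \<lfloor>base $ i\<rfloor>) + of_real (- ?m)"
      by (simp add: origin_def complex_eq_iff)
    then have "tcoord i origin = exp (2 * of_real pi * \<i> * of_real (of_int \<lfloor>base $ i\<rfloor>))
        * exp (2 * of_real pi * \<i> * of_real (- ?m))"
      unfolding tcoord_def by (simp only: distrib_left exp_add)
    also have "exp (2 * of_real pi * \<i> * of_real (of_int \<lfloor>base $ i\<rfloor>)) = 1"
      by (rule exp_2pi_integer) simp
    finally show ?thesis by simp
  qed
  then show ?thesis using origin_mem complexify_flat_subset by (simp add: power_weight_monomial subset_eq)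
qed

text \<open>
  The quotient of \<open>numer\<close> by \<open>denom\<close> is integral and agrees on \<open>LC\<close> with the selection sum of a transversal.
  If it were an invariant function \<open>h\<close>, then \<open>h\<close> and the selection sum would agree on all of \<open>LC\<close>, for
  lack of zero divisors. But their derivatives at \<open>origin\<close> differ in the direction that moves one
  block with speed \<open>?q\<close> and the other with speed \<open>- ?p\<close>, where \<open>?p\<close> and \<open>?q\<close> are their sizes: these speeds
  cancel when every coordinate counts, but not when every block counts once.
\<close>
theorem not_normal_if_unequal_blocks:
  assumes neq: "card (block L i1) \<noteq> card (block L i2)"
  shows "\<not> normal_subvariety N (stratum N L)"
proof
  assume normal: "normal_subvariety N (stratum N L)"
  have "\<exists>h\<in>invariant_functions. \<forall>z\<in>LC. numer z = denom z * h z"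
  proof (rule contains_integral_quotientsD[OF normal[unfolded normal_subvariety_iff] numer_invariant denom_invariant denom_nonzero])
    show "(\<lambda>z. Polynomial.coeff (selection_sum_poly z) j) \<in> invariant_functions" for j
      by (rule coeff_selection_sum_poly_invariant)
    show "(numer z / denom z) ^ card selections
        + (\<Sum>j<card selections. Polynomial.coeff (selection_sum_poly z) j * (numer z / denom z) ^ j) = 0"
      if "z \<in> LC" "denom z \<noteq> 0" for z
      using selection_sum_root[OF transversal_selection, of z] that by (simp add: numer_eq)
  qed
  then obtain h where h: "h \<in> invariant_functions" "\<forall>z\<in>LC. numer z = denom z * h z" ..
  have "(\<forall>z\<in>LC. denom z = 0) \<or> (\<forall>z\<in>LC. h z + (-1) * selection_sum transversal z = 0)"
  proof (rule torus_no_zero_divisors)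
    show "denom \<in> expsum \<Lambda>" using denom_invariant by (simp add: invariant_functions_def)
    show "(\<lambda>z. h z + (-1) * selection_sum transversal z) \<in> expsum \<Lambda>"
      using h(1) by (intro expsum_add expsum_cmult selection_sum_expsum) (simp add: invariant_functions_def)
    show "denom z * (h z + (-1) * selection_sum transversal z) = 0" if "z \<in> LC" for z
      using h(2) numer_eq[OF that] that by (simp add: algebra_simps)
  qed
  then have eq: "h z = selection_sum transversal z" if "z \<in> LC" for z
    using denom_nonzero that by auto
  let ?p = "real (card (block L i1))" and ?q = "real (card (block L i2))"
  define w where "w b = (if b = block L i1 then ?q else 0) - (if b = block L i2 then ?p else 0)" for b
  define v :: "real ^ 'n" where "v = (\<chi> i. w (block L i))"
  have in_block: "block L i = block L k \<longleftrightarrow> i \<in> block L k" for i k using block_eq_iff[of L k i] by metis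
  have vsum: "(\<Sum>i\<in>UNIV. v $ i) = 0"
  proof -
    have "(\<Sum>i\<in>UNIV. v $ i) = (\<Sum>i\<in>UNIV. if i \<in> block L i1 then ?q else 0) - (\<Sum>i\<in>UNIV. if i \<in> block L i2 then ?p else 0)"
      unfolding v_def w_def in_block by (simp add: sum_subtractf)
    then show ?thesis by (simp add: sum.If_cases)
  qed
  have vblk: "v $ i = v $ j" if "j \<in> block L i" for i j using block_eq[OF that] by (simp add: v_def)
  have on_L: "line t v \<in> LC" for t
    unfolding line_def by (rule complexify_shift[OF origin_mem vsum vblk])
  define \<theta> where "\<theta> = echar (power_weight i1) origin"
  \<comment> \<open>All summands have the same value at the origin, so only the directional speeds matter.\<close>
  have deriv_u: "((\<lambda>t. selection_sum transversal (line t v)) has_field_derivative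
      (\<Sum>i\<in>transversal. \<theta> * (2 * of_real pi * \<i>) * of_real (power_weight i \<bullet> v))) (at 0)"
  proof -
    have \<theta>: "echar (power_weight i) origin = \<theta>" for i unfolding \<theta>_def by (rule echar_uvec_origin)
    have "((\<lambda>t. \<theta> * exp (2 * of_real pi * \<i> * of_real x * t)) has_field_derivative
        \<theta> * (2 * of_real pi * \<i>) * of_real x) (at 0)" for x
      by (auto intro!: derivative_eq_intros)
    then show ?thesis unfolding selection_sum_def echar_line \<theta> by (rule DERIV_sum)
  qed
  have "power_weight i \<bullet> v = real CARD('n) * v $ i" for i
  proof -
    have "power_weight i \<bullet> v = (\<Sum>j\<in>UNIV. if j = i then real CARD('n) * v $ j else 0) - (\<Sum>j\<in>UNIV. v $ j)"
      unfolding inner_vec_def sum_subtractf[symmetric] by (intro sum.cong) (auto simp: power_weight_def algebra_simps)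
    then show ?thesis by (simp add: vsum)
  qed
  then have "(\<Sum>i\<in>transversal. \<theta> * (2 * of_real pi * \<i>) * of_real (power_weight i \<bullet> v))
      = \<theta> * (2 * of_real pi * \<i>) * of_real (real CARD('n) * (\<Sum>i\<in>transversal. v $ i))"
    by (simp add: sum_distrib_left)
  also have "(\<Sum>i\<in>transversal. v $ i) = (\<Sum>b\<in>blocks. w b)"
    using sum.reindex_bij_betw[OF transversal_bij, of w] by (simp add: v_def)
  also have "\<dots> = ?q - ?p"
    unfolding w_def sum_subtractf by simp
  finally have val: "(\<Sum>i\<in>transversal. \<theta> * (2 * of_real pi * \<i>) * of_real (power_weight i \<bullet> v))
      = \<theta> * (2 * of_real pi * \<i>) * of_real (real CARD('n) * (?q - ?p))" .
  have "((\<lambda>t. selection_sum transversal (line t v)) has_field_derivative 0) (at 0)"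
    using invariant_line_derivative[OF h(1) vsum] eq[OF on_L] by simp
  from DERIV_unique[OF deriv_u this] have "\<theta> * (2 * of_real pi * \<i>) * of_real (real CARD('n) * (?q - ?p)) = 0"
    unfolding val .
  then show False using neq by (simp add: \<theta>_def)
qed

end

context flat
begin

theorem normal_iff_equal_blocks:
  "normal_subvariety N (stratum N L) \<longleftrightarrow> (\<forall>i j. card (block L i) = card (block L j))"
  using normal_if_equal_blocks not_normal_if_unequal_blocks by blast

end

theorem proposition9p7:
  fixes n :: nat and N L :: "(real ^ 'n) set"
  assumes "n \<ge> 1" and "CARD('n) = n + 1"
    and "cocharacter_lattice N"
    and "is_flat L"
  shows "normal_subvariety N (stratum N L) \<longleftrightarrow>
         normal_subvariety coroot_lattice (stratum coroot_lattice L)"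
proof -
  have "flat N L" "flat coroot_lattice L"
    using assms cocharacter_coroot_lattice
    by (simp_all add: flat_def flat_axioms_def cocharacters_def)
  then show ?thesis by (simp add: flat.normal_iff_equal_blocks)
qed

end
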